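(* Let $\lambda\in P$ and let $\Gamma_1=(\beta_1,\dots,\beta_r)$ be a $\lambda$-chain. Suppose that for some integers $t\ge 0$ and $q\ge 1$ with $t+q\le r$ the segment $(\beta_{t+1},\dots,\beta_{t+q})$ has the form $(\alpha,\ s_\alpha(\beta),\ s_\alpha s_\beta(\alpha),\ \dots,\ s_\beta(\alpha),\ \beta)$ for some $\alpha,\beta\in\Delta$ with $\langle\alpha,\beta^\vee\rangle\le 0$ and $\alpha\neq-\beta$, and let $\Gamma_2=(\beta'_1,\dots,\beta'_r):=(\beta_1,\dots,\beta_t,\beta_{t+q},\beta_{t+q-1},\dots,\beta_{t+1},\beta_{t+q+1},\dots,\beta_r)$ (this is again a $\lambda$-chain; $\Gamma_2$ is said to be obtained from $\Gamma_1$ by a Yang–Baxter transformation). Fix $w\in W$. Then there exist subsets $\mathcal A_0(w,\Gamma_1)\subseteq\mathcal A(w,\Gamma_1)$ and $\mathcal A_0(w,\Gamma_2)\subseteq\mathcal A(w,\Gamma_2)$ such that: (1) there is a bijection $Y:\mathcal A_0(w,\Gamma_1)\to\mathcal A_0(w,\Gamma_2)$ such that for all $A\in\mathcal A_0(w,\Gamma_1)$: $Y(A)^{(1)}=A^{(1)}$, $\mathrm{end}^{(2)}(Y(A))=\mathrm{end}^{(2)}(A)$, $Y(A)^{(3)}=A^{(3)}$, $\mathrm{down}(Y(A))=\mathrm{down}(A)$, and $(-1)^{n(Y(A))}=(-1)^{n(A)}$; (2) for $k=1,2$, setting $\mathcal A_0^C(w,\Gamma_k):=\mathcal A(w,\Gamma_k)\setminus\mathcal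 A_0(w,\Gamma_k)$, there is an involution $I_k$ on $\mathcal A_0^C(w,\Gamma_k)$ such that for all $A\in\mathcal A_0^C(w,\Gamma_k)$: $I_k(A)^{(1)}=A^{(1)}$, $\mathrm{end}^{(2)}(I_k(A))=\mathrm{end}^{(2)}(A)$, $I_k(A)^{(3)}=A^{(3)}$, $\mathrm{down}(I_k(A))=\mathrm{down}(A)$, and $(-1)^{n(I_k(A))}=-(-1)^{n(A)}$.
   Context: Let $\mathfrak g$ be a complex simple Lie algebra or the complex Lie algebra of type $A_1\times A_1$, with root system $\Delta$, positive roots $\Delta^+$, simple roots $\alpha_i$ ($i\in I$), coroots $\alpha^\vee$, fundamental weights $\varpi_i$, weight lattice $P=\sum_i\mathbb Z\varpi_i$, $\mathfrak h^*_{\mathbb R}=P\otimes_{\mathbb Z}\mathbb R$, $Q^\vee=\sum_i\mathbb Z\alpha_i^\vee$, Weyl group $W$ with length function $\ell$, reflections $s_\alpha$, and $\rho=\frac12\sum_{\alpha\in\Delta^+}\alpha$. For $\alpha\in\Delta$, $\mathrm{sgn}(\alpha)=1$ if $\alpha\in\Delta^+$ and $-1$ otherwise, and $|\alpha|=\mathrm{sgn}(\alpha)\alpha$. Quantum Bruhat graph $\mathrm{QBG}(W)$: vertex set $W$; for $x\in W$, $\gamma\in\Delta^+$ there is an edge $x\xrightarrow{\gamma}xs_\gamma$ iff $\ell(xs_\gamma)=\ell(x)+1$ (Bruhat edge) or $\ell(xs_\gamma)=\ell(x)-2\langle\rho,\gamma^\vee\rangle+1$ (quantum edge). Alcoves: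 for $\alpha\in\Delta$, $k\in\mathbb Z$ let $H_{\alpha,k}=\{\nu\in\mathfrak h^*_{\mathbb R}:\langle\nu,\alpha^\vee\rangle=k\}$ and $s_{\alpha,k}(\nu)=\nu-(\langle\nu,\alpha^\vee\rangle-k)\alpha$. Alcoves are the connected components of the complement of all $H_{\alpha,k}$; two alcoves are adjacent if they share a wall, and $A\xrightarrow{\gamma}B$ ($\gamma\in\Delta$) means their common wall lies in some $H_{\gamma,k}$ and $\gamma$ points from $A$ to $B$. $A_\circ=\{\nu:0<\langle\nu,\alpha^\vee\rangle<1\ \forall\alpha\in\Delta^+\}$ is the fundamental alcove and $A_\mu=A_\circ+\mu$. For $\lambda\in P$, a $\lambda$-chain is a sequence of roots $(\beta_1,\dots,\beta_r)$ for which there are alcoves $A_\circ=A_0\xrightarrow{-\beta_1}A_1\xrightarrow{-\beta_2}\cdots\xrightarrow{-\beta_r}A_r=A_{-\lambda}$ with consecutive alcoves adjacent. Let $l_k\in\mathbb Z$ be such that $H_{\beta_k,-l_k}$ contains the common wall of $A_{k-1},A_k$, and $\tilde l_k=\langle\lambda,\beta_k^\vee\rangle-l_k$. For $w\in W$, $A=\{j_1<\dots<j_p\}\subseteq\{1,\dots,r\}$ is $w$-admissible if $w=w_0\xrightarrow{|\beta_{j_1}|}w_1\xrightarrow{|\beta_{j_2}|}\cdots\xrightarrow{|\beta_{j_p}|}w_p$ is a directed path in $\mathrm{QBG}(W)$ (so $w_k=w_{k-1}s_{|\beta_{j_k}|}$); $\mathcal A(w,\Gamma)$ is the set of such subsets.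 Statistics: $\mathrm{end}(A)=w_p$; $\mathrm{wt}(A)=-w\,s_{\beta_{j_1},-l_{j_1}}\cdots s_{\beta_{j_p},-l_{j_p}}(-\lambda)$; $A^-=\{j_k\in A: w_{k-1}\to w_k\text{ is a quantum edge}\}$; $\mathrm{down}(A)=\sum_{j\in A^-}|\beta_j|^\vee$; $\mathrm{height}(A)=\sum_{j\in A^-}\mathrm{sgn}(\beta_j)\tilde l_j$; $n(A)=\#\{j\in A:\beta_j\in-\Delta^+\}$. For $A$ in $\mathcal A(w,\Gamma_1)$ or $\mathcal A(w,\Gamma_2)$: $A^{(1)}=A\cap\{1,\dots,t\}$, $A^{(2)}=A\cap\{t+1,\dots,t+q\}$, $A^{(3)}=A\cap\{t+q+1,\dots,r\}$, and $\mathrm{end}^{(2)}(A)$ denotes the vertex reached by the path of $A$ after its last step with index in $A^{(1)}\cup A^{(2)}$, i.e. $w\,s_{|\gamma_{j_1}|}\cdots s_{|\gamma_{j_m}|}$ where $j_1<\dots<j_m$ are the elements of $A^{(1)}\cup A^{(2)}$ and $\gamma$ denotes the entries of the relevant chain ($\beta$ for $\Gamma_1$, $\beta'$ for $\Gamma_2$). *)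

theory Defs
  imports "HOL-Analysis.Analysis"
begin

text \<open>
  A complex semisimple Lie algebra enters only through its root system. The real space spanned by
  the weights is a Euclidean space \<open>'a\<close> whose inner product is Weyl group invariant (for example,
  induced by the Killing form). This inner product is also used to identify the space with its
  dual, so coroots are vectors of \<open>'a\<close> and the pairing of a weight with a coroot is \<open>\<bullet>\<close>.
\<close>

subsection \<open>Root systems\<close>

definition coroot :: "'a::euclidean_space \<Rightarrow> 'a" where
  "coroot \<alpha> = (2 / (\<alpha> \<bullet> \<alpha>)) *\<^sub>R \<alpha>"

definition refl :: "'a::euclidean_space \<Rightarrow> 'a \<Rightarrow> 'a" where
  "refl \<alpha> \<nu> = \<nu> - (\<nu> \<bullet> coroot \<alpha>) *\<^sub>R \<alpha>"

definition root_system :: "'a::euclidean_space set \<Rightarrow> bool" where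
  "root_system \<Delta> \<longleftrightarrow>
     finite \<Delta> \<and> 0 \<notin> \<Delta> \<and> span \<Delta> = UNIV \<and>
     (\<forall>\<alpha>\<in>\<Delta>. \<forall>\<beta>\<in>\<Delta>. refl \<alpha> \<beta> \<in> \<Delta>) \<and>
     (\<forall>\<alpha>\<in>\<Delta>. \<forall>\<beta>\<in>\<Delta>. \<beta> \<bullet> coroot \<alpha> \<in> \<int>) \<and>
     (\<forall>\<alpha>\<in>\<Delta>. \<forall>c. c *\<^sub>R \<alpha> \<in> \<Delta> \<longrightarrow> c = 1 \<or> c = -1)"

definition irreducible_root_system :: "'a::euclidean_space set \<Rightarrow> bool" where
  "irreducible_root_system \<Delta> \<longleftrightarrow>
     root_system \<Delta> \<and> \<Delta> \<noteq> {} \<and>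
     \<not> (\<exists>\<Delta>1 \<Delta>2. \<Delta>1 \<noteq> {} \<and> \<Delta>2 \<noteq> {} \<and> \<Delta> = \<Delta>1 \<union> \<Delta>2 \<and> (\<forall>\<alpha>\<in>\<Delta>1. \<forall>\<beta>\<in>\<Delta>2. \<alpha> \<bullet> \<beta> = 0))"

definition root_system_A1xA1 :: "'a::euclidean_space set \<Rightarrow> bool" where
  "root_system_A1xA1 \<Delta> \<longleftrightarrow>
     root_system \<Delta> \<and>
     (\<exists>\<alpha> \<beta>. \<alpha> \<noteq> 0 \<and> \<beta> \<noteq> 0 \<and> \<alpha> \<bullet> \<beta> = 0 \<and> \<Delta> = {\<alpha>, -\<alpha>, \<beta>, -\<beta>})"

definition pos_roots :: "'a::euclidean_space set \<Rightarrow> 'a set \<Rightarrow> 'a set" where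
  "pos_roots \<Delta> S = {\<alpha>\<in>\<Delta>. \<exists>c :: 'a \<Rightarrow> nat. \<alpha> = (\<Sum>\<gamma>\<in>S. real (c \<gamma>) *\<^sub>R \<gamma>)}"

definition simple_roots :: "'a::euclidean_space set \<Rightarrow> 'a set \<Rightarrow> bool" where
  "simple_roots \<Delta> S \<longleftrightarrow>
     S \<subseteq> \<Delta> \<and> independent S \<and> (\<forall>\<alpha>\<in>\<Delta>. \<alpha> \<in> pos_roots \<Delta> S \<or> -\<alpha> \<in> pos_roots \<Delta> S)"

definition root_sgn :: "'a::euclidean_space set \<Rightarrow> 'a set \<Rightarrow> 'a \<Rightarrow> real" where
  "root_sgn \<Delta> S \<alpha> = (if \<alpha> \<in> pos_roots \<Delta> S then 1 else -1)"

definition root_abs :: "'a::euclidean_space set \<Rightarrow> 'a set \<Rightarrow> 'a \<Rightarrow> 'a" where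
  "root_abs \<Delta> S \<alpha> = root_sgn \<Delta> S \<alpha> *\<^sub>R \<alpha>"

definition rho :: "'a::euclidean_space set \<Rightarrow> 'a set \<Rightarrow> 'a" where
  "rho \<Delta> S = (1/2) *\<^sub>R (\<Sum>\<alpha>\<in>pos_roots \<Delta> S. \<alpha>)"

definition fund_weight :: "'a::euclidean_space set \<Rightarrow> 'a \<Rightarrow> 'a" where
  "fund_weight S \<gamma> = (THE v. \<forall>\<delta>\<in>S. v \<bullet> coroot \<delta> = (if \<delta> = \<gamma> then 1 else 0))"

definition weight_lattice :: "'a::euclidean_space set \<Rightarrow> 'a set" where
  "weight_lattice S = {\<Sum>\<gamma>\<in>S. real_of_int (c \<gamma>) *\<^sub>R fund_weight S \<gamma> | c. True}"


subsection \<open>Weyl group and quantum Bruhat graph\<close>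

inductive_set weyl_group :: "'a::euclidean_space set \<Rightarrow> ('a \<Rightarrow> 'a) set" for \<Delta> where
  weyl_id: "id \<in> weyl_group \<Delta>"
| weyl_refl: "w \<in> weyl_group \<Delta> \<Longrightarrow> \<alpha> \<in> \<Delta> \<Longrightarrow> w \<circ> refl \<alpha> \<in> weyl_group \<Delta>"

definition weyl_length :: "'a::euclidean_space set \<Rightarrow> ('a \<Rightarrow> 'a) \<Rightarrow> nat" where
  "weyl_length S w =
     (LEAST n. \<exists>\<gamma>s. length \<gamma>s = n \<and> set \<gamma>s \<subseteq> S \<and> w = foldr (\<lambda>\<gamma> x. refl \<gamma> \<circ> x) \<gamma>s id)"

definition bruhat_edge :: "'a::euclidean_space set \<Rightarrow> 'a set \<Rightarrow> ('a \<Rightarrow> 'a) \<Rightarrow> 'a \<Rightarrow> bool" where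
  "bruhat_edge \<Delta> S x \<gamma> \<longleftrightarrow>
     \<gamma> \<in> pos_roots \<Delta> S \<and> weyl_length S (x \<circ> refl \<gamma>) = weyl_length S x + 1"

definition quantum_edge :: "'a::euclidean_space set \<Rightarrow> 'a set \<Rightarrow> ('a \<Rightarrow> 'a) \<Rightarrow> 'a \<Rightarrow> bool" where
  "quantum_edge \<Delta> S x \<gamma> \<longleftrightarrow>
     \<gamma> \<in> pos_roots \<Delta> S \<and>
     real (weyl_length S (x \<circ> refl \<gamma>)) =
       real (weyl_length S x) - 2 * (rho \<Delta> S \<bullet> coroot \<gamma>) + 1"

text \<open>A path is given by its starting vertex and the list of its edge labels.\<close>

fun qbg_path :: "'a::euclidean_space set \<Rightarrow> 'a set \<Rightarrow> ('a \<Rightarrow> 'a) \<Rightarrow> 'a list \<Rightarrow> bool" where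
  "qbg_path \<Delta> S x [] \<longleftrightarrow> True"
| "qbg_path \<Delta> S x (\<gamma> # \<gamma>s) \<longleftrightarrow>
     (bruhat_edge \<Delta> S x \<gamma> \<or> quantum_edge \<Delta> S x \<gamma>) \<and> qbg_path \<Delta> S (x \<circ> refl \<gamma>) \<gamma>s"

definition path_end :: "('a::euclidean_space \<Rightarrow> 'a) \<Rightarrow> 'a list \<Rightarrow> 'a \<Rightarrow> 'a" where
  "path_end x \<gamma>s = foldl (\<lambda>y \<gamma>. y \<circ> refl \<gamma>) x \<gamma>s"


subsection \<open>Alcoves and chains of roots\<close>

definition root_hyperplane :: "'a::euclidean_space \<Rightarrow> int \<Rightarrow> 'a set" where
  "root_hyperplane \<alpha> k = {\<nu>. \<nu> \<bullet> coroot \<alpha> = real_of_int k}"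

definition alcoves :: "'a::euclidean_space set \<Rightarrow> 'a set set" where
  "alcoves \<Delta> = components (UNIV - (\<Union>\<alpha>\<in>\<Delta>. \<Union>k. root_hyperplane \<alpha> k))"

definition fund_alcove :: "'a::euclidean_space set \<Rightarrow> 'a set \<Rightarrow> 'a set" where
  "fund_alcove \<Delta> S = {\<nu>. \<forall>\<alpha>\<in>pos_roots \<Delta> S. 0 < \<nu> \<bullet> coroot \<alpha> \<and> \<nu> \<bullet> coroot \<alpha> < 1}"

text \<open>A wall of an alcove is a facet of its closure.\<close>

definition common_wall :: "'a::euclidean_space set \<Rightarrow> 'a set \<Rightarrow> 'a set \<Rightarrow> bool" where
  "common_wall A B F \<longleftrightarrow> A \<noteq> B \<and> F facet_of closure A \<and> F facet_of closure B"

text \<open>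
  That \<open>\<gamma>\<close> points from \<open>A\<close> to \<open>B\<close> means that \<open>B\<close> lies on the side of the hyperplane of the
  common wall towards which \<open>\<gamma>\<close> is directed, and \<open>A\<close> on the other side.
\<close>

definition alcove_step :: "'a::euclidean_space set \<Rightarrow> 'a set \<Rightarrow> 'a \<Rightarrow> 'a set \<Rightarrow> bool" where
  "alcove_step \<Delta> A \<gamma> B \<longleftrightarrow>
     A \<in> alcoves \<Delta> \<and> B \<in> alcoves \<Delta> \<and> \<gamma> \<in> \<Delta> \<and>
     (\<exists>F k. common_wall A B F \<and> F \<subseteq> root_hyperplane \<gamma> k \<and>
            (\<forall>\<nu>\<in>A. \<nu> \<bullet> coroot \<gamma> < real_of_int k) \<and> (\<forall>\<nu>\<in>B. real_of_int k < \<nu> \<bullet> coroot \<gamma>))"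

definition weight_chain :: "'a::euclidean_space set \<Rightarrow> 'a set \<Rightarrow> 'a \<Rightarrow> 'a list \<Rightarrow> bool" where
  "weight_chain \<Delta> S \<mu> \<Gamma> \<longleftrightarrow>
     set \<Gamma> \<subseteq> \<Delta> \<and>
     (\<exists>As. length As = length \<Gamma> + 1 \<and>
           As ! 0 = fund_alcove \<Delta> S \<and>
           As ! length \<Gamma> = (\<lambda>\<nu>. \<nu> + - \<mu>) ` fund_alcove \<Delta> S \<and>
           (\<forall>k<length \<Gamma>. alcove_step \<Delta> (As ! k) (- (\<Gamma> ! k)) (As ! (k + 1))))"

text \<open>
  The \<open>n\<close>-th entry, counting from 0, of
  \<open>\<alpha>, s\<^sub>\<alpha>(\<beta>), s\<^sub>\<alpha> s\<^sub>\<beta>(\<alpha>), s\<^sub>\<alpha> s\<^sub>\<beta> s\<^sub>\<alpha>(\<beta>), \<dots>\<close>. The segment stops where \<open>\<beta>\<close> first occurs; continued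
  further, the sequence is periodic, so \<open>\<beta>\<close> alone would not determine its length.
\<close>

fun alternating_root :: "'a::euclidean_space \<Rightarrow> 'a \<Rightarrow> nat \<Rightarrow> 'a" where
  "alternating_root \<alpha> \<beta> 0 = \<alpha>"
| "alternating_root \<alpha> \<beta> (Suc n) = refl \<alpha> (alternating_root \<beta> \<alpha> n)"

definition yb_segment :: "'a::euclidean_space \<Rightarrow> 'a \<Rightarrow> 'a list" where
  "yb_segment \<alpha> \<beta> =
     map (alternating_root \<alpha> \<beta>) [0..<Suc (LEAST n. alternating_root \<alpha> \<beta> n = \<beta>)]"


subsection \<open>Admissible subsets\<close>

text \<open>Subsets consist of positions counted from 1, so position \<open>j\<close> refers to \<open>\<Gamma> ! (j - 1)\<close>.\<close>

definition labels :: "'a::euclidean_space set \<Rightarrow> 'a set \<Rightarrow> 'a list \<Rightarrow> nat set \<Rightarrow> 'a list" where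
  "labels \<Delta> S \<Gamma> A = map (\<lambda>j. root_abs \<Delta> S (\<Gamma> ! (j - 1))) (sorted_list_of_set A)"

definition admissible ::
    "'a::euclidean_space set \<Rightarrow> 'a set \<Rightarrow> ('a \<Rightarrow> 'a) \<Rightarrow> 'a list \<Rightarrow> nat set set" where
  "admissible \<Delta> S w \<Gamma> = {A. A \<subseteq> {1..length \<Gamma>} \<and> qbg_path \<Delta> S w (labels \<Delta> S \<Gamma> A)}"

definition quantum_steps ::
    "'a::euclidean_space set \<Rightarrow> 'a set \<Rightarrow> ('a \<Rightarrow> 'a) \<Rightarrow> 'a list \<Rightarrow> nat set \<Rightarrow> nat set" where
  "quantum_steps \<Delta> S w \<Gamma> A =
     {j\<in>A. quantum_edge \<Delta> S (path_end w (labels \<Delta> S \<Gamma> {i\<in>A. i < j}))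
             (root_abs \<Delta> S (\<Gamma> ! (j - 1)))}"

definition down ::
    "'a::euclidean_space set \<Rightarrow> 'a set \<Rightarrow> ('a \<Rightarrow> 'a) \<Rightarrow> 'a list \<Rightarrow> nat set \<Rightarrow> 'a" where
  "down \<Delta> S w \<Gamma> A =
     (\<Sum>j\<in>quantum_steps \<Delta> S w \<Gamma> A. coroot (root_abs \<Delta> S (\<Gamma> ! (j - 1))))"

definition neg_count ::
    "'a::euclidean_space set \<Rightarrow> 'a set \<Rightarrow> 'a list \<Rightarrow> nat set \<Rightarrow> nat" where
  "neg_count \<Delta> S \<Gamma> A = card {j\<in>A. \<Gamma> ! (j - 1) \<in> uminus ` pos_roots \<Delta> S}"

definition part1 :: "nat \<Rightarrow> nat set \<Rightarrow> nat set" where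
  "part1 t A = A \<inter> {1..t}"

definition part2 :: "nat \<Rightarrow> nat \<Rightarrow> nat set \<Rightarrow> nat set" where
  "part2 t q A = A \<inter> {t + 1..t + q}"

definition part3 :: "nat \<Rightarrow> nat \<Rightarrow> nat \<Rightarrow> nat set \<Rightarrow> nat set" where
  "part3 t q r A = A \<inter> {t + q + 1..r}"

definition end2 ::
    "'a::euclidean_space set \<Rightarrow> 'a set \<Rightarrow> ('a \<Rightarrow> 'a) \<Rightarrow> 'a list \<Rightarrow> nat \<Rightarrow> nat \<Rightarrow> nat set
       \<Rightarrow> 'a \<Rightarrow> 'a" where
  "end2 \<Delta> S w \<Gamma> t q A = path_end w (labels \<Delta> S \<Gamma> (part1 t A \<union> part2 t q A))"

end

theory Submission
  imports Defs
begin

text \<open>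
  Pairing off subsets of opposite sign reduces the claim to a signed count: for given \<open>A\<^sup>(\<^sup>1\<^sup>)\<close>, end
  vertex of the segment, \<open>A\<^sup>(\<^sup>3\<^sup>)\<close> and \<open>down(A)\<close>, the sums of \<open>(-1)\<close> to the power \<open>n(A)\<close> over the
  admissible subsets of \<open>\<Gamma>\<^sub>1\<close> and of \<open>\<Gamma>\<^sub>2\<close> agree. With \<open>down(A)\<close> recorded by exponentials, this is the
  Yang--Baxter equation for the operators \<open>w \<mapsto> w + sgn(\<beta>) Q w s\<^sub>\<beta>\<close>, where \<open>Q\<close> is the weight of the edge
  from \<open>w\<close> to \<open>w s\<^sub>\<beta>\<close> in the quantum Bruhat graph, or 0. After conjugation by \<open>b\<close> to the power \<open>\<ell>\<close>,
  these operators are limits of \<open>w \<mapsto> w + b\<^sup>-\<^sup>1 (1 / (1 - q\<^sup>\<beta>) - [w\<beta> < 0]) w s\<^sub>\<beta>\<close> as \<open>b\<close> and \<open>q\<close> tend to 0,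
  \<open>q\<close> in the direction \<open>2\<rho>\<close>. The sign \<open>sgn(\<beta>)\<close> appears by itself, because the coefficient is odd in \<open>\<beta>\<close>.
  Composed with \<open>s\<^sub>\<beta>\<close>, the deformed operators become \<open>T\<^sub>\<beta> + 1 / (1 - q\<^sup>\<beta>)\<close> for generators \<open>T\<^sub>\<beta>\<close> of a dihedral
  Hecke algebra, and their Yang--Baxter equation follows from the braid relation and from
  \<open>f(x) f(y) = f(xy) (f(x) + f(y) - 1)\<close> for \<open>f(x) = 1 / (1 - x)\<close>.
\<close>

section \<open>Root systems and Weyl groups\<close>

text \<open>The coefficients of the limit operators depend on lengths in all of \<open>W\<close>,
  which the dihedral subgroup of \<alpha> and \<beta> does not control. The deformed coefficients
  see only the sign of \<open>w \<gamma>\<close> and the number \<open>1 / (1 - q^\<gamma>)\<close>,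
  so their Yang--Baxter equation is a rank-two computation. The direction 2\<rho> is forced by the
  quantum edges. Let \<open>b = e^(-n)\<close> and let \<gamma> be positive. If
  \<open>w \<gamma>\<close> is negative, the coefficient is up to sign-free factors
  \<open>q^\<gamma> / (1 - q^\<gamma>)\<close>, and its decay rate in \<open>n\<close> is \<open>2
  \<langle>\<rho>, \<gamma>\<^sup>\<or>\<rangle> + \<ell>(w s_\<gamma>) - \<ell>(w) - 1\<close>.
  This number is never negative and vanishes exactly at quantum edges. If \<open>w \<gamma>\<close>
  is positive, the rate is \<open>\<ell>(w s_\<gamma>) - \<ell>(w) - 1\<close>, which vanishes
  exactly at Bruhat edges. The facts about Weyl groups needed for this are the comparison of lengths
  by the sign of \<open>w \<gamma>\<close> and the bound \<open>\<ell>(s_\<gamma>) + 1 \<le> 2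
  \<langle>\<rho>, \<gamma>\<^sup>\<or>\<rangle>\<close>. The bounded part \<open>y\<close> of the
  exponent stays free, and varying it separates the values of \<open>down\<close>.\<close>

lemma coroot_minus: "coroot (- \<alpha>) = - coroot \<alpha>"
  by (simp add: coroot_def)

lemma refl_minus_root: "refl (- \<alpha>) = refl \<alpha>"
  by (rule ext) (simp add: refl_def coroot_minus)

lemma linear_refl: "linear (refl \<alpha>)"
  unfolding refl_def by (rule linearI) (simp_all add: algebra_simps inner_left_distrib)

lemma inner_coroot_self: "\<alpha> \<noteq> 0 \<Longrightarrow> \<alpha> \<bullet> coroot \<alpha> = 2"
  by (simp add: coroot_def)

lemma refl_self: "\<alpha> \<noteq> 0 \<Longrightarrow> refl \<alpha> \<alpha> = - \<alpha>"
  by (simp add: refl_def inner_coroot_self scaleR_2)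

lemma refl_refl: "\<alpha> \<noteq> 0 \<Longrightarrow> refl \<alpha> (refl \<alpha> v) = v"
  by (simp add: refl_def inner_coroot_self inner_diff_left algebra_simps)

lemma refl_comp_refl: "\<alpha> \<noteq> 0 \<Longrightarrow> refl \<alpha> \<circ> refl \<alpha> = id"
  by (rule ext) (simp add: refl_refl)

lemma inner_refl_refl:
  assumes "\<alpha> \<noteq> 0"
  shows "refl \<alpha> x \<bullet> refl \<alpha> y = x \<bullet> y"
proof -
  have "\<alpha> \<bullet> \<alpha> \<noteq> 0" using assms by simp
  then show ?thesis
    by (simp add: refl_def coroot_def inner_diff_left inner_diff_right inner_commute field_simps)
qed

lemma coroot_isometry:
  assumes "linear w" and "\<And>x y. w x \<bullet> w y = x \<bullet> y"
  shows "coroot (w \<gamma>) = w (coroot \<gamma>)"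
  by (simp add: coroot_def assms linear_cmul)

lemma refl_isometry:
  assumes "linear w" and "\<And>x y. w x \<bullet> w y = x \<bullet> y"
  shows "refl (w \<gamma>) \<circ> w = w \<circ> refl \<gamma>"
proof (rule ext)
  fix v
  have "(refl (w \<gamma>) \<circ> w) v = w v - (w v \<bullet> w (coroot \<gamma>)) *\<^sub>R w \<gamma>"
    by (simp add: refl_def coroot_isometry[OF assms])
  also have "\<dots> = (w \<circ> refl \<gamma>) v"
    by (simp add: assms(2) refl_def linear_diff[OF assms(1)] linear_cmul[OF assms(1)])
  finally show "(refl (w \<gamma>) \<circ> w) v = (w \<circ> refl \<gamma>) v" .
qed

definition refl_word :: "'a::euclidean_space list \<Rightarrow> 'a \<Rightarrow> 'a" where
  "refl_word \<gamma>s = foldr (\<lambda>\<gamma> x. refl \<gamma> \<circ> x) \<gamma>s id"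

lemma refl_word_Nil [simp]: "refl_word [] = id"
  and refl_word_Cons [simp]: "refl_word (\<gamma> # \<gamma>s) = refl \<gamma> \<circ> refl_word \<gamma>s"
  by (simp_all add: refl_word_def)

lemma refl_word_append: "refl_word (xs @ ys) = refl_word xs \<circ> refl_word ys"
  by (induction xs) (auto simp: o_assoc)

lemma refl_word_isometry:
  assumes "0 \<notin> set \<gamma>s"
  shows "linear (refl_word \<gamma>s)" "refl_word \<gamma>s x \<bullet> refl_word \<gamma>s y = x \<bullet> y"
  using assms
proof (induction \<gamma>s arbitrary: x y)
  case (Cons a xs)
  { case 1
    then have "linear (refl_word xs)" using Cons.IH(1) by simp
    from linear_compose[OF this linear_refl[of a]] show ?case by (simp only: refl_word_Cons) }
  { case 2
    then have "a \<noteq> 0" "0 \<notin> set xs" by auto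
    then show ?case using Cons.IH(2)[of x y] inner_refl_refl[of a "refl_word xs x"] by simp }
qed (auto simp: linear_iff)

locale based_root_system =
  fixes \<Delta> S :: "'a::euclidean_space set"
  assumes root_system: "root_system \<Delta>" and simple_roots: "simple_roots \<Delta> S"
begin

abbreviation "pos \<equiv> pos_roots \<Delta> S"
abbreviation "W \<equiv> weyl_group \<Delta>"
abbreviation "len \<equiv> weyl_length S"

lemma finite_roots: "finite \<Delta>"
  and zero_notin: "0 \<notin> \<Delta>"
  and refl_root: "\<alpha> \<in> \<Delta> \<Longrightarrow> \<beta> \<in> \<Delta> \<Longrightarrow> refl \<alpha> \<beta> \<in> \<Delta>"
  and root_pairing_Ints: "\<alpha> \<in> \<Delta> \<Longrightarrow> \<beta> \<in> \<Delta> \<Longrightarrow> \<beta> \<bullet> coroot \<alpha> \<in> \<int>"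
  and root_multiple: "\<alpha> \<in> \<Delta> \<Longrightarrow> c *\<^sub>R \<alpha> \<in> \<Delta> \<Longrightarrow> c = 1 \<or> c = -1"
  using root_system unfolding root_system_def by blast+

lemma root_nonzero: "\<alpha> \<in> \<Delta> \<Longrightarrow> \<alpha> \<noteq> 0"
  using zero_notin by blast

lemma simple_subset: "S \<subseteq> \<Delta>" and independent_simple: "independent S"
  and root_pos_or_neg: "\<alpha> \<in> \<Delta> \<Longrightarrow> \<alpha> \<in> pos \<or> - \<alpha> \<in> pos"
  using simple_roots unfolding simple_roots_def by blast+

lemma finite_simple: "finite S"
  using independent_simple by (rule independent_imp_finite)

lemma neg_root: "\<alpha> \<in> \<Delta> \<Longrightarrow> - \<alpha> \<in> \<Delta>"
  using refl_root[of \<alpha> \<alpha>] refl_self[OF root_nonzero] by simp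

lemma pos_subset: "pos \<subseteq> \<Delta>"
  by (auto simp: pos_roots_def)

lemma finite_pos: "finite pos"
  using pos_subset finite_roots by (rule finite_subset)

section \<open>Coordinates and heights with respect to the simple roots\<close>

definition coord :: "'a \<Rightarrow> 'a \<Rightarrow> real" where
  "coord b = (SOME f. linear f \<and> (\<forall>b'\<in>S. f b' = (if b' = b then 1 else 0)))"

lemma coord: "linear (coord b)" "b' \<in> S \<Longrightarrow> coord b b' = (if b' = b then 1 else 0)"
proof -
  have "\<exists>f. linear f \<and> (\<forall>b'\<in>S. f b' = (if b' = b then 1 else (0::real)))"
    using linear_independent_extend[OF independent_simple] .
  from someI_ex[OF this] show "linear (coord b)" "b' \<in> S \<Longrightarrow> coord b b' = (if b' = b then 1 else 0)"
    unfolding coord_def[symmetric] by auto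
qed

lemma coord_sum:
  assumes "b \<in> S"
  shows "coord b (\<Sum>\<gamma>\<in>S. c \<gamma> *\<^sub>R \<gamma>) = c b"
proof -
  have "coord b (\<Sum>\<gamma>\<in>S. c \<gamma> *\<^sub>R \<gamma>) = (\<Sum>\<gamma>\<in>S. c \<gamma> * coord b \<gamma>)"
    by (simp add: linear_sum[OF coord(1)] linear_cmul[OF coord(1)])
  also have "\<dots> = (\<Sum>\<gamma>\<in>S. if \<gamma> = b then c \<gamma> else 0)"
    by (intro sum.cong) (auto simp: coord(2))
  finally show ?thesis using assms finite_simple by simp
qed

lemma pos_expansion:
  assumes "\<gamma> \<in> pos"
  shows "\<gamma> = (\<Sum>b\<in>S. coord b \<gamma> *\<^sub>R b)" and "b \<in> S \<Longrightarrow> coord b \<gamma> \<in> \<nat>"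
proof -
  obtain c :: "'a \<Rightarrow> nat" where c: "\<gamma> = (\<Sum>b\<in>S. real (c b) *\<^sub>R b)"
    using assms by (auto simp: pos_roots_def)
  have "coord b \<gamma> = real (c b)" if "b \<in> S" for b
    unfolding c using that by (rule coord_sum)
  then show "\<gamma> = (\<Sum>b\<in>S. coord b \<gamma> *\<^sub>R b)" "b \<in> S \<Longrightarrow> coord b \<gamma> \<in> \<nat>"
    by (auto simp: c[symmetric] cong: sum.cong)
qed

lemma coord_pos_nonneg: "\<gamma> \<in> pos \<Longrightarrow> b \<in> S \<Longrightarrow> coord b \<gamma> \<ge> 0"
  using pos_expansion(2) by (metis Nats_cases of_nat_0_le_iff)

text \<open>Its sign on a root decides positivity. Being linear, it turns later sign questions into
  inequalities between real numbers, also for combinations of roots.\<close>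

definition ht :: "'a \<Rightarrow> real" where "ht v = (\<Sum>b\<in>S. coord b v)"

lemma linear_ht: "linear ht"
  unfolding ht_def by (intro linear_compose_sum ballI coord)

lemma ht_pos_nat:
  assumes "\<gamma> \<in> pos"
  shows "ht \<gamma> \<in> \<nat>"
proof -
  have "(\<Sum>b\<in>B. coord b \<gamma>) \<in> \<nat>" if "B \<subseteq> S" for B
    using that by (induction B rule: infinite_finite_induct) (auto intro!: Nats_add pos_expansion(2)[OF assms])
  then show ?thesis by (simp add: ht_def)
qed

lemma ht_pos: 
  assumes "\<gamma> \<in> pos" shows "ht \<gamma> > 0"
proof (rule ccontr)
  assume "\<not> ht \<gamma> > 0"
  moreover have "ht \<gamma> \<ge> 0" unfolding ht_def by (intro sum_nonneg coord_pos_nonneg assms)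
  ultimately have "ht \<gamma> = 0" by simp
  then have "\<forall>b\<in>S. coord b \<gamma> = 0"
    unfolding ht_def using coord_pos_nonneg[OF assms] finite_simple by (simp add: sum_nonneg_eq_0_iff)
  then have "\<gamma> = 0" using pos_expansion(1)[OF assms] by simp
  then show False using assms pos_subset zero_notin by auto
qed

lemma ht_uminus: "ht (- v) = - ht v"
  by (rule linear_neg[OF linear_ht])

lemma pos_iff_ht: "\<gamma> \<in> \<Delta> \<Longrightarrow> \<gamma> \<in> pos \<longleftrightarrow> ht \<gamma> > 0"
  using ht_pos root_pos_or_neg ht_uminus by (metis neg_0_less_iff_less not_less_iff_gr_or_eq)

lemma neg_pos_iff_ht: "\<gamma> \<in> \<Delta> \<Longrightarrow> - \<gamma> \<in> pos \<longleftrightarrow> ht \<gamma> < 0"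
  using pos_iff_ht[OF neg_root] ht_uminus by simp

lemma ht_root_nonzero: "\<gamma> \<in> \<Delta> \<Longrightarrow> ht \<gamma> \<noteq> 0"
  using pos_iff_ht neg_pos_iff_ht root_pos_or_neg by fastforce

lemma simple_pos: "b \<in> S \<Longrightarrow> b \<in> pos"
  using pos_iff_ht simple_subset coord(2) finite_simple
  by (auto simp: ht_def subset_iff)

text \<open>Reflecting in \<open>b\<close> changes only the \<open>b\<close>-coordinate. If the
  image were negative, every other coordinate of \<open>\<gamma>\<close> would be both nonnegative
  and nonpositive, so \<open>\<gamma>\<close> would be a multiple of \<open>b\<close>, hence
  \<open>b\<close> itself.\<close>

lemma simple_refl_pos:
  assumes b: "b \<in> S" and g: "\<gamma> \<in> pos" "\<gamma> \<noteq> b"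
  shows "refl b \<gamma> \<in> pos"
proof (rule ccontr)
  assume n: "refl b \<gamma> \<notin> pos"
  have bD: "b \<in> \<Delta>" and gD: "\<gamma> \<in> \<Delta>" using b g simple_subset pos_subset by auto
  have np: "- refl b \<gamma> \<in> pos" using n root_pos_or_neg refl_root bD gD by blast
  have c: "coord b' \<gamma> = 0" if "b' \<in> S" "b' \<noteq> b" for b'
  proof -
    have "coord b' (- refl b \<gamma>) = - coord b' \<gamma>"
      using that b by (simp add: refl_def linear_diff[OF coord(1)] linear_neg[OF coord(1)] linear_cmul[OF coord(1)] coord(2))
    then show ?thesis using coord_pos_nonneg[OF np that(1)] coord_pos_nonneg[OF g(1) that(1)] by simp
  qed
  have "\<gamma> = (\<Sum>b'\<in>S. if b' = b then coord b' \<gamma> *\<^sub>R b' else 0)"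
    using c by (subst pos_expansion(1)[OF g(1)]) (auto intro!: sum.cong)
  then have e: "\<gamma> = coord b \<gamma> *\<^sub>R b" using b finite_simple by simp
  then have "coord b \<gamma> = 1 \<or> coord b \<gamma> = -1" using root_multiple[OF bD] gD by metis
  then have "coord b \<gamma> = 1" using coord_pos_nonneg[OF g(1) b] by auto
  then show False using e g(2) by simp
qed

text \<open>Expanding one factor of \<open>\<gamma> \<bullet> \<gamma> > 0\<close> in simple roots
  with nonnegative coefficients leaves a positive inner product. Such a \<open>b\<close> lowers the
  height in \<open>pos_root_refl_word\<close>.\<close>

lemma exists_simple_pairing_pos:
  assumes g: "\<gamma> \<in> pos"
  obtains b where "b \<in> S" "\<gamma> \<bullet> coroot b > 0"
proof (rule ccontr)
  note found = that
  assume "\<not> thesis"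
  then have n: "\<gamma> \<bullet> coroot b \<le> 0" if "b \<in> S" for b
    using found[OF that] by linarith
  have "\<gamma> \<bullet> b \<le> 0" if "b \<in> S" for b
  proof -
    have "b \<bullet> b > 0" using that simple_subset root_nonzero by auto
    then show ?thesis using n[OF that] by (simp add: coroot_def divide_simps mult_le_0_iff) 
  qed
  then have "(\<Sum>b\<in>S. coord b \<gamma> * (\<gamma> \<bullet> b)) \<le> 0"
    using coord_pos_nonneg[OF g] by (intro sum_nonpos) (simp add: mult_nonneg_nonpos)
  also have "(\<Sum>b\<in>S. coord b \<gamma> * (\<gamma> \<bullet> b)) = \<gamma> \<bullet> (\<Sum>b\<in>S. coord b \<gamma> *\<^sub>R b)"
    by (simp add: inner_sum_right)
  also have "\<dots> = \<gamma> \<bullet> \<gamma>"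
    using pos_expansion(1)[OF g] by simp
  finally have "\<not> \<gamma> \<bullet> \<gamma> > 0" by linarith
  moreover have "\<gamma> \<noteq> 0" using g pos_subset root_nonzero by blast
  ultimately show False by simp
qed

section \<open>Reduced words and the effect of reflections on lengths\<close>

lemma refl_word_root: "set \<gamma>s \<subseteq> \<Delta> \<Longrightarrow> \<gamma> \<in> \<Delta> \<Longrightarrow> refl_word \<gamma>s \<gamma> \<in> \<Delta>"
  by (induction \<gamma>s) (auto intro: refl_root)

lemma refl_word_linear: "set \<gamma>s \<subseteq> \<Delta> \<Longrightarrow> linear (refl_word \<gamma>s)"
  and refl_word_inner: "set \<gamma>s \<subseteq> \<Delta> \<Longrightarrow> refl_word \<gamma>s x \<bullet> refl_word \<gamma>s y = x \<bullet> y"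
  using zero_notin by (auto intro!: refl_word_isometry)

text \<open>Induction on the height, a natural number on positive roots. For a simple
  \<open>b\<close> with positive pairing, \<open>refl b \<gamma>\<close> is a positive root of
  smaller height, and its reflection conjugated by \<open>refl b\<close> is
  \<open>refl \<gamma>\<close>.\<close>

lemma pos_root_refl_word:
  assumes "\<gamma> \<in> pos"
  shows "\<exists>xs. set xs \<subseteq> S \<and> refl \<gamma> = refl_word xs"
  using assms
proof (induction "nat \<lfloor>ht \<gamma>\<rfloor>" arbitrary: \<gamma> rule: less_induct)
  case less
  show ?case
  proof (cases "\<gamma> \<in> S")
    case True
    then show ?thesis by (intro exI[of _ "[\<gamma>]"]) simp
  next
    case False
    obtain b where b: "b \<in> S" "\<gamma> \<bullet> coroot b > 0" using exists_simple_pairing_pos[OF less.prems] .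
    have g': "refl b \<gamma> \<in> pos" using simple_refl_pos b less.prems False by metis
    have "ht (refl b \<gamma>) = ht \<gamma> - (\<gamma> \<bullet> coroot b) * ht b"
      by (simp add: refl_def linear_diff[OF linear_ht] linear_cmul[OF linear_ht])
    then have lt: "ht (refl b \<gamma>) < ht \<gamma>"
      using b ht_pos[OF simple_pos] by simp
    obtain m n where mn: "ht (refl b \<gamma>) = real m" "ht \<gamma> = real n"
      using ht_pos_nat g' less.prems by (metis Nats_cases)
    have "nat \<lfloor>ht (refl b \<gamma>)\<rfloor> < nat \<lfloor>ht \<gamma>\<rfloor>" using lt unfolding mn by simp
    from less.hyps[OF this g'] obtain xs where xs: "set xs \<subseteq> S" "refl (refl b \<gamma>) = refl_word xs" by blast
    have b0: "b \<noteq> 0" using b simple_subset root_nonzero by auto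
    have "refl (refl b (refl b \<gamma>)) \<circ> refl b = refl b \<circ> refl (refl b \<gamma>)"
      by (rule refl_isometry) (auto simp: linear_refl inner_refl_refl b0)
    then have "refl \<gamma> \<circ> (refl b \<circ> refl b) = refl b \<circ> refl (refl b \<gamma>) \<circ> refl b"
      by (simp add: refl_refl b0 o_assoc)
    then have "refl \<gamma> = refl_word (b # xs @ [b])"
      by (simp add: refl_comp_refl b0 refl_word_append xs o_assoc)
    then show ?thesis using xs b by (intro exI[of _ "b # xs @ [b]"]) auto
  qed
qed

lemma root_refl_word: "\<gamma> \<in> \<Delta> \<Longrightarrow> \<exists>xs. set xs \<subseteq> S \<and> refl \<gamma> = refl_word xs"
  using pos_root_refl_word root_pos_or_neg refl_minus_root by metis

lemma weyl_word: "w \<in> W \<Longrightarrow> \<exists>xs. set xs \<subseteq> S \<and> w = refl_word xs"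
proof (induction rule: weyl_group.induct)
  case weyl_id
  then show ?case by (intro exI[of _ "[]"]) simp
next
  case (weyl_refl w \<alpha>)
  then obtain xs ys where "set xs \<subseteq> S" "w = refl_word xs" "set ys \<subseteq> S" "refl \<alpha> = refl_word ys"
    using root_refl_word by metis
  then show ?case by (intro exI[of _ "xs @ ys"]) (auto simp: refl_word_append)
qed

lemma
  assumes "w \<in> W"
  shows weyl_linear: "linear w" and weyl_inner: "w x \<bullet> w y = x \<bullet> y"
    and weyl_root: "\<gamma> \<in> \<Delta> \<Longrightarrow> w \<gamma> \<in> \<Delta>"
proof -
  obtain xs where xs: "set xs \<subseteq> \<Delta>" "w = refl_word xs"
    using weyl_word[OF assms] simple_subset by blast
  then show "linear w" "w x \<bullet> w y = x \<bullet> y" "\<gamma> \<in> \<Delta> \<Longrightarrow> w \<gamma> \<in> \<Delta>"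
    using refl_word_linear refl_word_inner refl_word_root by auto
qed

lemma length_refl_word_le: "set xs \<subseteq> S \<Longrightarrow> len (refl_word xs) \<le> length xs"
  unfolding weyl_length_def refl_word_def by (rule Least_le) blast

lemma reduced_word:
  assumes "w \<in> W"
  obtains xs where "set xs \<subseteq> S" "w = refl_word xs" "length xs = len w"
proof -
  let ?P = "\<lambda>n. \<exists>\<gamma>s. length \<gamma>s = n \<and> set \<gamma>s \<subseteq> S \<and> w = foldr (\<lambda>\<gamma> x. refl \<gamma> \<circ> x) \<gamma>s id"
  obtain xs where "set xs \<subseteq> S" "w = refl_word xs" using weyl_word[OF assms] by blast
  then have "?P (length xs)" unfolding refl_word_def by blast
  then have "?P (LEAST n. ?P n)" by (rule LeastI)
  then show ?thesis using that unfolding weyl_length_def[symmetric] refl_word_def by blast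
qed

text \<open>Reading a word for \<open>w\<close> from the right, the image of \<open>\<gamma>\<close> changes sign at some letter, which
  can be deleted to obtain a word for \<open>w s\<^sub>\<gamma>\<close>.\<close>

lemma strong_exchange:
  assumes "set xs \<subseteq> S" "\<gamma> \<in> pos" "refl_word xs \<gamma> \<notin> pos"
  shows "\<exists>ys. set ys \<subseteq> S \<and> length xs = Suc (length ys) \<and> refl_word xs \<circ> refl \<gamma> = refl_word ys"
  using assms
proof (induction xs)
  case (Cons a xs)
  have aD: "a \<in> \<Delta>" and a0: "a \<noteq> 0" and aS: "a \<in> S"
    using Cons.prems simple_subset root_nonzero by auto
  have xD: "set xs \<subseteq> \<Delta>" using Cons.prems simple_subset by auto
  show ?case
  proof (cases "refl_word xs \<gamma> \<in> pos")
    case True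
    then have "refl_word xs \<gamma> = a"
      using Cons.prems simple_refl_pos[OF aS] by auto
    then have "refl a \<circ> refl_word xs = refl_word xs \<circ> refl \<gamma>"
      using refl_isometry[OF refl_word_linear[OF xD] refl_word_inner[OF xD], of \<gamma>] by simp
    then have "refl_word (a # xs) \<circ> refl \<gamma> = refl a \<circ> (refl a \<circ> refl_word xs)"
      by (metis o_assoc refl_word_Cons)
    also have "\<dots> = refl_word xs" by (simp add: o_assoc refl_comp_refl a0)
    finally have "refl_word (a # xs) \<circ> refl \<gamma> = refl_word xs" .
    then show ?thesis using Cons.prems(1) by (metis length_Cons set_subset_Cons subset_trans)
  next
    case False
    then obtain ys where "set ys \<subseteq> S" "length xs = Suc (length ys)" "refl_word xs \<circ> refl \<gamma> = refl_word ys"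
      using Cons.IH[OF _ Cons.prems(2)] Cons.prems(1) by (metis set_subset_Cons subset_trans)
    moreover have "refl_word (a # xs) \<circ> refl \<gamma> = refl a \<circ> (refl_word xs \<circ> refl \<gamma>)"
      by (simp only: refl_word_Cons comp_assoc)
    ultimately have "refl_word (a # xs) \<circ> refl \<gamma> = refl_word (a # ys)"
      by (simp only: refl_word_Cons)
    moreover have "set (a # ys) \<subseteq> S" "length (a # xs) = Suc (length (a # ys))"
      using aS \<open>set ys \<subseteq> S\<close> \<open>length xs = Suc (length ys)\<close> by auto
    ultimately show ?thesis by blast
  qed
qed simp

lemma len_refl_less:
  assumes "w \<in> W" "\<gamma> \<in> pos" "w \<gamma> \<notin> pos"
  shows "len (w \<circ> refl \<gamma>) < len w"
proof -
  obtain xs where xs: "set xs \<subseteq> S" "w = refl_word xs" "length xs = len w"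
    using reduced_word[OF assms(1)] .
  obtain ys where "set ys \<subseteq> S" "length xs = Suc (length ys)" "refl_word xs \<circ> refl \<gamma> = refl_word ys"
    using strong_exchange[OF xs(1) assms(2)] assms(3) xs(2) by auto
  then show ?thesis using length_refl_word_le[of ys] xs by simp
qed

lemma comp_refl_refl: "\<gamma> \<in> \<Delta> \<Longrightarrow> w \<circ> refl \<gamma> \<circ> refl \<gamma> = w"
  by (simp add: o_assoc[symmetric] refl_comp_refl root_nonzero)

text \<open>Apply \<open>len_refl_less\<close> to \<open>w \<circ> refl \<gamma>\<close>, which
  sends \<open>\<gamma>\<close> to \<open>- w \<gamma>\<close>, and cancel the double
  reflection.\<close>

lemma len_refl_greater:
  assumes "w \<in> W" "\<gamma> \<in> pos" "w \<gamma> \<in> pos"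
  shows "len w < len (w \<circ> refl \<gamma>)"
proof -
  have gD: "\<gamma> \<in> \<Delta>" using assms pos_subset by auto
  have "(w \<circ> refl \<gamma>) \<gamma> = - w \<gamma>"
    using refl_self[OF root_nonzero[OF gD]] linear_neg[OF weyl_linear[OF assms(1)]] by simp
  then have "(w \<circ> refl \<gamma>) \<gamma> \<notin> pos"
    using assms ht_pos ht_uminus by (metis less_asym neg_0_less_iff_less)
  from len_refl_less[OF weyl_refl[OF assms(1) gD] assms(2) this] show ?thesis
    by (simp only: comp_refl_refl[OF gD])
qed

section \<open>Inversion counts and the bound of reflection lengths by \<rho>\<close>

definition inversions :: "('a \<Rightarrow> 'a) \<Rightarrow> 'a set" where
  "inversions w = {\<gamma> \<in> pos. w \<gamma> \<notin> pos}"

text \<open>Split off the last letter \<open>b\<close> of a reduced word,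
  \<open>w = v \<circ> refl b\<close>. The reflection in \<open>b\<close> permutes the positive
  roots other than \<open>b\<close>, so it carries the inversions of \<open>v\<close> to those of
  \<open>w\<close> except \<open>b\<close>, which is new.\<close>

lemma card_inversions:
  assumes "w \<in> W"
  shows "card (inversions w) = len w"
  using assms
proof (induction "len w" arbitrary: w)
  case 0
  have "inversions w = {}"
    using len_refl_less[OF 0(2)] 0(1) by (auto simp: inversions_def)
  then show ?case using 0 by simp
next
  case (Suc n)
  obtain xs where xs: "set xs \<subseteq> S" "w = refl_word xs" "length xs = len w"
    using reduced_word[OF Suc.prems] .
  then obtain ys b where ys: "xs = ys @ [b]" using Suc.hyps(2) by (cases xs rule: rev_cases) auto
  define v where "v = w \<circ> refl b"
  have b: "b \<in> S" "b \<in> \<Delta>" "b \<in> pos" "b \<noteq> 0" 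
    using xs ys simple_subset simple_pos root_nonzero by auto
  have v: "v \<in> W" unfolding v_def using Suc.prems b by (intro weyl_refl)
  have wv: "w = v \<circ> refl b" unfolding v_def using comp_refl_refl[OF b(2), of w] by (rule sym)
  have "v = refl_word ys"
    unfolding v_def xs ys by (simp add: refl_word_append comp_refl_refl b)
  then have le: "len v \<le> n" using length_refl_word_le[of ys] xs ys Suc.hyps(2) by auto
  have vb: "v b \<in> pos"
    using len_refl_less[OF v b(3)] le Suc.hyps(2) wv by fastforce
  have wb: "w b \<notin> pos"
    using len_refl_greater[OF Suc.prems b(3)] le Suc.hyps(2) v_def by fastforce
  \<comment> \<open>Appending \<open>b\<close> to a shorter word for \<open>v\<close> would give a
    word for \<open>w\<close> shorter than \<open>len w\<close>.\<close>
  have "n \<le> len v"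
  proof -
    obtain zs where zs: "set zs \<subseteq> S" "v = refl_word zs" "length zs = len v" using reduced_word[OF v] .
    have "w = refl_word (zs @ [b])" unfolding wv by (simp add: refl_word_append zs)
    then have "len w \<le> length (zs @ [b])" using zs b length_refl_word_le[of "zs @ [b]"] by auto
    then show ?thesis using zs Suc.hyps(2) by simp
  qed
  then have lv: "len v = n" using le by simp
  have "inversions w = insert b (refl b ` inversions v)"
  proof (rule set_eqI)
    fix \<gamma>
    have "\<gamma> \<in> inversions w \<longleftrightarrow> \<gamma> \<in> refl b ` inversions v" if "\<gamma> \<noteq> b"
    proof -
      have "\<gamma> \<in> pos \<longleftrightarrow> refl b \<gamma> \<in> pos" if "refl b \<gamma> \<noteq> b"
        using simple_refl_pos[OF b(1)] \<open>\<gamma> \<noteq> b\<close> that refl_refl[OF b(4)] by metis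
      \<comment> \<open>The exceptional root is \<open>- b\<close>: the reflection makes it
        positive, but it belongs to neither side.\<close>
      moreover have "\<gamma> \<notin> pos" if "refl b \<gamma> = b" 
      proof -
        have "\<gamma> = - b" using that refl_refl[OF b(4)] refl_self[OF b(4)] by metis
        then show ?thesis using b pos_iff_ht neg_root ht_uminus ht_pos by fastforce
      qed
      moreover have "\<gamma> \<in> refl b ` inversions v \<longleftrightarrow> refl b \<gamma> \<in> inversions v"
        using refl_refl[OF b(4)] by (metis image_iff)
      moreover have "v (refl b \<gamma>) = w \<gamma>" by (simp add: v_def refl_refl b)
      ultimately show ?thesis using vb b(3) refl_refl[OF b(4), of \<gamma>] by (cases "refl b \<gamma> = b") (auto simp: inversions_def)
    qed
    then show "\<gamma> \<in> inversions w \<longleftrightarrow> \<gamma> \<in> insert b (refl b ` inversions v)"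
      using wb b by (cases "\<gamma> = b") (simp_all add: inversions_def)
  qed
  moreover have "b \<notin> refl b ` inversions v"
  proof
    assume "b \<in> refl b ` inversions v"
    then have "- b \<in> inversions v" using refl_refl[OF b(4)] refl_self[OF b(4)] by (metis imageE)
    then show False using ht_pos[OF b(3)] ht_pos[of "-b"] by (auto simp: inversions_def ht_uminus)
  qed
  moreover have "inj_on (refl b) (inversions v)" by (metis inj_onI refl_refl b(4))
  moreover have "finite (inversions v)" using finite_pos by (simp add: inversions_def)
  ultimately show ?case using Suc.hyps(1)[OF lv[symmetric] v] Suc.hyps(2) lv
    by (simp add: card_image)
qed

text \<open>Concatenate reduced words of \<open>w \<circ> refl \<gamma>\<close> and
  \<open>refl \<gamma>\<close>. Together with \<open>len_refl_rho\<close> this shows that no step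
  descends further than a quantum edge would.\<close>

lemma len_refl_le:
  assumes w: "w \<in> W" and g: "\<gamma> \<in> \<Delta>"
  shows "len w \<le> len (w \<circ> refl \<gamma>) + len (refl \<gamma>)"
proof -
  have r: "refl \<gamma> \<in> W" using weyl_refl[OF weyl_id g] by simp
  obtain xs where xs: "set xs \<subseteq> S" "w \<circ> refl \<gamma> = refl_word xs" "length xs = len (w \<circ> refl \<gamma>)"
    using reduced_word[OF weyl_refl[OF w g]] .
  obtain ys where ys: "set ys \<subseteq> S" "refl \<gamma> = refl_word ys" "length ys = len (refl \<gamma>)"
    using reduced_word[OF r] .
  have "w = refl_word (xs @ ys)"
    unfolding refl_word_append xs(2)[symmetric] ys(2)[symmetric] by (simp only: comp_refl_refl[OF g])
  then have "len w \<le> length (xs @ ys)" using length_refl_word_le[of "xs @ ys"] xs(1) ys(1) by simp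
  then show ?thesis using xs ys by simp
qed

text \<open>\<open>\<langle>\<rho>, \<gamma>\<^sup>\<or>\<rangle> \<gamma> = \<rho> - s\<^sub>\<gamma>(\<rho>)\<close> is the sum of the inversions of \<open>s\<^sub>\<gamma>\<close>. Each of them pairs with \<open>\<gamma>\<^sup>\<or>\<close>
  to a positive integer, and \<open>\<gamma>\<close> itself to 2.\<close>

lemma len_refl_rho:
  assumes g: "\<gamma> \<in> pos"
  shows "real (len (refl \<gamma>)) + 1 \<le> 2 * (rho \<Delta> S \<bullet> coroot \<gamma>)"
proof -
  let ?s = "refl \<gamma>" and ?I = "inversions (refl \<gamma>)"
  have gD: "\<gamma> \<in> \<Delta>" and g0: "\<gamma> \<noteq> 0" using g pos_subset root_nonzero by auto
  have s: "?s \<in> W" using weyl_refl[OF weyl_id gD] by simp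
  have ss: "?s (?s x) = x" for x using refl_refl[OF g0] .
  have fI: "finite ?I" using finite_pos by (simp add: inversions_def)
  have IP: "?I \<subseteq> pos" by (auto simp: inversions_def)
  have gI: "\<gamma> \<in> ?I" using g ht_pos[OF g] pos_iff_ht[OF neg_root[OF gD]] 
    by (simp add: inversions_def refl_self g0 ht_uminus)
  have im: "?s ` (pos - ?I) = pos - ?I"
  proof -
    have "?s ` (pos - ?I) \<subseteq> pos - ?I" by (auto simp: inversions_def ss)
    then show ?thesis by (metis (no_types, lifting) ss subset_antisym image_eqI subsetI image_subset_iff)
  qed
  have pair: "?s x \<bullet> coroot \<gamma> = - (x \<bullet> coroot \<gamma>)" for x
    by (simp add: refl_def inner_diff_left inner_coroot_self g0)
  have "(\<Sum>\<delta>\<in>pos - ?I. \<delta> \<bullet> coroot \<gamma>) = (\<Sum>\<delta>\<in>?s ` (pos - ?I). \<delta> \<bullet> coroot \<gamma>)" by (simp add: im)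
  also have "\<dots> = (\<Sum>\<delta>\<in>pos - ?I. ?s \<delta> \<bullet> coroot \<gamma>)"
    by (rule sum.reindex_cong[OF _ refl refl]) (metis inj_onI ss)
  \<comment> \<open>\<open>refl \<gamma>\<close> permutes the positive roots outside
    \<open>?I\<close> and negates their pairing with the coroot, so their sum equals its own
    negative.\<close>
  finally have z: "(\<Sum>\<delta>\<in>pos - ?I. \<delta> \<bullet> coroot \<gamma>) = 0" by (simp add: pair sum_negf)
  have "2 * (rho \<Delta> S \<bullet> coroot \<gamma>) = (\<Sum>\<delta>\<in>pos. \<delta> \<bullet> coroot \<gamma>)"
    by (simp add: rho_def inner_sum_left)
  also have "\<dots> = (\<Sum>\<delta>\<in>?I. \<delta> \<bullet> coroot \<gamma>)"
    using z sum.subset_diff[OF IP finite_pos, of "\<lambda>\<delta>. \<delta> \<bullet> coroot \<gamma>"] by simp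
  also have "\<dots> = 2 + (\<Sum>\<delta>\<in>?I - {\<gamma>}. \<delta> \<bullet> coroot \<gamma>)"
    using sum.remove[OF fI gI, of "\<lambda>\<delta>. \<delta> \<bullet> coroot \<gamma>"] inner_coroot_self[OF g0] by simp
  finally have e: "2 * (rho \<Delta> S \<bullet> coroot \<gamma>) = 2 + (\<Sum>\<delta>\<in>?I - {\<gamma>}. \<delta> \<bullet> coroot \<gamma>)" .
  \<comment> \<open>\<open>refl \<gamma> \<delta>\<close> has negative height although \<delta> and
    \<gamma> have positive height; this forces a positive pairing, and integrality makes it at least
    1.\<close>
  have "1 \<le> \<delta> \<bullet> coroot \<gamma>" if "\<delta> \<in> ?I" for \<delta>
  proof -
    have d: "\<delta> \<in> pos" "\<delta> \<in> \<Delta>" "?s \<delta> \<notin> pos" using that pos_subset by (auto simp: inversions_def)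
    have "ht (?s \<delta>) < 0" using d refl_root[OF gD d(2)] pos_iff_ht ht_root_nonzero by fastforce
    moreover have "ht (?s \<delta>) = ht \<delta> - (\<delta> \<bullet> coroot \<gamma>) * ht \<gamma>"
      by (simp add: refl_def linear_diff[OF linear_ht] linear_cmul[OF linear_ht])
    ultimately have "\<delta> \<bullet> coroot \<gamma> > 0"
      using ht_pos[OF d(1)] ht_pos[OF g] by (smt (verit) mult_nonpos_nonneg)
    moreover have "\<delta> \<bullet> coroot \<gamma> \<in> \<int>" using root_pairing_Ints gD d by auto
    ultimately show ?thesis by (auto elim!: Ints_cases)
  qed
  then have "(\<Sum>\<delta>\<in>?I - {\<gamma>}. 1) \<le> (\<Sum>\<delta>\<in>?I - {\<gamma>}. \<delta> \<bullet> coroot \<gamma>)" by (intro sum_mono) auto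
  moreover have "(\<Sum>\<delta>\<in>?I - {\<gamma>}. (1::real)) = real (card ?I) - 1"
    using gI fI by (simp add: card_Diff_singleton) (metis Suc_pred card_gt_0_iff empty_iff of_nat_Suc add_diff_cancel_left' One_nat_def)
  ultimately show ?thesis using e card_inversions[OF s] by simp
qed

end

section \<open>The Yang--Baxter equation in dihedral Hecke algebras\<close>

text \<open>Models right multiplication by \<open>refl \<gamma>\<close> on \<open>W\<close>, with
  \<open>n w\<close> standing for negativity of \<open>w \<gamma>\<close>. The Hecke relations can
  then be computed over an abstract set.\<close>

locale signed_involution =
  fixes b :: real and X :: "'x set" and s :: "'x \<Rightarrow> 'x" and n :: "'x \<Rightarrow> bool"
  assumes closed: "x \<in> X \<Longrightarrow> s x \<in> X"
    and invol: "x \<in> X \<Longrightarrow> s (s x) = x"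
    and sign_flip: "x \<in> X \<Longrightarrow> n (s x) \<longleftrightarrow> \<not> n x"

text \<open>The unit of the algebra generated by the operators \<open>hecke\<close>: functions are
  total, but the involution is controlled only on \<open>X\<close>, so every operator restricts to
  \<open>X\<close>.\<close>

definition cutoff :: "'x set \<Rightarrow> ('x \<Rightarrow> real) \<Rightarrow> 'x \<Rightarrow> real" where
  "cutoff X F = (\<lambda>x. if x \<in> X then F x else 0)"

text \<open>On the pair \<open>x\<close>, \<open>s x\<close> this is the matrix of a Hecke
  generator, normalised to \<open>T^2 = b^2 - T\<close>; the diagonal entry -1 sits at the member
  satisfying \<open>n\<close>.\<close>

definition hecke :: "real \<Rightarrow> 'x set \<Rightarrow> ('x \<Rightarrow> 'x) \<Rightarrow> ('x \<Rightarrow> bool) \<Rightarrow> ('x \<Rightarrow> real) \<Rightarrow> 'x \<Rightarrow> real" where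
  "hecke b X s n F = (\<lambda>x. if x \<in> X then b * F (s x) - of_bool (n x) * F x else 0)"

definition baxter ::
    "real \<Rightarrow> 'x set \<Rightarrow> ('x \<Rightarrow> 'x) \<Rightarrow> ('x \<Rightarrow> bool) \<Rightarrow> real \<Rightarrow> ('x \<Rightarrow> real) \<Rightarrow> 'x \<Rightarrow> real" where
  "baxter b X s n f F = (\<lambda>x. hecke b X s n F x + f * cutoff X F x)"

lemma hecke_add: "hecke b X s n (\<lambda>x. F x + G x) = (\<lambda>x. hecke b X s n F x + hecke b X s n G x)"
  and hecke_diff: "hecke b X s n (\<lambda>x. F x - G x) = (\<lambda>x. hecke b X s n F x - hecke b X s n G x)"
  and hecke_cmult: "hecke b X s n (\<lambda>x. c * F x) = (\<lambda>x. c * hecke b X s n F x)"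
  by (auto simp: hecke_def fun_eq_iff algebra_simps)

lemma cutoff_add: "cutoff X (\<lambda>x. F x + G x) = (\<lambda>x. cutoff X F x + cutoff X G x)"
  and cutoff_diff: "cutoff X (\<lambda>x. F x - G x) = (\<lambda>x. cutoff X F x - cutoff X G x)"
  and cutoff_cmult: "cutoff X (\<lambda>x. c * F x) = (\<lambda>x. c * cutoff X F x)"
  and cutoff_hecke: "cutoff X (hecke b X s n F) = hecke b X s n F"
  and cutoff_cutoff: "cutoff X (cutoff X F) = cutoff X F"
  by (auto simp: cutoff_def hecke_def fun_eq_iff)

context signed_involution
begin

lemma hecke_cutoff: "hecke b X s n (cutoff X F) = hecke b X s n F"
  using closed by (auto simp: hecke_def cutoff_def fun_eq_iff)

text \<open>Exactly one of \<open>x\<close> and \<open>s x\<close> satisfies \<open>n\<close>, so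
  the two diagonal terms together contribute \<open>F (s x)\<close> once, with coefficient
  \<open>- b\<close>.\<close>

lemma hecke_quadratic:
  "hecke b X s n (hecke b X s n F) = (\<lambda>x. b\<^sup>2 * cutoff X F x - hecke b X s n F x)"
  using closed invol sign_flip
  by (auto simp: hecke_def cutoff_def fun_eq_iff algebra_simps power2_eq_square)

end

lemmas hecke_expand = baxter_def hecke_add hecke_diff hecke_cmult cutoff_add cutoff_diff cutoff_cmult
  cutoff_hecke cutoff_cutoff

text \<open>
  Think of \<open>X\<close> as a Weyl group, of \<open>sA\<close>, \<open>sB\<close> as right multiplication by \<open>s\<^sub>\<alpha>\<close>, \<open>s\<^sub>\<beta>\<close>, and of \<open>n i x\<close> as
  saying that \<open>x\<close> maps the \<open>i\<close>-th of the \<open>m\<close> roots \<open>\<alpha>, s\<^sub>\<alpha>(\<beta>), \<dots>, s\<^sub>\<beta>(\<alpha>), \<beta>\<close> to a negative root.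
\<close>

locale dihedral_signs =
  A: signed_involution b X sA "n 1" + B: signed_involution b X sB "n m"
  for b :: real and X :: "'x set" and sA sB :: "'x \<Rightarrow> 'x" and n :: "nat \<Rightarrow> 'x \<Rightarrow> bool" and m :: nat +
  assumes sign_A: "x \<in> X \<Longrightarrow> 2 \<le> i \<Longrightarrow> i \<le> m \<Longrightarrow> n i (sA x) \<longleftrightarrow> n (m + 2 - i) x"
    and sign_B: "x \<in> X \<Longrightarrow> 1 \<le> i \<Longrightarrow> i < m \<Longrightarrow> n i (sB x) \<longleftrightarrow> n (m - i) x"
    and sign_threshold: "x \<in> X \<Longrightarrow> \<exists>j\<le>m. (\<forall>i\<in>{1..m}. n i x \<longleftrightarrow> i \<le> j) \<or> (\<forall>i\<in>{1..m}. n i x \<longleftrightarrow> j < i)"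
begin

abbreviation "TA \<equiv> hecke b X sA (n 1)"
abbreviation "TB \<equiv> hecke b X sB (n m)"
abbreviation "RA \<equiv> baxter b X sA (n 1)"
abbreviation "RB \<equiv> baxter b X sB (n m)"

text \<open>Normal form: products of \<open>RA\<close> and \<open>RB\<close> become combinations of
  alternating words in \<open>TA\<close> and \<open>TB\<close>, squares being removed by the
  quadratic relation.\<close>

lemmas hecke_norm = hecke_expand A.hecke_cutoff B.hecke_cutoff A.hecke_quadratic B.hecke_quadratic

text \<open>For two orthogonal roots each reflection preserves the sign of the other root, so the
  diagonal factors pass through.\<close>

lemma hecke_braid_2:
  assumes m: "m = 2" and braid: "\<And>x. x \<in> X \<Longrightarrow> sA (sB x) = sB (sA x)"
  shows "TA (TB F) = TB (TA F)"
proof (rule ext)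
  fix x
  show "TA (TB F) x = TB (TA F) x"
  proof (cases "x \<in> X")
    case x: True
    show ?thesis
      using sign_A[OF x, of 2] sign_B[OF x, of 1] x
      by (simp add: hecke_def m A.closed B.closed braid algebra_simps)
  qed (simp add: hecke_def)
qed

text \<open>By \<open>sign_threshold\<close> only \<open>2m\<close> of the \<open>2^m\<close> sign
  patterns can occur. In each of them both sides become explicit combinations of values of
  \<open>F\<close> on the orbit of \<open>x\<close>, which agree by the braid relation for the
  longest product. The cases \<open>m = 4\<close> and \<open>m = 6\<close> follow the same
  scheme.\<close>

lemma hecke_braid_3:
  assumes m: "m = 3" and braid: "\<And>x. x \<in> X \<Longrightarrow> sA (sB (sA x)) = sB (sA (sB x))"
  shows "TA (TB (TA F)) = TB (TA (TB F))"
proof (rule ext)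
  fix x
  show "TA (TB (TA F)) x = TB (TA (TB F)) x"
  proof (cases "x \<in> X")
    case x: True
    note cl = A.closed B.closed x
    obtain j where j: "j \<le> 3"
      "(\<forall>i\<in>{1..3}. n i x \<longleftrightarrow> i \<le> j) \<or> (\<forall>i\<in>{1..3}. n i x \<longleftrightarrow> j < i)"
      using sign_threshold[OF x] m by metis
    have pat: "(n 1 x, n 2 x, n 3 x) \<in> {(False,False,False), (True,False,False),
      (True,True,False), (True,True,True),
      (False,True,True), (False,False,True)}"
      using j(2)
    proof
      assume "\<forall>i\<in>{1..3}. n i x \<longleftrightarrow> i \<le> j"
      then have "(n 1 x, n 2 x, n 3 x) = (1 \<le> j, 2 \<le> j, 3 \<le> j)" by simp
      moreover have "j \<in> {0,1,2,3}" using j(1) by auto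
      ultimately show ?thesis by (elim insertE emptyE) (simp_all only:, simp_all)
    next
      assume "\<forall>i\<in>{1..3}. n i x \<longleftrightarrow> j < i"
      then have "(n 1 x, n 2 x, n 3 x) = (j < 1, j < 2, j < 3)" by simp
      moreover have "j \<in> {0,1,2,3}" using j(1) by auto
      ultimately show ?thesis by (elim insertE emptyE) (simp_all only:, simp_all)
    qed
    have sA: "n 1 (sA y) = (\<not> n 1 y)" "n 2 (sA y) = n 3 y" "n 3 (sA y) = n 2 y"
      and sB: "n 1 (sB y) = n 2 y" "n 2 (sB y) = n 1 y" "n 3 (sB y) = (\<not> n 3 y)" if "y \<in> X" for y
      using sign_A[OF that, of 2] sign_A[OF that, of 3] A.sign_flip[OF that]
        sign_B[OF that, of 1] sign_B[OF that, of 2] B.sign_flip[OF that] by (simp_all add: m)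
    show ?thesis
      using pat
      by (elim insertE emptyE Pair_inject)
        (simp_all add: hecke_def m cl sA sB A.invol B.invol braid algebra_simps del: One_nat_def)
  qed (simp add: hecke_def)
qed

lemma hecke_braid_4:
  assumes m: "m = 4" and braid: "\<And>x. x \<in> X \<Longrightarrow> sA (sB (sA (sB x))) = sB (sA (sB (sA x)))"
  shows "TA (TB (TA (TB F))) = TB (TA (TB (TA F)))"
proof (rule ext)
  fix x
  show "TA (TB (TA (TB F))) x = TB (TA (TB (TA F))) x"
  proof (cases "x \<in> X")
    case x: True
    note cl = A.closed B.closed x
    obtain j where j: "j \<le> 4"
      "(\<forall>i\<in>{1..4}. n i x \<longleftrightarrow> i \<le> j) \<or> (\<forall>i\<in>{1..4}. n i x \<longleftrightarrow> j < i)"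
      using sign_threshold[OF x] m by metis
    have pat: "(n 1 x, n 2 x, n 3 x, n 4 x) \<in> {(False,False,False,False), (True,False,False,False),
      (True,True,False,False), (True,True,True,False),
      (True,True,True,True), (False,True,True,True),
      (False,False,True,True), (False,False,False,True)}"
      using j(2)
    proof
      assume "\<forall>i\<in>{1..4}. n i x \<longleftrightarrow> i \<le> j"
      then have "(n 1 x, n 2 x, n 3 x, n 4 x) = (1 \<le> j, 2 \<le> j, 3 \<le> j, 4 \<le> j)" by simp
      moreover have "j \<in> {0,1,2,3,4}" using j(1) by auto
      ultimately show ?thesis by (elim insertE emptyE) (simp_all only:, simp_all)
    next
      assume "\<forall>i\<in>{1..4}. n i x \<longleftrightarrow> j < i"
      then have "(n 1 x, n 2 x, n 3 x, n 4 x) = (j < 1, j < 2, j < 3, j < 4)" by simp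
      moreover have "j \<in> {0,1,2,3,4}" using j(1) by auto
      ultimately show ?thesis by (elim insertE emptyE) (simp_all only:, simp_all)
    qed
    have sA: "n 1 (sA y) = (\<not> n 1 y)" "n 2 (sA y) = n 4 y" "n 3 (sA y) = n 3 y" "n 4 (sA y) = n 2 y"
      and sB: "n 1 (sB y) = n 3 y" "n 2 (sB y) = n 2 y" "n 3 (sB y) = n 1 y" "n 4 (sB y) = (\<not> n 4 y)"
      if "y \<in> X" for y
      using sign_A[OF that, of 2] sign_A[OF that, of 3] sign_A[OF that, of 4] A.sign_flip[OF that]
        sign_B[OF that, of 1] sign_B[OF that, of 2] sign_B[OF that, of 3] B.sign_flip[OF that]
      by (simp_all add: m)
    show ?thesis
      using pat
      by (elim insertE emptyE Pair_inject)
        (simp_all add: hecke_def m cl sA sB A.invol B.invol braid algebra_simps del: One_nat_def)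
  qed (simp add: hecke_def)
qed

lemma hecke_braid_6:
  assumes m: "m = 6"
    and braid: "\<And>x. x \<in> X \<Longrightarrow> sA (sB (sA (sB (sA (sB x))))) = sB (sA (sB (sA (sB (sA x)))))"
  shows "TA (TB (TA (TB (TA (TB F))))) = TB (TA (TB (TA (TB (TA F)))))"
proof (rule ext)
  fix x
  show "TA (TB (TA (TB (TA (TB F))))) x = TB (TA (TB (TA (TB (TA F))))) x"
  proof (cases "x \<in> X")
    case x: True
    note cl = A.closed B.closed x
    obtain j where j: "j \<le> 6"
      "(\<forall>i\<in>{1..6}. n i x \<longleftrightarrow> i \<le> j) \<or> (\<forall>i\<in>{1..6}. n i x \<longleftrightarrow> j < i)"
      using sign_threshold[OF x] m by metis
    have pat: "(n 1 x, n 2 x, n 3 x, n 4 x, n 5 x, n 6 x) \<in> {(False,False,False,False,False,False), (True,False,False,False,False,False),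
      (True,True,False,False,False,False), (True,True,True,False,False,False),
      (True,True,True,True,False,False), (True,True,True,True,True,False),
      (True,True,True,True,True,True), (False,True,True,True,True,True),
      (False,False,True,True,True,True), (False,False,False,True,True,True),
      (False,False,False,False,True,True), (False,False,False,False,False,True)}"
      using j(2)
    proof
      assume "\<forall>i\<in>{1..6}. n i x \<longleftrightarrow> i \<le> j"
      then have "(n 1 x, n 2 x, n 3 x, n 4 x, n 5 x, n 6 x) = (1 \<le> j, 2 \<le> j, 3 \<le> j, 4 \<le> j, 5 \<le> j, 6 \<le> j)" by simp
      moreover have "j \<in> {0,1,2,3,4,5,6}" using j(1) by auto
      ultimately show ?thesis by (elim insertE emptyE) (simp_all only:, simp_all)
    next
      assume "\<forall>i\<in>{1..6}. n i x \<longleftrightarrow> j < i"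
      then have "(n 1 x, n 2 x, n 3 x, n 4 x, n 5 x, n 6 x) = (j < 1, j < 2, j < 3, j < 4, j < 5, j < 6)" by simp
      moreover have "j \<in> {0,1,2,3,4,5,6}" using j(1) by auto
      ultimately show ?thesis by (elim insertE emptyE) (simp_all only:, simp_all)
    qed
    have sA: "n 1 (sA y) = (\<not> n 1 y)" "n 2 (sA y) = n 6 y" "n 3 (sA y) = n 5 y"
        "n 4 (sA y) = n 4 y" "n 5 (sA y) = n 3 y" "n 6 (sA y) = n 2 y"
      and sB: "n 1 (sB y) = n 5 y" "n 2 (sB y) = n 4 y" "n 3 (sB y) = n 3 y" 
        "n 4 (sB y) = n 2 y" "n 5 (sB y) = n 1 y" "n 6 (sB y) = (\<not> n 6 y)"
      if "y \<in> X" for y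
      using sign_A[OF that, of 2] sign_A[OF that, of 3] sign_A[OF that, of 4] 
        sign_A[OF that, of 5] sign_A[OF that, of 6] A.sign_flip[OF that]
        sign_B[OF that, of 1] sign_B[OF that, of 2] sign_B[OF that, of 3]
        sign_B[OF that, of 4] sign_B[OF that, of 5] B.sign_flip[OF that]
      by (simp_all add: m)
    show ?thesis
      using pat
      by (elim insertE emptyE Pair_inject)
        (simp_all add: hecke_def m cl sA sB A.invol B.invol braid algebra_simps del: One_nat_def)
  qed (simp add: hecke_def)
qed

lemma baxter_braid_2:
  assumes "m = 2" and "\<And>x. x \<in> X \<Longrightarrow> sA (sB x) = sB (sA x)"
  shows "RA f1 (RB f2 F) = RB f2 (RA f1 F)"
  by (simp only: hecke_norm hecke_braid_2[OF assms])
      (simp add: algebra_simps del: One_nat_def)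

text \<open>The words of full length cancel by the braid relation, and what remains is a multiple of
  \<open>TA F - TB F\<close>. Its coefficient vanishes by the relation \<open>f\<close>, in which
  \<open>f2\<close> will belong to the sum of the other two coroots.\<close>

lemma baxter_braid_3:
  assumes "m = 3" and "\<And>x. x \<in> X \<Longrightarrow> sA (sB (sA x)) = sB (sA (sB x))"
    and f: "f1 * f3 = f2 * (f1 + f3 - 1)"
  shows "RA f1 (RB f2 (RA f3 F)) = RB f3 (RA f2 (RB f1 F))"
proof (rule ext)
  fix x
  have "RA f1 (RB f2 (RA f3 F)) x - RB f3 (RA f2 (RB f1 F)) x
      = (f1 * f2 + f2 * f3 - f2 - f1 * f3) * (TA F x - TB F x)"
    by (simp only: hecke_norm hecke_braid_3[OF assms(1,2)])
      (simp add: algebra_simps del: One_nat_def)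
  moreover have "f1 * f2 + f2 * f3 - f2 - f1 * f3 = 0" using f by algebra
  ultimately show "RA f1 (RB f2 (RA f3 F)) x = RB f3 (RA f2 (RB f1 F)) x" by simp
qed

text \<open>Here the commutator of \<open>TA\<close> and \<open>TB\<close> is the only surviving
  term. The two relations will come from writing each of the two middle coroots as a sum of two
  others.\<close>

lemma baxter_braid_4:
  assumes "m = 4" and "\<And>x. x \<in> X \<Longrightarrow> sA (sB (sA (sB x))) = sB (sA (sB (sA x)))"
    and f: "f1 * f4 = f2 * (f1 + f4 - 1)" "f2 * f4 = f3 * (f2 + f4 - 1)"
  shows "RA f1 (RB f2 (RA f3 (RB f4 F))) = RB f4 (RA f3 (RB f2 (RA f1 F)))"
proof (rule ext)
  fix x
  have "RA f1 (RB f2 (RA f3 (RB f4 F))) x - RB f4 (RA f3 (RB f2 (RA f1 F))) x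
      = (f1 * f2 + f2 * f3 + f3 * f4 - f2 - f3 - f1 * f4) * (TA (TB F) x - TB (TA F) x)"
    by (simp only: hecke_norm hecke_braid_4[OF assms(1,2)])
      (simp add: algebra_simps del: One_nat_def)
  moreover have "f1 * f2 + f2 * f3 + f3 * f4 - f2 - f3 - f1 * f4 = 0" using f by algebra
  ultimately show "RA f1 (RB f2 (RA f3 (RB f4 F))) x = RB f4 (RA f3 (RB f2 (RA f1 F))) x" by simp
qed

text \<open>The five relations are coroot additions in type G2: \<open>f2\<close>, \<open>f4\<close>
  and \<open>f5\<close> belong to one sum each, \<open>f3\<close> to two.\<close>

lemma baxter_braid_6:
  assumes "m = 6"
    and "\<And>x. x \<in> X \<Longrightarrow> sA (sB (sA (sB (sA (sB x))))) = sB (sA (sB (sA (sB (sA x)))))"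
    and f: "f1 * f6 = f2 * (f1 + f6 - 1)" "f2 * f6 = f4 * (f2 + f6 - 1)" "f4 * f6 = f5 * (f4 + f6 - 1)"
      "f1 * f5 = f3 * (f1 + f5 - 1)" "f2 * f4 = f3 * (f2 + f4 - 1)"
  shows "RA f1 (RB f2 (RA f3 (RB f4 (RA f5 (RB f6 F))))) = RB f6 (RA f5 (RB f4 (RA f3 (RB f2 (RA f1 F)))))"
proof (rule ext)
  fix x
  \<comment> \<open>the coordinates of the difference of both sides in the standard basis of the Hecke algebra\<close>
  let ?e1 = "f1*f2 - f1*f6 + f2*f3 + f3*f4 + f4*f5 + f5*f6 - f2 - f3 - f4 - f5"
  let ?e2 = "f1*f2*f3*f4 - f1*f2*f3*f6 + f1*f2*f4*f5 + f1*f2*f5*f6 - f1*f3*f4*f6 - f1*f4*f5*f6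
    + f2*f3*f4*f5 + f2*f3*f5*f6 + f3*f4*f5*f6 - f1*f2*f4 - f1*f2*f5 + f1*f3*f6 + f1*f4*f6
    - f2*f3*f4 - f2*f3*f5 - f2*f4*f5 - f2*f5*f6 - f3*f4*f5 - f3*f5*f6 + f2*f4 + f2*f5 + f3*f5"
  \<comment> \<open>The part with \<open>b\<^sup>2\<close> arises from squares of generators; it and
    the part \<open>?e2\<close> free of \<open>b\<close> vanish separately.\<close>
  let ?e3 = "f1*f3 - f1*f5 + f2*f4 - f2*f6 + f3*f5 + f4*f6 - f3 - f4"
  have "RA f1 (RB f2 (RA f3 (RB f4 (RA f5 (RB f6 F))))) x
        - RB f6 (RA f5 (RB f4 (RA f3 (RB f2 (RA f1 F))))) x
      = ?e1 * (TA (TB (TA (TB F))) x - TB (TA (TB (TA F))) x)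
        + (?e2 + b\<^sup>2 * ?e3) * (TA (TB F) x - TB (TA F) x)"
    by (simp only: hecke_norm hecke_braid_6[OF assms(1,2)])
      (simp add: algebra_simps del: One_nat_def)
  moreover have "?e1 = 0" using f by algebra
  moreover have "?e3 = 0" using f by algebra
  moreover have "?e2 = 0" using f by algebra
  ultimately show "RA f1 (RB f2 (RA f3 (RB f4 (RA f5 (RB f6 F))))) x
      = RB f6 (RA f5 (RB f4 (RA f3 (RB f2 (RA f1 F))))) x"
    by simp
qed

end

section \<open>The Yang--Baxter equation for root systems\<close>

text \<open>The product of \<open>n\<close> alternating reflections, with
  \<open>refl \<alpha>\<close> applied first. It accumulates on the right when the reflections of a
  segment are moved past the remaining operators.\<close>

fun alternating_refl :: "'a::euclidean_space \<Rightarrow> 'a \<Rightarrow> nat \<Rightarrow> 'a \<Rightarrow> 'a" where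
  "alternating_refl \<alpha> \<beta> 0 = id"
| "alternating_refl \<alpha> \<beta> (Suc n) = alternating_refl \<beta> \<alpha> n \<circ> refl \<alpha>"

lemma threshold_decreasing:
  fixes N :: "nat \<Rightarrow> bool"
  assumes "\<And>i. 1 \<le> i \<Longrightarrow> i < m \<Longrightarrow> N (Suc i) \<Longrightarrow> N i"
  shows "\<exists>j\<le>m. \<forall>i\<in>{1..m}. N i \<longleftrightarrow> i \<le> j"
  using assms
proof (induction m)
  case (Suc m)
  then obtain j where j: "j \<le> m" "\<forall>i\<in>{1..m}. N i \<longleftrightarrow> i \<le> j" by force
  show ?case
  proof (cases "N (Suc m)")
    case True
    have "N i" if "i \<in> {1..Suc m}" for i
      using Suc.prems True that by (auto intro: inc_induct[of i "Suc m" N])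
    then show ?thesis by (intro exI[of _ "Suc m"]) auto
  next
    case False
    then show ?thesis using j by (intro exI[of _ j]) (auto simp: le_Suc_eq)
  qed
qed simp

context based_root_system
begin

definition neg :: "'a \<Rightarrow> ('a \<Rightarrow> 'a) \<Rightarrow> bool" where
  "neg \<gamma> w \<longleftrightarrow> ht (w \<gamma>) < 0"

text \<open>The deformed operator multiplied by \<open>b\<close>, with \<open>f\<close> in place of
  \<open>1 / (1 - q^\<gamma>)\<close>; the factor removes the inverse of \<open>b\<close>.\<close>

definition yang :: "real \<Rightarrow> real \<Rightarrow> 'a \<Rightarrow> (('a \<Rightarrow> 'a) \<Rightarrow> real) \<Rightarrow> ('a \<Rightarrow> 'a) \<Rightarrow> real" where
  "yang b f \<gamma> F w = b * F w + (f - of_bool (neg \<gamma> w)) * F (w \<circ> refl \<gamma>)"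

text \<open>Coefficients and roots are separate lists, because \<open>yangs_refl\<close> conjugates
  the roots and leaves the coefficients as they are.\<close>

definition yangs :: "real \<Rightarrow> real list \<Rightarrow> 'a list \<Rightarrow> (('a \<Rightarrow> 'a) \<Rightarrow> real) \<Rightarrow> ('a \<Rightarrow> 'a) \<Rightarrow> real" where
  "yangs b fs \<gamma>s F = foldr (\<lambda>(f, \<gamma>). yang b f \<gamma>) (zip fs \<gamma>s) F"

lemma refl_refl_root:
  assumes "\<alpha> \<noteq> 0"
  shows "refl (refl \<alpha> \<gamma>) = refl \<alpha> \<circ> refl \<gamma> \<circ> refl \<alpha>"
proof -
  have "refl (refl \<alpha> \<gamma>) \<circ> refl \<alpha> = refl \<alpha> \<circ> refl \<gamma>"
    using assms by (intro refl_isometry) (auto simp: linear_refl inner_refl_refl)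
  then have "refl (refl \<alpha> \<gamma>) \<circ> (refl \<alpha> \<circ> refl \<alpha>) = refl \<alpha> \<circ> refl \<gamma> \<circ> refl \<alpha>"
    by (simp only: o_assoc)
  then show ?thesis by (simp add: refl_comp_refl assms)
qed

lemma yangs_Cons: "yangs b (f # fs) (\<gamma> # \<gamma>s) F = yang b f \<gamma> (yangs b fs \<gamma>s F)"
  by (simp add: yangs_def)

text \<open>Moving the argument from \<open>w\<close> to \<open>w s_\<alpha>\<close> replaces each
  root \<open>s_\<alpha>(\<gamma>)\<close> by \<open>\<gamma>\<close>, in the sign condition as well
  as in the reflected argument.\<close>

lemma yangs_refl:
  assumes "\<alpha> \<in> \<Delta>"
  shows "yangs b fs (map (refl \<alpha>) \<gamma>s) F w = yangs b fs \<gamma>s (\<lambda>v. F (v \<circ> refl \<alpha>)) (w \<circ> refl \<alpha>)"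
proof (induction fs arbitrary: \<gamma>s w)
  case Nil
  then show ?case by (simp only: yangs_def zip_Nil foldr.simps id_apply comp_refl_refl[OF assms])
next
  case (Cons f fs)
  show ?case
  proof (cases \<gamma>s)
    case Nil
    then show ?thesis by (simp only: yangs_def list.map zip.simps foldr.simps id_apply comp_refl_refl[OF assms])
  next
    case (Cons \<gamma> \<gamma>s')
    have "w \<circ> refl (refl \<alpha> \<gamma>) \<circ> refl \<alpha> = w \<circ> refl \<alpha> \<circ> refl \<gamma>"
      unfolding refl_refl_root[OF root_nonzero[OF assms]] o_assoc by (rule comp_refl_refl[OF assms])
    moreover have "neg (refl \<alpha> \<gamma>) w = neg \<gamma> (w \<circ> refl \<alpha>)" by (simp add: neg_def)
    ultimately show ?thesis
      by (simp only: Cons list.map yangs_Cons yang_def Cons.IH)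
  qed
qed

text \<open>
  Moving all reflections to the right turns the operators of the successive roots
  \<open>\<alpha>, s\<^sub>\<alpha>(\<beta>), s\<^sub>\<alpha> s\<^sub>\<beta>(\<alpha>), \<dots>\<close> into operators that alternate between \<open>\<alpha>\<close> and \<open>\<beta>\<close>.
\<close>

fun dressed :: "real \<Rightarrow> 'a \<Rightarrow> 'a \<Rightarrow> real list \<Rightarrow> (('a \<Rightarrow> 'a) \<Rightarrow> real) \<Rightarrow> ('a \<Rightarrow> 'a) \<Rightarrow> real" where
  "dressed b \<alpha> \<beta> [] F = F"
| "dressed b \<alpha> \<beta> (f # fs) F = baxter b W (\<lambda>w. w \<circ> refl \<alpha>) (neg \<alpha>) f (dressed b \<beta> \<alpha> fs F)"

lemma yangs_dressed:
  assumes "\<alpha> \<in> \<Delta>" "\<beta> \<in> \<Delta>" "w \<in> W"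
  shows "yangs b fs (map (alternating_root \<alpha> \<beta>) [0..<length fs]) F w
    = dressed b \<alpha> \<beta> fs (\<lambda>v. F (v \<circ> alternating_refl \<alpha> \<beta> (length fs))) w"
  using assms
proof (induction fs arbitrary: \<alpha> \<beta> F w)
  case Nil
  then show ?case by (simp add: yangs_def)
next
  case (Cons f fs)
  let ?H = "yangs b fs (map (alternating_root \<beta> \<alpha>) [0..<length fs]) (\<lambda>v. F (v \<circ> refl \<alpha>))"
  let ?G = "yangs b fs (map (refl \<alpha>) (map (alternating_root \<beta> \<alpha>) [0..<length fs])) F"
  have l: "map (alternating_root \<alpha> \<beta>) [0..<length (f # fs)]
      = \<alpha> # map (refl \<alpha>) (map (alternating_root \<beta> \<alpha>) [0..<length fs])"
    by (simp add: map_upt_Suc del: upt_Suc)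
  have "yangs b (f # fs) (map (alternating_root \<alpha> \<beta>) [0..<length (f # fs)]) F w
      = yang b f \<alpha> ?G w"
    unfolding l by (simp add: yangs_def)
  \<comment> \<open>The conjugation exchanges the arguments \<open>w\<close> and
    \<open>w \<circ> refl \<alpha>\<close> of the inner operator. Now \<open>b\<close> multiplies
    the reflected value and the sign condition the unreflected one, which is the shape of
    \<open>baxter\<close>.\<close>
  also have "\<dots> = b * ?H (w \<circ> refl \<alpha>) + (f - of_bool (neg \<alpha> w)) * ?H w"
    unfolding yang_def yangs_refl[OF Cons.prems(1)] comp_refl_refl[OF Cons.prems(1)] ..
  also have "\<dots> = baxter b W (\<lambda>w. w \<circ> refl \<alpha>) (neg \<alpha>) f ?H w"
    using Cons.prems(3) by (simp add: baxter_def hecke_def cutoff_def algebra_simps)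
  also have "\<dots> = baxter b W (\<lambda>w. w \<circ> refl \<alpha>) (neg \<alpha>) f
      (dressed b \<beta> \<alpha> fs (\<lambda>v. F (v \<circ> alternating_refl \<beta> \<alpha> (length fs) \<circ> refl \<alpha>))) w"
    using Cons.IH[OF Cons.prems(2,1,3)] Cons.IH[OF Cons.prems(2,1) weyl_refl[OF Cons.prems(3,1)]]
    by (simp only: baxter_def hecke_def cutoff_def)
  finally show ?case
    by (simp only: o_assoc[symmetric] dressed.simps alternating_refl.simps length_Cons)
qed

lemma alternating_root_in: "\<alpha> \<in> \<Delta> \<Longrightarrow> \<beta> \<in> \<Delta> \<Longrightarrow> alternating_root \<alpha> \<beta> n \<in> \<Delta>"
  by (induction n arbitrary: \<alpha> \<beta>) (auto intro: refl_root)

lemma signed_involution_refl: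
  assumes "\<alpha> \<in> \<Delta>"
  shows "signed_involution W (\<lambda>w. w \<circ> refl \<alpha>) (neg \<alpha>)"
proof
  fix w assume w: "w \<in> W"
  show "w \<circ> refl \<alpha> \<in> W" using w assms by (rule weyl_refl)
  show "w \<circ> refl \<alpha> \<circ> refl \<alpha> = w" using assms by (rule comp_refl_refl)
  have "ht (w \<alpha>) \<noteq> 0" using ht_root_nonzero weyl_root[OF w] assms by auto
  then show "neg \<alpha> (w \<circ> refl \<alpha>) \<longleftrightarrow> \<not> neg \<alpha> w"
    by (auto simp: neg_def refl_self root_nonzero assms linear_neg[OF weyl_linear[OF w]] ht_uminus)
qed

text \<open>\<open>opp\<close> says that reading the sequence backwards exchanges \<alpha> and
  \<beta>; it gives the two sign rules. \<open>comb\<close> expresses the angular order: each root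
  lies in the cone of its successor and \<alpha>. If \<open>w \<alpha>\<close> is negative,
  negativity therefore passes from an entry to its predecessor, and likewise for positivity, so the
  signs change at most once.\<close>

lemma dihedral_signs_refl:
  assumes ab: "\<alpha> \<in> \<Delta>" "\<beta> \<in> \<Delta>" and m: "m > 0"
    and opp: "\<And>i. i < m \<Longrightarrow> alternating_root \<beta> \<alpha> i = alternating_root \<alpha> \<beta> (m - 1 - i)"
    and comb: "\<And>i. Suc i < m \<Longrightarrow> \<exists>c d. c \<ge> 0 \<and> d \<ge> 0 \<and>
      alternating_root \<alpha> \<beta> i = c *\<^sub>R alternating_root \<alpha> \<beta> (Suc i) + d *\<^sub>R \<alpha>"
  shows "dihedral_signs W (\<lambda>w. w \<circ> refl \<alpha>) (\<lambda>w. w \<circ> refl \<beta>) (\<lambda>i. neg (alternating_root \<alpha> \<beta> (i - 1))) m"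
proof -
  have e: "alternating_root \<alpha> \<beta> (m - 1) = \<beta>" using opp[of 0] m by simp
  interpret A: signed_involution b W "\<lambda>w. w \<circ> refl \<alpha>" "neg (alternating_root \<alpha> \<beta> (1 - 1))"
    using signed_involution_refl[OF ab(1)] by simp
  interpret B: signed_involution b W "\<lambda>w. w \<circ> refl \<beta>" "neg (alternating_root \<alpha> \<beta> (m - 1))"
    using signed_involution_refl[OF ab(2)] by (simp only: e)
  show ?thesis
  proof
    fix w i assume w: "w \<in> W" 
    { assume i: "2 \<le> i" "i \<le> m"
      then have "i - 1 = Suc (i - 2)" by simp
      then have "alternating_root \<alpha> \<beta> (i - 1) = refl \<alpha> (alternating_root \<beta> \<alpha> (i - 2))"
        by (metis alternating_root.simps(2))
      then have "refl \<alpha> (alternating_root \<alpha> \<beta> (i - 1)) = alternating_root \<alpha> \<beta> (m + 2 - i - 1)"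
        using opp[of "i - 2"] i refl_refl[OF root_nonzero[OF ab(1)]] by (simp add: numeral_2_eq_2)
      then show "neg (alternating_root \<alpha> \<beta> (i - 1)) (w \<circ> refl \<alpha>) \<longleftrightarrow> neg (alternating_root \<alpha> \<beta> (m + 2 - i - 1)) w"
        by (simp add: neg_def) }
    { assume i: "1 \<le> i" "i < m"
      then have "alternating_root \<alpha> \<beta> (i - 1) = alternating_root \<beta> \<alpha> (Suc (m - i - 1))"
        using opp[of "m - i"] by (simp add: Suc_diff_Suc)
      then have "refl \<beta> (alternating_root \<alpha> \<beta> (i - 1)) = alternating_root \<alpha> \<beta> (m - i - 1)"
        using refl_refl[OF root_nonzero[OF ab(2)]] by simp
      then show "neg (alternating_root \<alpha> \<beta> (i - 1)) (w \<circ> refl \<beta>) \<longleftrightarrow> neg (alternating_root \<alpha> \<beta> (m - i - 1)) w"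
        by (simp add: neg_def) }
    let ?N = "\<lambda>i. neg (alternating_root \<alpha> \<beta> (i - 1)) w"
    have nz: "ht (w (alternating_root \<alpha> \<beta> i)) \<noteq> 0" for i
      using ht_root_nonzero weyl_root[OF w] alternating_root_in ab by auto
    have step: "\<exists>c d. c \<ge> 0 \<and> d \<ge> 0 \<and> ht (w (alternating_root \<alpha> \<beta> (i - 1)))
        = c * ht (w (alternating_root \<alpha> \<beta> i)) + d * ht (w \<alpha>)" if i: "1 \<le> i" "i < m" for i
    proof -
      obtain c d where "c \<ge> 0" "d \<ge> 0" "alternating_root \<alpha> \<beta> (i - 1) = c *\<^sub>R alternating_root \<alpha> \<beta> i + d *\<^sub>R \<alpha>"
        using comb[of "i - 1"] i by auto
      then show ?thesis
        by (intro exI[of _ c] exI[of _ d])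
          (simp add: linear_add[OF weyl_linear[OF w]] linear_cmul[OF weyl_linear[OF w]] linear_add[OF linear_ht] linear_cmul[OF linear_ht])
    qed
    show "\<exists>j\<le>m. (\<forall>i\<in>{1..m}. ?N i \<longleftrightarrow> i \<le> j) \<or> (\<forall>i\<in>{1..m}. ?N i \<longleftrightarrow> j < i)"
    proof (cases "ht (w \<alpha>) < 0")
      case True
      have "?N i" if i: "1 \<le> i" "i < m" and n: "?N (Suc i)" for i
      proof -
        obtain c d where "c \<ge> 0" "d \<ge> 0" and e: "ht (w (alternating_root \<alpha> \<beta> (i - 1)))
          = c * ht (w (alternating_root \<alpha> \<beta> i)) + d * ht (w \<alpha>)" using step[OF i] by blast
        then have "c * ht (w (alternating_root \<alpha> \<beta> i)) \<le> 0" "d * ht (w \<alpha>) \<le> 0"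
          using True n by (auto simp: neg_def mult_nonneg_nonpos)
        then show ?thesis using e nz[of "i - 1"] by (simp add: neg_def)
      qed
      then show ?thesis using threshold_decreasing[of m ?N] by blast
    next
      case False
      have "\<not> ?N i" if i: "1 \<le> i" "i < m" and n: "\<not> ?N (Suc i)" for i
      proof -
        obtain c d where "c \<ge> 0" "d \<ge> 0" and e: "ht (w (alternating_root \<alpha> \<beta> (i - 1)))
          = c * ht (w (alternating_root \<alpha> \<beta> i)) + d * ht (w \<alpha>)" using step[OF i] by blast
        then have "c * ht (w (alternating_root \<alpha> \<beta> i)) \<ge> 0" "d * ht (w \<alpha>) \<ge> 0"
          using False n by (auto simp: neg_def)
        then show ?thesis using e by (simp add: neg_def)
      qed
      then obtain j where "j \<le> m" "\<forall>i\<in>{1..m}. \<not> ?N i \<longleftrightarrow> i \<le> j"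
        using threshold_decreasing[of m "\<lambda>i. \<not> ?N i"] by blast
      then show ?thesis by (metis not_le)
    qed
  qed
qed

end

section \<open>Trigonometric parameters and the segments of alternating roots\<close>

definition trig :: "'a::euclidean_space \<Rightarrow> 'a \<Rightarrow> real" where
  "trig z \<gamma> = 1 / (1 - exp (- (z \<bullet> coroot \<gamma>)))"

lemma trig_add:
  assumes "coroot \<gamma> = coroot \<delta> + coroot \<epsilon>"
    and "z \<bullet> coroot \<gamma> \<noteq> 0" "z \<bullet> coroot \<delta> \<noteq> 0" "z \<bullet> coroot \<epsilon> \<noteq> 0"
  shows "trig z \<delta> * trig z \<epsilon> = trig z \<gamma> * (trig z \<delta> + trig z \<epsilon> - 1)"
proof -
  define x where "x = exp (- (z \<bullet> coroot \<delta>))"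
  define y where "y = exp (- (z \<bullet> coroot \<epsilon>))"
  have xy: "exp (- (z \<bullet> coroot \<gamma>)) = x * y"
    by (simp add: assms(1) x_def y_def inner_add_right exp_add[symmetric])
  have "x \<noteq> 1" "y \<noteq> 1" using assms(3,4) by (simp_all add: x_def y_def)
  moreover have "x * y \<noteq> 1" using assms(2) unfolding xy[symmetric] by simp
  ultimately show ?thesis
    unfolding trig_def xy x_def[symmetric] y_def[symmetric] by (simp add: divide_simps) algebra
qed

context based_root_system
begin

definition yang_list :: "real \<Rightarrow> 'a \<Rightarrow> 'a list \<Rightarrow> (('a \<Rightarrow> 'a) \<Rightarrow> real) \<Rightarrow> ('a \<Rightarrow> 'a) \<Rightarrow> real" where
  "yang_list b z \<gamma>s = foldr (\<lambda>\<gamma>. yang b (trig z \<gamma>) \<gamma>) \<gamma>s"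

lemma yangs_trig: "yangs b (map (trig z) \<gamma>s) \<gamma>s F = yang_list b z \<gamma>s F"
  by (induction \<gamma>s) (simp_all add: yangs_def yang_list_def)

lemma yang_list_alternating:
  assumes "\<alpha> \<in> \<Delta>" "\<beta> \<in> \<Delta>" "w \<in> W"
  shows "yang_list b z (map (alternating_root \<alpha> \<beta>) [0..<m]) F w
    = dressed b \<alpha> \<beta> (map (trig z) (map (alternating_root \<alpha> \<beta>) [0..<m])) (\<lambda>v. F (v \<circ> alternating_refl \<alpha> \<beta> m)) w"
  using yangs_dressed[OF assms, of b "map (trig z) (map (alternating_root \<alpha> \<beta>) [0..<m])" F]
  by (simp add: yangs_trig[symmetric])

text \<open>Otherwise \<alpha> and \<beta> are proportional, hence equal or opposite. Equality
  contradicts the sign of the pairing. This locates the first occurrence of \<beta> in a segment: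
  earlier entries have a nonzero \<alpha>-coefficient.\<close>

lemma roots_not_proportional:
  assumes "\<alpha> \<in> \<Delta>" "\<beta> \<in> \<Delta>" "\<alpha> \<bullet> coroot \<beta> \<le> 0" "\<alpha> \<noteq> - \<beta>" "d \<noteq> 0"
  shows "c *\<^sub>R \<beta> + d *\<^sub>R \<alpha> \<noteq> \<beta>"
proof
  assume "c *\<^sub>R \<beta> + d *\<^sub>R \<alpha> = \<beta>"
  then have "d *\<^sub>R \<alpha> = (1 - c) *\<^sub>R \<beta>" by (simp add: algebra_simps)
  then have "(1 / d) *\<^sub>R (d *\<^sub>R \<alpha>) = (1 / d) *\<^sub>R ((1 - c) *\<^sub>R \<beta>)" by simp
  then have e: "\<alpha> = ((1 - c) / d) *\<^sub>R \<beta>" using assms(5) by simp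
  then have "(1 - c) / d = 1 \<or> (1 - c) / d = - 1" using root_multiple[OF assms(2)] assms(1) by metis
  then have "\<alpha> = \<beta>" using e assms(4) by auto
  then show False using assms(3) inner_coroot_self[OF root_nonzero[OF assms(2)]] by simp
qed

lemma yb_segment_eq:
  assumes "\<alpha> \<in> \<Delta>" "\<beta> \<in> \<Delta>" "\<alpha> \<bullet> coroot \<beta> \<le> 0" "\<alpha> \<noteq> - \<beta>" "m > 0"
    and e: "alternating_root \<alpha> \<beta> (m - 1) = \<beta>"
    and d: "\<And>i. Suc i < m \<Longrightarrow> \<exists>c d. d \<noteq> 0 \<and> alternating_root \<alpha> \<beta> i = c *\<^sub>R \<beta> + d *\<^sub>R \<alpha>"
  shows "yb_segment \<alpha> \<beta> = map (alternating_root \<alpha> \<beta>) [0..<m]"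
proof -
  have "(LEAST n. alternating_root \<alpha> \<beta> n = \<beta>) = m - 1"
  proof (rule Least_equality)
    fix i assume i: "alternating_root \<alpha> \<beta> i = \<beta>"
    show "m - 1 \<le> i"
      using d[of i] roots_not_proportional[OF assms(1-4)] i by (metis Suc_eq_plus1 less_diff_conv not_le)
  qed (rule e)
  then show ?thesis using assms(5) by (simp add: yb_segment_def del: upt_Suc)
qed

lemma alternating_rev:
  assumes opp: "\<And>i. i < m \<Longrightarrow> alternating_root \<beta> \<alpha> i = alternating_root \<alpha> \<beta> (m - 1 - i)"
  shows "map (alternating_root \<beta> \<alpha>) [0..<m] = rev (map (alternating_root \<alpha> \<beta>) [0..<m])"
  by (rule nth_equalityI) (auto simp: opp rev_nth)

lemma coroot_refl: "\<alpha> \<in> \<Delta> \<Longrightarrow> coroot (refl \<alpha> x) = refl \<alpha> (coroot x)"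
  by (intro coroot_isometry linear_refl inner_refl_refl root_nonzero)

text \<open>All \<open>b\<close> and all regular \<open>z\<close> are allowed, since the limit is
  taken along \<open>b = e^(-n)\<close> and a moving \<open>z\<close>. Regularity keeps the
  denominators of \<open>trig\<close> nonzero.\<close>

definition yb_equation :: "'a list \<Rightarrow> bool" where
  "yb_equation L \<longleftrightarrow> (\<forall>z b F. \<forall>w\<in>W. (\<forall>\<gamma>\<in>\<Delta>. z \<bullet> coroot \<gamma> \<noteq> 0) \<longrightarrow>
     yang_list b z L F w = yang_list b z (rev L) F w)"

section \<open>Rank-two root systems in the basis \<alpha>, \<beta>, with \<open>k\<close> and
  \<open>l\<close> the negated Cartan integers\<close>

context
  fixes \<alpha> \<beta> :: 'a and k l :: real
  assumes roots: "\<alpha> \<in> \<Delta>" "\<beta> \<in> \<Delta>" and not_opp: "\<alpha> \<noteq> - \<beta>"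
    and pairing: "\<beta> \<bullet> coroot \<alpha> = - k" "\<alpha> \<bullet> coroot \<beta> = - l" and nonneg: "k \<ge> 0" "l \<ge> 0"
begin

definition comb :: "real \<Rightarrow> real \<Rightarrow> 'a" where "comb a c = a *\<^sub>R \<alpha> + c *\<^sub>R \<beta>"
definition cocomb :: "real \<Rightarrow> real \<Rightarrow> 'a" where "cocomb a c = a *\<^sub>R coroot \<alpha> + c *\<^sub>R coroot \<beta>"

lemma refl_basis:
  "refl \<alpha> \<alpha> = - \<alpha>" "refl \<beta> \<beta> = - \<beta>" "refl \<alpha> \<beta> = \<beta> + k *\<^sub>R \<alpha>" "refl \<beta> \<alpha> = \<alpha> + l *\<^sub>R \<beta>"
  using refl_self root_nonzero roots by (auto simp: refl_def[of _ \<alpha>] refl_def[of _ \<beta>] pairing inner_coroot_self scaleR_2)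

lemma coroot_basis:
  "refl \<alpha> (coroot \<beta>) = coroot \<beta> + l *\<^sub>R coroot \<alpha>" "refl \<beta> (coroot \<alpha>) = coroot \<alpha> + k *\<^sub>R coroot \<beta>"
  "refl \<alpha> (coroot \<alpha>) = - coroot \<alpha>" "refl \<beta> (coroot \<beta>) = - coroot \<beta>"
proof -
  have nz: "\<alpha> \<bullet> \<alpha> \<noteq> 0" "\<beta> \<bullet> \<beta> \<noteq> 0" using roots root_nonzero by auto
  \<comment> \<open>The scalar inside \<open>coroot \<alpha>\<close> can be moved from the pairing
    to the vector. This is why \<open>k\<close> and \<open>l\<close> trade places on
    coroots.\<close>
  have "(coroot \<beta> \<bullet> coroot \<alpha>) *\<^sub>R \<alpha> = (\<alpha> \<bullet> coroot \<beta>) *\<^sub>R coroot \<alpha>"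
    "(coroot \<alpha> \<bullet> coroot \<beta>) *\<^sub>R \<beta> = (\<beta> \<bullet> coroot \<alpha>) *\<^sub>R coroot \<beta>"
    by (simp_all add: coroot_def inner_commute)
  then show "refl \<alpha> (coroot \<beta>) = coroot \<beta> + l *\<^sub>R coroot \<alpha>" "refl \<beta> (coroot \<alpha>) = coroot \<alpha> + k *\<^sub>R coroot \<beta>"
    by (simp_all add: refl_def pairing)
  show "refl \<alpha> (coroot \<alpha>) = - coroot \<alpha>" "refl \<beta> (coroot \<beta>) = - coroot \<beta>"
    using nz by (simp_all add: refl_def coroot_def scaleR_2[symmetric] algebra_simps)
qed

lemma refl_comb:
  "refl \<alpha> (comb a c) = comb (k * c - a) c" "refl \<beta> (comb a c) = comb a (l * a - c)"
  "refl \<alpha> (cocomb a c) = cocomb (l * c - a) c" "refl \<beta> (cocomb a c) = cocomb a (k * a - c)"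
  by (simp_all add: comb_def cocomb_def refl_basis coroot_basis linear_add[OF linear_refl]
      linear_cmul[OF linear_refl] algebra_simps)

text \<open>Products of the two reflections change any \<open>v\<close> by a combination of \<alpha>
  and \<beta>. Tracking its two coefficients proves the braid relations on the whole space, not only
  on the plane of the two roots.\<close>

lemma refl_diff_comb:
  "refl \<alpha> (v - comb a c) = v - comb (v \<bullet> coroot \<alpha> + k * c - a) c"
  "refl \<beta> (v - comb a c) = v - comb a (v \<bullet> coroot \<beta> + l * a - c)"
proof -
  have "refl \<alpha> v = v - comb (v \<bullet> coroot \<alpha>) 0" "refl \<beta> v = v - comb 0 (v \<bullet> coroot \<beta>)"
    by (simp_all add: refl_def comb_def)
  then show "refl \<alpha> (v - comb a c) = v - comb (v \<bullet> coroot \<alpha> + k * c - a) c"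
    "refl \<beta> (v - comb a c) = v - comb a (v \<bullet> coroot \<beta> + l * a - c)"
    unfolding linear_diff[OF linear_refl] refl_comb by (simp_all add: comb_def algebra_simps)
qed

lemma comb_basis: "\<alpha> = comb 1 0" "\<beta> = comb 0 1" "coroot \<alpha> = cocomb 1 0" "coroot \<beta> = cocomb 0 1"
  by (simp_all add: comb_def cocomb_def)

lemma alternating_root_0: "alternating_root \<alpha> \<beta> 0 = comb 1 0" "alternating_root \<beta> \<alpha> 0 = comb 0 1"
  by (simp_all add: comb_def)

lemma coroot_alternating:
  "coroot (alternating_root \<alpha> \<beta> 0) = cocomb 1 0" "coroot (alternating_root \<beta> \<alpha> 0) = cocomb 0 1"
  "coroot (alternating_root \<alpha> \<beta> (Suc n)) = refl \<alpha> (coroot (alternating_root \<beta> \<alpha> n))"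
  "coroot (alternating_root \<beta> \<alpha> (Suc n)) = refl \<beta> (coroot (alternating_root \<alpha> \<beta> n))"
  by (simp_all add: comb_basis[symmetric] coroot_refl roots)

lemma alternating_refl_comb:
  "alternating_refl \<alpha> \<beta> m v = alternating_refl \<alpha> \<beta> m (v - comb 0 0)"
  "alternating_refl \<beta> \<alpha> m v = alternating_refl \<beta> \<alpha> m (v - comb 0 0)"
  by (simp_all add: comb_def)

lemmas alternating_calc = alternating_root_0 alternating_root.simps(2) refl_comb eval_nat_numeral

lemma ex_comb: "\<exists>c d. d \<noteq> 0 \<and> comb x y = c *\<^sub>R \<beta> + d *\<^sub>R \<alpha>" if "x \<noteq> 0" for x y
  using that by (intro exI[of _ y] exI[of _ x]) (simp add: comb_def)

lemma ex_comb': "\<exists>c d. d \<noteq> 0 \<and> comb x y = c *\<^sub>R \<alpha> + d *\<^sub>R \<beta>" if "y \<noteq> 0" for x y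
  using that by (intro exI[of _ x] exI[of _ y]) (simp add: comb_def)

text \<open>Comparing coefficients of \<beta> gives the witness \<open>c = y / y'\<close>; what is
  left is a multiple of \<alpha>.\<close>

lemma ex_comb_step: "\<exists>c d. c \<ge> 0 \<and> d \<ge> 0 \<and> comb x y = c *\<^sub>R comb x' y' + d *\<^sub>R \<alpha>"
  if "y' \<noteq> 0" "y / y' \<ge> 0" "x \<ge> y / y' * x'" for x y x' y'
  using that by (intro exI[of _ "y / y'"] exI[of _ "x - y / y' * x'"]) (simp add: comb_def algebra_simps)

text \<open>Reduces the equation to finitely checkable data: reversal, angular order, the braid
  relation and an identity of dressed operators. Both segments are treated at once because each is
  the reverse of the other, which shortens the case distinction on Cartan integers.\<close>

lemma yb_equation_alternating:
  assumes m: "m > 0"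
    and opp: "\<And>i. i < m \<Longrightarrow> alternating_root \<beta> \<alpha> i = alternating_root \<alpha> \<beta> (m - 1 - i)"
    and comb: "\<And>i. Suc i < m \<Longrightarrow> \<exists>c d. c \<ge> 0 \<and> d \<ge> 0 \<and>
      alternating_root \<alpha> \<beta> i = c *\<^sub>R alternating_root \<alpha> \<beta> (Suc i) + d *\<^sub>R \<alpha>"
    and braid: "alternating_refl \<alpha> \<beta> m = alternating_refl \<beta> \<alpha> m"
    and d: "\<And>i. Suc i < m \<Longrightarrow> \<exists>c d. d \<noteq> 0 \<and> alternating_root \<alpha> \<beta> i = c *\<^sub>R \<beta> + d *\<^sub>R \<alpha>"
    and d': "\<And>i. Suc i < m \<Longrightarrow> \<exists>c d. d \<noteq> 0 \<and> alternating_root \<beta> \<alpha> i = c *\<^sub>R \<alpha> + d *\<^sub>R \<beta>"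
    and dressed: "\<And>b z F w. \<lbrakk>\<forall>\<gamma>\<in>\<Delta>. z \<bullet> coroot \<gamma> \<noteq> 0; 
        dihedral_signs W (\<lambda>w. w \<circ> refl \<alpha>) (\<lambda>w. w \<circ> refl \<beta>) (\<lambda>i. neg (alternating_root \<alpha> \<beta> (i - 1))) m\<rbrakk> \<Longrightarrow>
      dressed b \<alpha> \<beta> (map (trig z) (map (alternating_root \<alpha> \<beta>) [0..<m])) F =
      dressed b \<beta> \<alpha> (map (trig z) (rev (map (alternating_root \<alpha> \<beta>) [0..<m]))) F"
  shows "yb_equation (yb_segment \<alpha> \<beta>) \<and> yb_equation (yb_segment \<beta> \<alpha>)"
proof -
  let ?L = "map (alternating_root \<alpha> \<beta>) [0..<m]"
  have e: "alternating_root \<alpha> \<beta> (m - 1) = \<beta>" using opp[of 0] m by simp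
  have e': "alternating_root \<beta> \<alpha> (m - 1) = \<alpha>" using opp[of "m - 1"] m by simp
  have s: "yb_segment \<alpha> \<beta> = ?L"
    using yb_segment_eq[OF roots _ not_opp m e d] pairing nonneg by simp
  have "\<beta> \<noteq> - \<alpha>" using not_opp by auto
  then have "yb_segment \<beta> \<alpha> = map (alternating_root \<beta> \<alpha>) [0..<m]"
    using yb_segment_eq[OF roots(2,1) _ _ m e' d'] pairing nonneg by simp
  then have s': "yb_segment \<beta> \<alpha> = rev ?L" using alternating_rev[OF opp] by simp
  have "yang_list b z ?L F w = yang_list b z (rev ?L) F w"
    if z: "\<forall>\<gamma>\<in>\<Delta>. z \<bullet> coroot \<gamma> \<noteq> 0" and w: "w \<in> W" for z b F w
    using yang_list_alternating[OF roots w, of b z m F]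
      yang_list_alternating[OF roots(2,1) w, of b z m F]
    by (simp only: alternating_rev[OF opp] braid dressed[OF z dihedral_signs_refl[OF roots m opp comb]])
  then show ?thesis
    unfolding s s' yb_equation_def by simp
qed


lemma Suc_numerals: "Suc 0 = 1" "Suc 1 = 2" "Suc 2 = 3" "Suc 3 = 4" "Suc 4 = 5"
  by simp_all

lemma trig_alternating:
  assumes "\<forall>\<gamma>\<in>\<Delta>. z \<bullet> coroot \<gamma> \<noteq> 0"
    and "coroot (alternating_root \<alpha> \<beta> h) = coroot (alternating_root \<alpha> \<beta> i) + coroot (alternating_root \<alpha> \<beta> j)"
  shows "trig z (alternating_root \<alpha> \<beta> i) * trig z (alternating_root \<alpha> \<beta> j) = trig z (alternating_root \<alpha> \<beta> h)
    * (trig z (alternating_root \<alpha> \<beta> i) + trig z (alternating_root \<alpha> \<beta> j) - 1)"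
  by (intro trig_add assms(2)) (use assms(1) alternating_root_in[OF roots] in blast)+

lemma cocomb_add: "cocomb a c + cocomb a' c' = cocomb (a + a') (c + c')"
  by (simp add: cocomb_def algebra_simps)

lemma yb_equation_2:
  assumes kl: "k = 0" "l = 0"
  shows "yb_equation (yb_segment \<alpha> \<beta>) \<and> yb_equation (yb_segment \<beta> \<alpha>)"
proof (rule yb_equation_alternating[where m = 2])
  have vals: "alternating_root \<alpha> \<beta> 0 = comb 1 0" "alternating_root \<alpha> \<beta> 1 = comb 0 1"
    "alternating_root \<beta> \<alpha> 0 = comb 0 1" "alternating_root \<beta> \<alpha> 1 = comb 1 0"
    by (simp_all add: alternating_calc kl del: alternating_root.simps(1))
  note vals = vals vals(2)[unfolded One_nat_def]
  have co: "coroot (alternating_root \<alpha> \<beta> 0) = cocomb 1 0" "coroot (alternating_root \<alpha> \<beta> 1) = cocomb 0 1"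
    by (simp_all add: eval_nat_numeral coroot_alternating refl_comb kl del: alternating_root.simps)
  have lt: "i \<in> {0,1}" if "i < 2" for i :: nat using that by auto
  have Suc_lt: "i \<in> {0}" if "Suc i < 2" for i :: nat using that by auto
  show "alternating_root \<beta> \<alpha> i = alternating_root \<alpha> \<beta> (2 - 1 - i)" if "i < 2" for i
    using lt[OF that] by (elim insertE emptyE) (simp_all add: vals del: alternating_root.simps One_nat_def)
  show "\<exists>c d. d \<noteq> 0 \<and> alternating_root \<alpha> \<beta> i = c *\<^sub>R \<beta> + d *\<^sub>R \<alpha>" if "Suc i < 2" for i
    using Suc_lt[OF that] by (elim insertE emptyE; simp only: vals) (auto intro!: ex_comb)
  show "\<exists>c d. d \<noteq> 0 \<and> alternating_root \<beta> \<alpha> i = c *\<^sub>R \<alpha> + d *\<^sub>R \<beta>" if "Suc i < 2" for i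
    using Suc_lt[OF that] by (elim insertE emptyE; simp only: vals) (auto intro!: ex_comb')
  show "\<exists>c d. c \<ge> 0 \<and> d \<ge> 0 \<and> alternating_root \<alpha> \<beta> i = c *\<^sub>R alternating_root \<alpha> \<beta> (Suc i) + d *\<^sub>R \<alpha>"
    if "Suc i < 2" for i
    using Suc_lt[OF that] by (elim insertE emptyE; simp only: vals Suc_numerals; intro ex_comb_step; simp)
  have "alternating_refl \<alpha> \<beta> 2 (v - comb 0 0) = alternating_refl \<beta> \<alpha> 2 (v - comb 0 0)" for v
    by (simp add: eval_nat_numeral refl_diff_comb kl algebra_simps)
  then have braid: "alternating_refl \<alpha> \<beta> 2 v = alternating_refl \<beta> \<alpha> 2 v" for v
    by (simp only: alternating_refl_comb[symmetric])
  then show "alternating_refl \<alpha> \<beta> 2 = alternating_refl \<beta> \<alpha> 2" by (rule ext)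
  fix b z F
  assume z: "\<forall>\<gamma>\<in>\<Delta>. z \<bullet> coroot \<gamma> \<noteq> 0"
    and signs: "dihedral_signs W (\<lambda>w. w \<circ> refl \<alpha>) (\<lambda>w. w \<circ> refl \<beta>) (\<lambda>i. neg (alternating_root \<alpha> \<beta> (i - 1))) 2"
  interpret dihedral_signs b W "\<lambda>w. w \<circ> refl \<alpha>" "\<lambda>w. w \<circ> refl \<beta>" "\<lambda>i. neg (alternating_root \<alpha> \<beta> (i - 1))" 2
    by (rule signs)
  have upt: "[0..<2] = [0,1]" by (simp add: upt_rec)
  let ?A = "baxter b W (\<lambda>w. w \<circ> refl \<alpha>) (neg \<alpha>)" and ?B = "baxter b W (\<lambda>w. w \<circ> refl \<beta>) (neg \<beta>)"
  let ?f = "\<lambda>i. trig z (alternating_root \<alpha> \<beta> i)"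
  have braid': "w \<circ> refl \<beta> \<circ> refl \<alpha> = w \<circ> refl \<alpha> \<circ> refl \<beta>" for w
    by (rule ext) (use braid in \<open>simp add: eval_nat_numeral\<close>)
  have ends: "alternating_root \<alpha> \<beta> (1 - 1) = \<alpha>" "alternating_root \<alpha> \<beta> (2 - 1) = \<beta>"
    using vals(2) comb_basis by simp_all
  have "?A (?f 0) (?B (?f 1) F)
      = ?B (?f 1) (?A (?f 0) F)"
    using baxter_braid_2[OF refl braid'] unfolding ends by simp
  then show "dressed b \<alpha> \<beta> (map (trig z) (map (alternating_root \<alpha> \<beta>) [0..<2])) F =
      dressed b \<beta> \<alpha> (map (trig z) (rev (map (alternating_root \<alpha> \<beta>) [0..<2]))) F"
    by (simp only: upt list.map rev.simps append.simps dressed.simps)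
qed simp

text \<open>Type A2: the middle coroot is the sum of the outer two, which gives the single relation
  between the parameters.\<close>

lemma yb_equation_3:
  assumes kl: "k = 1" "l = 1"
  shows "yb_equation (yb_segment \<alpha> \<beta>) \<and> yb_equation (yb_segment \<beta> \<alpha>)"
proof (rule yb_equation_alternating[where m = 3])
  have vals: "alternating_root \<alpha> \<beta> 0 = comb 1 0" "alternating_root \<alpha> \<beta> 1 = comb 1 1"
    "alternating_root \<alpha> \<beta> 2 = comb 0 1" "alternating_root \<beta> \<alpha> 0 = comb 0 1"
    "alternating_root \<beta> \<alpha> 1 = comb 1 1" "alternating_root \<beta> \<alpha> 2 = comb 1 0"
    by (simp_all add: alternating_calc kl del: alternating_root.simps(1))
  note vals = vals vals(2)[unfolded One_nat_def]
  have co: "coroot (alternating_root \<alpha> \<beta> 0) = cocomb 1 0" "coroot (alternating_root \<alpha> \<beta> 1) = cocomb 1 1"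
    "coroot (alternating_root \<alpha> \<beta> 2) = cocomb 0 1"
    by (simp_all add: eval_nat_numeral coroot_alternating refl_comb kl del: alternating_root.simps)
  have lt: "i \<in> {0,1,2}" if "i < 3" for i :: nat using that by auto
  have Suc_lt: "i \<in> {0,1}" if "Suc i < 3" for i :: nat using that by auto
  show "alternating_root \<beta> \<alpha> i = alternating_root \<alpha> \<beta> (3 - 1 - i)" if "i < 3" for i
    using lt[OF that] by (elim insertE emptyE) (simp_all add: vals del: alternating_root.simps One_nat_def)
  show "\<exists>c d. d \<noteq> 0 \<and> alternating_root \<alpha> \<beta> i = c *\<^sub>R \<beta> + d *\<^sub>R \<alpha>" if "Suc i < 3" for i
    using Suc_lt[OF that] by (elim insertE emptyE; simp only: vals) (auto intro!: ex_comb)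
  show "\<exists>c d. d \<noteq> 0 \<and> alternating_root \<beta> \<alpha> i = c *\<^sub>R \<alpha> + d *\<^sub>R \<beta>" if "Suc i < 3" for i
    using Suc_lt[OF that] by (elim insertE emptyE; simp only: vals) (auto intro!: ex_comb')
  show "\<exists>c d. c \<ge> 0 \<and> d \<ge> 0 \<and> alternating_root \<alpha> \<beta> i = c *\<^sub>R alternating_root \<alpha> \<beta> (Suc i) + d *\<^sub>R \<alpha>"
    if "Suc i < 3" for i
    using Suc_lt[OF that] by (elim insertE emptyE; simp only: vals Suc_numerals; intro ex_comb_step; simp)
  have "alternating_refl \<alpha> \<beta> 3 (v - comb 0 0) = alternating_refl \<beta> \<alpha> 3 (v - comb 0 0)" for v
    by (simp add: eval_nat_numeral refl_diff_comb kl algebra_simps)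
  then have braid: "alternating_refl \<alpha> \<beta> 3 v = alternating_refl \<beta> \<alpha> 3 v" for v
    by (simp only: alternating_refl_comb[symmetric])
  then show "alternating_refl \<alpha> \<beta> 3 = alternating_refl \<beta> \<alpha> 3" by (rule ext)
  fix b z F
  assume z: "\<forall>\<gamma>\<in>\<Delta>. z \<bullet> coroot \<gamma> \<noteq> 0"
    and signs: "dihedral_signs W (\<lambda>w. w \<circ> refl \<alpha>) (\<lambda>w. w \<circ> refl \<beta>) (\<lambda>i. neg (alternating_root \<alpha> \<beta> (i - 1))) 3"
  interpret dihedral_signs b W "\<lambda>w. w \<circ> refl \<alpha>" "\<lambda>w. w \<circ> refl \<beta>" "\<lambda>i. neg (alternating_root \<alpha> \<beta> (i - 1))" 3
    by (rule signs)
  have upt: "[0..<3] = [0,1,2]" by (simp add: upt_rec)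
  let ?A = "baxter b W (\<lambda>w. w \<circ> refl \<alpha>) (neg \<alpha>)" and ?B = "baxter b W (\<lambda>w. w \<circ> refl \<beta>) (neg \<beta>)"
  let ?f = "\<lambda>i. trig z (alternating_root \<alpha> \<beta> i)"
  have braid': "w \<circ> refl \<alpha> \<circ> refl \<beta> \<circ> refl \<alpha> = w \<circ> refl \<beta> \<circ> refl \<alpha> \<circ> refl \<beta>" for w
    by (rule ext) (use braid in \<open>simp add: eval_nat_numeral\<close>)
  have f: "?f 0 * ?f 2 = ?f 1 * (?f 0 + ?f 2 - 1)"
    by (intro trig_alternating z; simp only: co cocomb_add; simp)+
  have ends: "alternating_root \<alpha> \<beta> (1 - 1) = \<alpha>" "alternating_root \<alpha> \<beta> (3 - 1) = \<beta>"
    using vals(3) comb_basis by simp_all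
  have "?A (?f 0) (?B (?f 1) (?A (?f 2) F))
      = ?B (?f 2) (?A (?f 1) (?B (?f 0) F))"
    using baxter_braid_3[OF refl braid' f] unfolding ends by simp
  then show "dressed b \<alpha> \<beta> (map (trig z) (map (alternating_root \<alpha> \<beta>) [0..<3])) F =
      dressed b \<beta> \<alpha> (map (trig z) (rev (map (alternating_root \<alpha> \<beta>) [0..<3]))) F"
    by (simp only: upt list.map rev.simps append.simps dressed.simps)
qed simp

text \<open>Type B2 with \<beta> long. In the basis of the two coroots the sequence is
  \<open>(1,0), (1,1), (1,2), (0,1)\<close>; each middle entry is its predecessor plus the last
  one.\<close>

lemma yb_equation_4:
  assumes kl: "k = 2" "l = 1"
  shows "yb_equation (yb_segment \<alpha> \<beta>) \<and> yb_equation (yb_segment \<beta> \<alpha>)"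
proof (rule yb_equation_alternating[where m = 4])
  have vals: "alternating_root \<alpha> \<beta> 0 = comb 1 0" "alternating_root \<alpha> \<beta> 1 = comb 2 1"
    "alternating_root \<alpha> \<beta> 2 = comb 1 1" "alternating_root \<alpha> \<beta> 3 = comb 0 1"
    "alternating_root \<beta> \<alpha> 0 = comb 0 1" "alternating_root \<beta> \<alpha> 1 = comb 1 1"
    "alternating_root \<beta> \<alpha> 2 = comb 2 1" "alternating_root \<beta> \<alpha> 3 = comb 1 0"
    by (simp_all add: alternating_calc kl del: alternating_root.simps(1))
  note vals = vals vals(2)[unfolded One_nat_def]
  have co: "coroot (alternating_root \<alpha> \<beta> 0) = cocomb 1 0" "coroot (alternating_root \<alpha> \<beta> 1) = cocomb 1 1"
    "coroot (alternating_root \<alpha> \<beta> 2) = cocomb 1 2" "coroot (alternating_root \<alpha> \<beta> 3) = cocomb 0 1"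
    by (simp_all add: eval_nat_numeral coroot_alternating refl_comb kl del: alternating_root.simps)
  have lt: "i \<in> {0,1,2,3}" if "i < 4" for i :: nat using that by auto
  have Suc_lt: "i \<in> {0,1,2}" if "Suc i < 4" for i :: nat using that by auto
  show "alternating_root \<beta> \<alpha> i = alternating_root \<alpha> \<beta> (4 - 1 - i)" if "i < 4" for i
    using lt[OF that] by (elim insertE emptyE) (simp_all add: vals del: alternating_root.simps One_nat_def)
  show "\<exists>c d. d \<noteq> 0 \<and> alternating_root \<alpha> \<beta> i = c *\<^sub>R \<beta> + d *\<^sub>R \<alpha>" if "Suc i < 4" for i
    using Suc_lt[OF that] by (elim insertE emptyE; simp only: vals) (auto intro!: ex_comb)
  show "\<exists>c d. d \<noteq> 0 \<and> alternating_root \<beta> \<alpha> i = c *\<^sub>R \<alpha> + d *\<^sub>R \<beta>" if "Suc i < 4" for i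
    using Suc_lt[OF that] by (elim insertE emptyE; simp only: vals) (auto intro!: ex_comb')
  show "\<exists>c d. c \<ge> 0 \<and> d \<ge> 0 \<and> alternating_root \<alpha> \<beta> i = c *\<^sub>R alternating_root \<alpha> \<beta> (Suc i) + d *\<^sub>R \<alpha>"
    if "Suc i < 4" for i
    using Suc_lt[OF that] by (elim insertE emptyE; simp only: vals Suc_numerals; intro ex_comb_step; simp)
  have "alternating_refl \<alpha> \<beta> 4 (v - comb 0 0) = alternating_refl \<beta> \<alpha> 4 (v - comb 0 0)" for v
    by (simp add: eval_nat_numeral refl_diff_comb kl algebra_simps)
  then have braid: "alternating_refl \<alpha> \<beta> 4 v = alternating_refl \<beta> \<alpha> 4 v" for v
    by (simp only: alternating_refl_comb[symmetric])
  then show "alternating_refl \<alpha> \<beta> 4 = alternating_refl \<beta> \<alpha> 4" by (rule ext)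
  fix b z F
  assume z: "\<forall>\<gamma>\<in>\<Delta>. z \<bullet> coroot \<gamma> \<noteq> 0"
    and signs: "dihedral_signs W (\<lambda>w. w \<circ> refl \<alpha>) (\<lambda>w. w \<circ> refl \<beta>) (\<lambda>i. neg (alternating_root \<alpha> \<beta> (i - 1))) 4"
  interpret dihedral_signs b W "\<lambda>w. w \<circ> refl \<alpha>" "\<lambda>w. w \<circ> refl \<beta>" "\<lambda>i. neg (alternating_root \<alpha> \<beta> (i - 1))" 4
    by (rule signs)
  have upt: "[0..<4] = [0,1,2,3]" by (simp add: upt_rec)
  let ?A = "baxter b W (\<lambda>w. w \<circ> refl \<alpha>) (neg \<alpha>)" and ?B = "baxter b W (\<lambda>w. w \<circ> refl \<beta>) (neg \<beta>)"
  let ?f = "\<lambda>i. trig z (alternating_root \<alpha> \<beta> i)"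
  have braid': "w \<circ> refl \<beta> \<circ> refl \<alpha> \<circ> refl \<beta> \<circ> refl \<alpha> = w \<circ> refl \<alpha> \<circ> refl \<beta> \<circ> refl \<alpha> \<circ> refl \<beta>" for w
    by (rule ext) (use braid in \<open>simp add: eval_nat_numeral\<close>)
  have f: "?f 0 * ?f 3 = ?f 1 * (?f 0 + ?f 3 - 1)" "?f 1 * ?f 3 = ?f 2 * (?f 1 + ?f 3 - 1)"
    by (intro trig_alternating z; simp only: co cocomb_add; simp)+
  have ends: "alternating_root \<alpha> \<beta> (1 - 1) = \<alpha>" "alternating_root \<alpha> \<beta> (4 - 1) = \<beta>"
    using vals(4) comb_basis by simp_all
  have "?A (?f 0) (?B (?f 1) (?A (?f 2) (?B (?f 3) F)))
      = ?B (?f 3) (?A (?f 2) (?B (?f 1) (?A (?f 0) F)))"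
    using baxter_braid_4[OF refl braid' f] unfolding ends by simp
  then show "dressed b \<alpha> \<beta> (map (trig z) (map (alternating_root \<alpha> \<beta>) [0..<4])) F =
      dressed b \<beta> \<alpha> (map (trig z) (rev (map (alternating_root \<alpha> \<beta>) [0..<4]))) F"
    by (simp only: upt list.map rev.simps append.simps dressed.simps)
qed simp

text \<open>Type G2 with \<beta> long. The relations between the parameters are read off from
  \<open>co\<close>; for instance the two for the third coroot come from
  \<open>(2,3) = (1,0) + (1,3) = (1,1) + (1,2)\<close>.\<close>

lemma yb_equation_6:
  assumes kl: "k = 3" "l = 1"
  shows "yb_equation (yb_segment \<alpha> \<beta>) \<and> yb_equation (yb_segment \<beta> \<alpha>)"
proof (rule yb_equation_alternating[where m = 6])
  have vals: "alternating_root \<alpha> \<beta> 0 = comb 1 0" "alternating_root \<alpha> \<beta> 1 = comb 3 1"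
    "alternating_root \<alpha> \<beta> 2 = comb 2 1" "alternating_root \<alpha> \<beta> 3 = comb 3 2"
    "alternating_root \<alpha> \<beta> 4 = comb 1 1" "alternating_root \<alpha> \<beta> 5 = comb 0 1"
    "alternating_root \<beta> \<alpha> 0 = comb 0 1" "alternating_root \<beta> \<alpha> 1 = comb 1 1"
    "alternating_root \<beta> \<alpha> 2 = comb 3 2" "alternating_root \<beta> \<alpha> 3 = comb 2 1"
    "alternating_root \<beta> \<alpha> 4 = comb 3 1" "alternating_root \<beta> \<alpha> 5 = comb 1 0"
    by (simp_all add: alternating_calc kl del: alternating_root.simps(1))
  note vals = vals vals(2)[unfolded One_nat_def]
  have co: "coroot (alternating_root \<alpha> \<beta> 0) = cocomb 1 0" "coroot (alternating_root \<alpha> \<beta> 1) = cocomb 1 1"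
    "coroot (alternating_root \<alpha> \<beta> 2) = cocomb 2 3" "coroot (alternating_root \<alpha> \<beta> 3) = cocomb 1 2"
    "coroot (alternating_root \<alpha> \<beta> 4) = cocomb 1 3" "coroot (alternating_root \<alpha> \<beta> 5) = cocomb 0 1"
    by (simp_all add: eval_nat_numeral coroot_alternating refl_comb kl del: alternating_root.simps)
  have lt: "i \<in> {0,1,2,3,4,5}" if "i < 6" for i :: nat using that by auto
  have Suc_lt: "i \<in> {0,1,2,3,4}" if "Suc i < 6" for i :: nat using that by auto
  show "alternating_root \<beta> \<alpha> i = alternating_root \<alpha> \<beta> (6 - 1 - i)" if "i < 6" for i
    using lt[OF that] by (elim insertE emptyE) (simp_all add: vals del: alternating_root.simps One_nat_def)
  show "\<exists>c d. d \<noteq> 0 \<and> alternating_root \<alpha> \<beta> i = c *\<^sub>R \<beta> + d *\<^sub>R \<alpha>" if "Suc i < 6" for i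
    using Suc_lt[OF that] by (elim insertE emptyE; simp only: vals) (auto intro!: ex_comb)
  show "\<exists>c d. d \<noteq> 0 \<and> alternating_root \<beta> \<alpha> i = c *\<^sub>R \<alpha> + d *\<^sub>R \<beta>" if "Suc i < 6" for i
    using Suc_lt[OF that] by (elim insertE emptyE; simp only: vals) (auto intro!: ex_comb')
  show "\<exists>c d. c \<ge> 0 \<and> d \<ge> 0 \<and> alternating_root \<alpha> \<beta> i = c *\<^sub>R alternating_root \<alpha> \<beta> (Suc i) + d *\<^sub>R \<alpha>"
    if "Suc i < 6" for i
    using Suc_lt[OF that] by (elim insertE emptyE; simp only: vals Suc_numerals; intro ex_comb_step; simp)
  have "alternating_refl \<alpha> \<beta> 6 (v - comb 0 0) = alternating_refl \<beta> \<alpha> 6 (v - comb 0 0)" for v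
    by (simp add: eval_nat_numeral refl_diff_comb kl algebra_simps)
  then have braid: "alternating_refl \<alpha> \<beta> 6 v = alternating_refl \<beta> \<alpha> 6 v" for v
    by (simp only: alternating_refl_comb[symmetric])
  then show "alternating_refl \<alpha> \<beta> 6 = alternating_refl \<beta> \<alpha> 6" by (rule ext)
  fix b z F
  assume z: "\<forall>\<gamma>\<in>\<Delta>. z \<bullet> coroot \<gamma> \<noteq> 0"
    and signs: "dihedral_signs W (\<lambda>w. w \<circ> refl \<alpha>) (\<lambda>w. w \<circ> refl \<beta>) (\<lambda>i. neg (alternating_root \<alpha> \<beta> (i - 1))) 6"
  interpret dihedral_signs b W "\<lambda>w. w \<circ> refl \<alpha>" "\<lambda>w. w \<circ> refl \<beta>" "\<lambda>i. neg (alternating_root \<alpha> \<beta> (i - 1))" 6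
    by (rule signs)
  have upt: "[0..<6] = [0,1,2,3,4,5]" by (simp add: upt_rec)
  let ?A = "baxter b W (\<lambda>w. w \<circ> refl \<alpha>) (neg \<alpha>)" and ?B = "baxter b W (\<lambda>w. w \<circ> refl \<beta>) (neg \<beta>)"
  let ?f = "\<lambda>i. trig z (alternating_root \<alpha> \<beta> i)"
  have braid': "w \<circ> refl \<beta> \<circ> refl \<alpha> \<circ> refl \<beta> \<circ> refl \<alpha> \<circ> refl \<beta> \<circ> refl \<alpha> = w \<circ> refl \<alpha> \<circ> refl \<beta> \<circ> refl \<alpha> \<circ> refl \<beta> \<circ> refl \<alpha> \<circ> refl \<beta>" for w
    by (rule ext) (use braid in \<open>simp add: eval_nat_numeral\<close>)
  have f: "?f 0 * ?f 5 = ?f 1 * (?f 0 + ?f 5 - 1)" "?f 1 * ?f 5 = ?f 3 * (?f 1 + ?f 5 - 1)"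
    "?f 3 * ?f 5 = ?f 4 * (?f 3 + ?f 5 - 1)" "?f 0 * ?f 4 = ?f 2 * (?f 0 + ?f 4 - 1)"
    "?f 1 * ?f 3 = ?f 2 * (?f 1 + ?f 3 - 1)"
    by (intro trig_alternating z; simp only: co cocomb_add; simp)+
  have ends: "alternating_root \<alpha> \<beta> (1 - 1) = \<alpha>" "alternating_root \<alpha> \<beta> (6 - 1) = \<beta>"
    using vals(6) comb_basis by simp_all
  have "?A (?f 0) (?B (?f 1) (?A (?f 2) (?B (?f 3) (?A (?f 4) (?B (?f 5) F)))))
      = ?B (?f 5) (?A (?f 4) (?B (?f 3) (?A (?f 2) (?B (?f 1) (?A (?f 0) F)))))"
    using baxter_braid_6[OF refl braid' f] unfolding ends by simp
  then show "dressed b \<alpha> \<beta> (map (trig z) (map (alternating_root \<alpha> \<beta>) [0..<6])) F =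
      dressed b \<beta> \<alpha> (map (trig z) (rev (map (alternating_root \<alpha> \<beta>) [0..<6]))) F"
    by (simp only: upt list.map rev.simps append.simps dressed.simps)
qed simp

end
end

text \<open>The limit keeps a term exactly when its exponent is zero; this is how the edges of the
  graph are selected.\<close>

lemma exp_neg_mult_tendsto:
  assumes "i \<ge> (0::real)"
  shows "(\<lambda>n. exp (- (real n * i))) \<longlonglongrightarrow> of_bool (i = 0)"
proof (cases "i = 0")
  case False
  then have "exp (- i) < 1" using assms by simp
  then have "(\<lambda>n. exp (- i) ^ n) \<longlonglongrightarrow> 0" by (intro LIMSEQ_power_zero) simp
  then show ?thesis using False by (simp add: exp_of_nat_mult[symmetric])
qed simp

lemma foldr_Cons_apply: "foldr f (x # xs) a = f x (foldr f xs a)"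
  by simp

text \<open>This is \<open>f(1/x) = 1 - f(x)\<close>. As the sign condition also switches between 0
  and 1, the difference of the two is odd in the root.\<close>

lemma trig_minus: "z \<bullet> coroot \<gamma> \<noteq> 0 \<Longrightarrow> trig z (- \<gamma>) = 1 - trig z \<gamma>"
proof -
  assume "z \<bullet> coroot \<gamma> \<noteq> 0"
  then have "exp (z \<bullet> coroot \<gamma>) \<noteq> 1" by simp
  then show ?thesis by (simp add: trig_def coroot_minus exp_minus divide_simps)
qed

context based_root_system
begin

text \<open>Strict Cauchy--Schwarz bounds the product of the Cartan integers by 3. Their negatives
  are nonnegative integers that vanish together, so few pairs remain.\<close>

lemma root_pairing_cases:
  assumes ab: "\<alpha> \<in> \<Delta>" "\<beta> \<in> \<Delta>" "\<alpha> \<bullet> coroot \<beta> \<le> 0" "\<alpha> \<noteq> - \<beta>"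
  shows "(- (\<beta> \<bullet> coroot \<alpha>), - (\<alpha> \<bullet> coroot \<beta>)) \<in> {(0,0),(1,1),(2,1),(1,2),(3,1),(1,3)}"
proof -
  let ?k = "- (\<beta> \<bullet> coroot \<alpha>)" and ?l = "- (\<alpha> \<bullet> coroot \<beta>)"
  have pos: "\<alpha> \<bullet> \<alpha> > 0" "\<beta> \<bullet> \<beta> > 0" using root_nonzero ab by auto
  have kl: "?k * (\<alpha> \<bullet> \<alpha>) = - 2 * (\<alpha> \<bullet> \<beta>)" "?l * (\<beta> \<bullet> \<beta>) = - 2 * (\<alpha> \<bullet> \<beta>)"
    using pos by (simp_all add: coroot_def inner_commute)
  obtain i j where ij: "\<beta> \<bullet> coroot \<alpha> = of_int i" "\<alpha> \<bullet> coroot \<beta> = of_int j"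
    using root_pairing_Ints ab by (meson Ints_cases)
  have ab_le: "\<alpha> \<bullet> \<beta> \<le> 0" using kl(2) ab(3) pos by (smt (verit) mult_nonneg_nonneg)
  have "(\<alpha> \<bullet> \<beta>)\<^sup>2 < (\<alpha> \<bullet> \<alpha>) * (\<beta> \<bullet> \<beta>)"
  proof -
    \<comment> \<open>A multiple of the component of \<alpha> orthogonal to \<beta>; it is nonzero
      because the roots are not proportional.\<close>
    define v where "v = (\<beta> \<bullet> \<beta>) *\<^sub>R \<alpha> - (\<alpha> \<bullet> \<beta>) *\<^sub>R \<beta>"
    have "v \<noteq> 0"
    proof
      assume "v = 0"
      then have "(1 + \<alpha> \<bullet> \<beta>) *\<^sub>R \<beta> + (- (\<beta> \<bullet> \<beta>)) *\<^sub>R \<alpha> = \<beta>" by (simp add: v_def algebra_simps)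
      then show False using roots_not_proportional[OF ab, of "- (\<beta> \<bullet> \<beta>)"] pos by auto
    qed
    then have "0 < v \<bullet> v" by simp
    also have "v \<bullet> v = (\<beta> \<bullet> \<beta>) * ((\<alpha> \<bullet> \<alpha>) * (\<beta> \<bullet> \<beta>) - (\<alpha> \<bullet> \<beta>)\<^sup>2)"
      by (simp add: v_def inner_diff_left inner_diff_right inner_commute power2_eq_square algebra_simps)
    finally show ?thesis using pos by (simp add: zero_less_mult_iff)
  qed
  moreover have "(?k * ?l) * ((\<alpha> \<bullet> \<alpha>) * (\<beta> \<bullet> \<beta>)) = 4 * (\<alpha> \<bullet> \<beta>)\<^sup>2"
    using arg_cong2[OF kl, of "(*)"] by (simp add: power2_eq_square algebra_simps)
  ultimately have "(?k * ?l) * ((\<alpha> \<bullet> \<alpha>) * (\<beta> \<bullet> \<beta>)) < 4 * ((\<alpha> \<bullet> \<alpha>) * (\<beta> \<bullet> \<beta>))" by simp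
  then have "?k * ?l < 4" using pos by (simp add: mult_less_cancel_right)
  then have lt: "i * j < 4" unfolding ij by (simp flip: of_int_mult)
  have "?k \<ge> 0" using kl(1) ab_le pos by (smt (verit) mult_neg_pos)
  then have i: "i \<le> 0" and j: "j \<le> 0" using ij ab(3) by simp_all
  have "i = 0 \<longleftrightarrow> j = 0" using kl ij pos by auto
  moreover have "i > - 4" if "j \<noteq> 0"
  proof (rule ccontr)
    assume "\<not> i > - 4"
    then have "4 * 1 \<le> (- i) * (- j)" using that j by (intro mult_mono) auto
    then show False using lt by simp
  qed
  moreover have "j > - 4" if "i \<noteq> 0"
  proof (rule ccontr)
    assume "\<not> j > - 4"
    then have "1 * 4 \<le> (- i) * (- j)" using that i by (intro mult_mono) auto
    then show False using lt by simp
  qed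
  ultimately have "(i, j) \<in> {(0,0),(-1,-1),(-2,-1),(-1,-2),(-3,-1),(-1,-3)}"
  proof (cases "i = 0")
    case False
    then have "i \<in> {-1,-2,-3}" "j \<in> {-1,-2,-3}"
      using \<open>i = 0 \<longleftrightarrow> j = 0\<close> \<open>j \<noteq> 0 \<Longrightarrow> i > - 4\<close> \<open>i \<noteq> 0 \<Longrightarrow> j > - 4\<close> i j by auto
    then show ?thesis using lt by auto
  qed auto
  then show ?thesis unfolding ij by auto
qed

text \<open>The pairs \<open>(1,2)\<close> and \<open>(1,3)\<close> are the cases
  \<open>(2,1)\<close> and \<open>(3,1)\<close> with the two roots exchanged.\<close>

lemma yb_equation_yb_segment:
  assumes ab: "\<alpha> \<in> \<Delta>" "\<beta> \<in> \<Delta>" "\<alpha> \<bullet> coroot \<beta> \<le> 0" "\<alpha> \<noteq> - \<beta>"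
  shows "yb_equation (yb_segment \<alpha> \<beta>)"
proof -
  let ?k = "- (\<beta> \<bullet> coroot \<alpha>)" and ?l = "- (\<alpha> \<bullet> coroot \<beta>)"
  have kl: "(?k, ?l) \<in> {(0,0),(1,1),(2,1),(1,2),(3,1),(1,3)}"
    using root_pairing_cases[OF ab] .
  then have nn: "?k \<ge> 0" "?l \<ge> 0" by auto
  have ab': "\<beta> \<noteq> - \<alpha>" using ab(4) by auto
  have m: "\<beta> \<bullet> coroot \<alpha> = - ?k" "\<alpha> \<bullet> coroot \<beta> = - ?l" by simp_all
  note eqs = yb_equation_2 yb_equation_3 yb_equation_4 yb_equation_6
  note ltr = eqs[OF ab(1,2,4) m nn] and rtl = eqs[OF ab(2,1) ab' m(2,1) nn(2,1)]
  show ?thesis using kl ltr rtl by auto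
qed

end

section \<open>The limit to the quantum Bruhat graph\<close>

context based_root_system
begin

text \<open>Here \<open>b = e\<^sup>-\<^sup>n\<close>, and \<open>q\<close> to the power \<open>\<gamma>\<^sup>\<or>\<close> is the exponential of \<open>-\<langle>y + 2n\<rho>, \<gamma>\<^sup>\<or>\<rangle>\<close>.\<close>

definition conj_coeff :: "'a \<Rightarrow> nat \<Rightarrow> ('a \<Rightarrow> 'a) \<Rightarrow> 'a \<Rightarrow> real" where
  "conj_coeff y n w \<gamma> = (trig (y + (2 * real n) *\<^sub>R rho \<Delta> S) \<gamma> - of_bool (neg \<gamma> w))
     * exp (- (real n * (real (len (w \<circ> refl \<gamma>)) - real (len w) - 1)))"

text \<open>Non-edges get coefficient 0. Along a path the exponentials of the quantum edges multiply
  to the exponential of minus the pairing of \<open>y\<close> with \<open>down\<close>.\<close>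

definition qbg_coeff :: "'a \<Rightarrow> ('a \<Rightarrow> 'a) \<Rightarrow> 'a \<Rightarrow> real" where
  "qbg_coeff y w \<gamma> = (let \<gamma>' = root_abs \<Delta> S \<gamma> in root_sgn \<Delta> S \<gamma> *
     (of_bool (bruhat_edge \<Delta> S w \<gamma>') + of_bool (quantum_edge \<Delta> S w \<gamma>') * exp (- (y \<bullet> coroot \<gamma>'))))"

lemma rho_pos: "\<gamma> \<in> pos \<Longrightarrow> rho \<Delta> S \<bullet> coroot \<gamma> > 0"
  using len_refl_rho[of \<gamma>] by linarith

lemma quantum_edge_len_less:
  assumes "quantum_edge \<Delta> S w \<gamma>"
  shows "len (w \<circ> refl \<gamma>) \<le> len w"
  using assms len_refl_rho[of \<gamma>] by (auto simp: quantum_edge_def)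

lemma neg_iff_not_pos: "w \<in> W \<Longrightarrow> \<gamma> \<in> \<Delta> \<Longrightarrow> neg \<gamma> w \<longleftrightarrow> w \<gamma> \<notin> pos"
  using weyl_root[of w \<gamma>] pos_iff_ht[of "w \<gamma>"] ht_root_nonzero[of "w \<gamma>"] by (auto simp: neg_def)

text \<open>Each pairing is affine in \<open>n\<close> with slope
  \<open>2 * (rho \<Delta> S \<bullet> coroot \<gamma>)\<close>, which is nonzero for every root,
  and there are finitely many roots.\<close>

lemma eventually_regular:
  "\<forall>\<^sub>F n in sequentially. \<forall>\<gamma>\<in>\<Delta>. (y + (2 * real n) *\<^sub>R rho \<Delta> S) \<bullet> coroot \<gamma> \<noteq> 0"
proof (intro eventually_ball_finite finite_roots ballI)
  have pos: "\<forall>\<^sub>F n in sequentially. (y + (2 * real n) *\<^sub>R rho \<Delta> S) \<bullet> coroot \<gamma> > 0" if "\<gamma> \<in> pos" for \<gamma>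
  proof -
    have "filterlim (\<lambda>n. y \<bullet> coroot \<gamma> + (2 * (rho \<Delta> S \<bullet> coroot \<gamma>)) * real n) at_top sequentially"
      using rho_pos[OF that]
      by (intro filterlim_tendsto_add_at_top[OF tendsto_const] filterlim_tendsto_pos_mult_at_top[OF tendsto_const]
          filterlim_real_sequentially) auto
    then show ?thesis
      by (simp add: filterlim_at_top_dense inner_add_left algebra_simps)
  qed
  fix \<gamma> assume g: "\<gamma> \<in> \<Delta>"
  then show "\<forall>\<^sub>F n in sequentially. (y + (2 * real n) *\<^sub>R rho \<Delta> S) \<bullet> coroot \<gamma> \<noteq> 0"
  proof (cases "\<gamma> \<in> pos")
    case True
    from pos[OF this] show ?thesis by eventually_elim simp
  next
    case False
    then have "- \<gamma> \<in> pos" using g root_pos_or_neg by blast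
    from pos[OF this] show ?thesis by eventually_elim (simp add: coroot_minus)
  qed
qed

lemma conj_coeff_tendsto_pos:
  assumes w: "w \<in> W" and g: "\<gamma> \<in> pos"
  shows "(\<lambda>n. conj_coeff y n w \<gamma>) \<longlonglongrightarrow> qbg_coeff y w \<gamma>"
proof -
  let ?x = "\<lambda>n. exp (- ((y + (2 * real n) *\<^sub>R rho \<Delta> S) \<bullet> coroot \<gamma>))"
  let ?r = "2 * (rho \<Delta> S \<bullet> coroot \<gamma>)"
  let ?j = "real (len (w \<circ> refl \<gamma>)) - real (len w) - 1"
  have gD: "\<gamma> \<in> \<Delta>" using g pos_subset by auto
  have x: "?x n = exp (- (y \<bullet> coroot \<gamma>)) * exp (- (real n * ?r))" for n
    by (simp add: inner_add_left exp_add[symmetric] algebra_simps)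
  have "(\<lambda>n. exp (- (y \<bullet> coroot \<gamma>)) * exp (- (real n * ?r))) \<longlonglongrightarrow> exp (- (y \<bullet> coroot \<gamma>)) * of_bool (?r = 0)"
    using rho_pos[OF g] by (intro tendsto_intros exp_neg_mult_tendsto) simp
  then have x0: "?x \<longlonglongrightarrow> 0" using rho_pos[OF g] unfolding x by simp
  have abs: "root_abs \<Delta> S \<gamma> = \<gamma>" "root_sgn \<Delta> S \<gamma> = 1" using g by (simp_all add: root_abs_def root_sgn_def)
  show ?thesis
  proof (cases "w \<gamma> \<in> pos")
    case True
    then have up: "len w < len (w \<circ> refl \<gamma>)" using len_refl_greater w g by blast
    then have j: "?j \<ge> 0" by linarith
    have "(\<lambda>n. (1 / (1 - ?x n) - 0) * exp (- (real n * ?j))) \<longlonglongrightarrow> (1 / (1 - 0) - 0) * of_bool (?j = 0)"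
      by (intro tendsto_intros exp_neg_mult_tendsto x0 j) simp
    moreover have "qbg_coeff y w \<gamma> = of_bool (?j = 0)"
      using up quantum_edge_len_less[of w \<gamma>] g by (auto simp: qbg_coeff_def abs bruhat_edge_def)
    moreover have "\<not> neg \<gamma> w" using True neg_iff_not_pos w gD by blast
    ultimately show ?thesis by (simp add: conj_coeff_def trig_def)
  next
    case False
    then have dn: "len (w \<circ> refl \<gamma>) < len w" using len_refl_less w g by blast
    have i: "?r + ?j \<ge> 0" using len_refl_le[OF w gD] len_refl_rho[OF g] by linarith
    have "(\<lambda>n. 1 / (1 - ?x n) * (exp (- (y \<bullet> coroot \<gamma>)) * exp (- (real n * (?r + ?j)))))
        \<longlonglongrightarrow> 1 / (1 - 0) * (exp (- (y \<bullet> coroot \<gamma>)) * of_bool (?r + ?j = 0))"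
      by (intro tendsto_intros exp_neg_mult_tendsto x0 i) simp
    moreover have "qbg_coeff y w \<gamma> = exp (- (y \<bullet> coroot \<gamma>)) * of_bool (?r + ?j = 0)"
      using dn g by (auto simp: qbg_coeff_def abs bruhat_edge_def quantum_edge_def)
    moreover have "\<forall>\<^sub>F n in sequentially. 1 / (1 - ?x n) * (exp (- (y \<bullet> coroot \<gamma>)) * exp (- (real n * (?r + ?j))))
        = conj_coeff y n w \<gamma>"
      using eventually_regular[of y]
    proof eventually_elim
      case (elim n)
      then have "?x n \<noteq> 1" using gD by auto
      \<comment> \<open>Subtracting 1 for the negative sign leaves a factor \<open>?x n\<close>,
        whose rate \<open>?r\<close> compensates the descent in length.\<close>
      then have "1 / (1 - ?x n) - 1 = 1 / (1 - ?x n) * ?x n" by (simp add: field_simps)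
      moreover have "?x n * exp (- (real n * ?j)) = exp (- (y \<bullet> coroot \<gamma>)) * exp (- (real n * (?r + ?j)))"
        by (simp only: x) (simp add: exp_add[symmetric] algebra_simps)
      moreover have "neg \<gamma> w" using False neg_iff_not_pos w gD by blast
      ultimately show ?case by (simp add: conj_coeff_def trig_def)
    qed
    ultimately show ?thesis by (simp add: tendsto_cong)
  qed
qed

text \<open>Negating the root changes the sign of both the coefficient, by
  \<open>trig_minus\<close>, and its limit, so positive roots suffice.\<close>

lemma conj_coeff_tendsto:
  assumes w: "w \<in> W" and g: "\<gamma> \<in> \<Delta>"
  shows "(\<lambda>n. conj_coeff y n w \<gamma>) \<longlonglongrightarrow> qbg_coeff y w \<gamma>"
proof (cases "\<gamma> \<in> pos")
  case False
  then have n: "- \<gamma> \<in> pos" using g root_pos_or_neg by blast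
  have "\<forall>\<^sub>F n in sequentially. - conj_coeff y n w (- \<gamma>) = conj_coeff y n w \<gamma>"
    using eventually_regular[of y]
  proof eventually_elim
    case (elim n)
    have "ht (w \<gamma>) \<noteq> 0" using ht_root_nonzero weyl_root[OF w g] .
    then have "neg (- \<gamma>) w \<longleftrightarrow> \<not> neg \<gamma> w"
      by (auto simp: neg_def linear_neg[OF weyl_linear[OF w]] ht_uminus)
    moreover have "trig (y + (2 * real n) *\<^sub>R rho \<Delta> S) (- \<gamma>) = 1 - trig (y + (2 * real n) *\<^sub>R rho \<Delta> S) \<gamma>"
      using elim g by (blast intro: trig_minus)
    ultimately have "trig (y + (2 * real n) *\<^sub>R rho \<Delta> S) (- \<gamma>) - of_bool (neg (- \<gamma>) w)
        = - (trig (y + (2 * real n) *\<^sub>R rho \<Delta> S) \<gamma> - of_bool (neg \<gamma> w))" by simp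
    then show ?case
      by (simp only: conj_coeff_def refl_minus_root mult_minus_left minus_minus)
  qed
  moreover have "(\<lambda>n. - conj_coeff y n w (- \<gamma>)) \<longlonglongrightarrow> - qbg_coeff y w (- \<gamma>)"
    by (intro tendsto_minus conj_coeff_tendsto_pos w n)
  moreover have "- qbg_coeff y w (- \<gamma>) = qbg_coeff y w \<gamma>"
    using n False by (simp add: Let_def qbg_coeff_def root_abs_def root_sgn_def)
  ultimately show ?thesis by (simp add: tendsto_cong)
qed (rule conj_coeff_tendsto_pos[OF w])

definition step_op ::
    "(('a \<Rightarrow> 'a) \<Rightarrow> 'a \<Rightarrow> real) \<Rightarrow> 'a \<Rightarrow> (('a \<Rightarrow> 'a) \<Rightarrow> real) \<Rightarrow> ('a \<Rightarrow> 'a) \<Rightarrow> real" where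
  "step_op c \<gamma> F w = F w + c w \<gamma> * F (w \<circ> refl \<gamma>)"

text \<open>Length differences telescope along a path, and each operator supplies one factor
  \<open>e^(-n)\<close>. The remaining scalar depends only on the number of operators and on the
  starting vertex.\<close>

lemma yang_list_conj:
  "yang_list (exp (- real n)) (y + (2 * real n) *\<^sub>R rho \<Delta> S) L (\<lambda>v. exp (- (real n * len v)) * F v) w
    = exp (- (real n * (length L + len w))) * foldr (step_op (conj_coeff y n)) L F w"
proof (induction L arbitrary: w)
  case (Cons \<gamma> L)
  let ?G = "foldr (step_op (conj_coeff y n)) L F"
  let ?t = "trig (y + (2 * real n) *\<^sub>R rho \<Delta> S) \<gamma> - of_bool (neg \<gamma> w)"
  have "exp (- (real n * (length L + len (w \<circ> refl \<gamma>)))) = exp (- (real n * (length (\<gamma> # L) + len w)))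
      * exp (- (real n * (real (len (w \<circ> refl \<gamma>)) - real (len w) - 1)))"
    by (simp add: exp_add[symmetric] algebra_simps)
  moreover have "exp (- real n) * exp (- (real n * (length L + len w))) = exp (- (real n * (length (\<gamma> # L) + len w)))"
    by (simp add: exp_add[symmetric] algebra_simps)
  ultimately have "exp (- real n) * (exp (- (real n * (length L + len w))) * ?G w)
      + ?t * (exp (- (real n * (length L + len (w \<circ> refl \<gamma>)))) * ?G (w \<circ> refl \<gamma>))
    = exp (- (real n * (length (\<gamma> # L) + len w))) * (?G w + conj_coeff y n w \<gamma> * ?G (w \<circ> refl \<gamma>))"
    unfolding conj_coeff_def by (simp only: mult.assoc[symmetric]) (simp add: algebra_simps)
  then show ?case
    using Cons.IH unfolding yang_list_def by (simp only: foldr_Cons_apply yang_def step_op_def[of _ \<gamma>])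
qed (simp add: yang_list_def)

lemma foldr_step_op_tendsto:
  assumes "set L \<subseteq> \<Delta>" "w \<in> W"
  shows "(\<lambda>n. foldr (step_op (conj_coeff y n)) L F w) \<longlonglongrightarrow> foldr (step_op (qbg_coeff y)) L F w"
  using assms
proof (induction L arbitrary: w)
  case (Cons \<gamma> L)
  then have "w \<circ> refl \<gamma> \<in> W" by (simp add: weyl_refl)
  then show ?case
    using Cons unfolding foldr.simps o_apply step_op_def[of _ \<gamma>]
    by (intro tendsto_intros conj_coeff_tendsto) auto
qed simp

text \<open>A list and its reverse have the same scalar in \<open>yang_list_conj\<close>, so it
  cancels before the limit is taken.\<close>

lemma quantum_yang_baxter:
  assumes yb: "yb_equation L" and L: "set L \<subseteq> \<Delta>" and w: "w \<in> W"
  shows "foldr (step_op (qbg_coeff y)) L F w = foldr (step_op (qbg_coeff y)) (rev L) F w"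
proof -
  have "\<forall>\<^sub>F n in sequentially. foldr (step_op (conj_coeff y n)) L F w = foldr (step_op (conj_coeff y n)) (rev L) F w"
    using eventually_regular[of y]
  proof eventually_elim
    case (elim n)
    then have "yang_list (exp (- real n)) (y + (2 * real n) *\<^sub>R rho \<Delta> S) L (\<lambda>v. exp (- (real n * len v)) * F v) w
      = yang_list (exp (- real n)) (y + (2 * real n) *\<^sub>R rho \<Delta> S) (rev L) (\<lambda>v. exp (- (real n * len v)) * F v) w"
      using yb w unfolding yb_equation_def by blast
    then show ?case unfolding yang_list_conj by simp
  qed
  then have "(\<lambda>n. foldr (step_op (conj_coeff y n)) L F w) \<longlonglongrightarrow> foldr (step_op (qbg_coeff y)) (rev L) F w"
    using foldr_step_op_tendsto[of "rev L" w y F] L w by (simp add: tendsto_cong)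
  then show ?thesis
    using foldr_step_op_tendsto[OF L w] LIMSEQ_unique by blast
qed

end

section \<open>Signed counts and matchings\<close>

text \<open>For \<open>y = -n e\<close> with \<open>e\<close> of maximal norm, the term of \<open>e\<close> dominates all others.\<close>

lemma exponentials_independent:
  fixes c :: "'a::euclidean_space \<Rightarrow> real"
  assumes fin: "finite D" and zero: "\<And>y. (\<Sum>d\<in>D. c d * exp (- (y \<bullet> d))) = 0" and d: "d \<in> D"
  shows "c d = 0"
proof (rule ccontr)
  assume "c d \<noteq> 0"
  let ?E = "{d\<in>D. c d \<noteq> 0}"
  have E: "finite ?E" "?E \<noteq> {}" using fin d \<open>c d \<noteq> 0\<close> by auto
  then have "Max (norm ` ?E) \<in> norm ` ?E" by (intro Max_in) auto
  then obtain e where e: "e \<in> ?E" "norm e = Max (norm ` ?E)" by force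
  then have le_e: "norm d \<le> norm e" if "d \<in> ?E" for d using that E by auto
  have less: "0 < e \<bullet> e - e \<bullet> d" if "d \<in> ?E - {e}" for d
  proof -
    have "0 < (e - d) \<bullet> (e - d)" using that by auto
    moreover have "d \<bullet> d \<le> e \<bullet> e" using le_e[of d] that by (simp add: norm_le)
    ultimately show ?thesis by (simp add: inner_diff_left inner_diff_right inner_commute)
  qed
  \<comment> \<open>The given relation at \<open>y = - n e\<close>, divided by the dominant
    exponential.\<close>
  have "(\<Sum>d\<in>?E. c d * exp (- (real n * (e \<bullet> e - e \<bullet> d)))) = 0" for n :: nat
  proof -
    have "(\<Sum>d\<in>?E. c d * exp (- (real n * (e \<bullet> e - e \<bullet> d))))
        = exp (- (real n * (e \<bullet> e))) * (\<Sum>d\<in>?E. c d * exp (- ((- real n *\<^sub>R e) \<bullet> d)))"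
      by (simp add: sum_distrib_left exp_add[symmetric] algebra_simps)
    also have "(\<Sum>d\<in>?E. c d * exp (- ((- real n *\<^sub>R e) \<bullet> d))) = (\<Sum>d\<in>D. c d * exp (- ((- real n *\<^sub>R e) \<bullet> d)))"
      using fin by (intro sum.mono_neutral_left) auto
    also note zero
    finally show ?thesis by simp
  qed
  moreover have "(\<lambda>n. \<Sum>d\<in>?E. c d * exp (- (real n * (e \<bullet> e - e \<bullet> d))))
      \<longlonglongrightarrow> (\<Sum>d\<in>?E. c d * of_bool (e \<bullet> e - e \<bullet> d = 0))"
    using less by (intro tendsto_intros exp_neg_mult_tendsto) force
  ultimately have "(\<Sum>d\<in>?E. c d * of_bool (e \<bullet> e - e \<bullet> d = 0)) = 0"
    by (simp add: LIMSEQ_const_iff)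
  also have "(\<Sum>d\<in>?E. c d * of_bool (e \<bullet> e - e \<bullet> d = 0)) = (\<Sum>d\<in>?E. if d = e then c d else 0)"
    using less by (intro sum.cong) force+
  finally show False using e E by simp
qed

text \<open>Elements of equal key and opposite sign are removed in pairs until none is left. A
  removal preserves the signed sum of every key, and the removed pairs form the involution.\<close>

lemma signed_pairing:
  fixes sgn :: "'x \<Rightarrow> int" and key :: "'x \<Rightarrow> 'k"
  assumes "finite X" and "\<forall>A\<in>X. sgn A \<in> {1, -1}"
  shows "\<exists>Z\<subseteq>X. (\<exists>I. \<forall>A\<in>X - Z. I A \<in> X - Z \<and> I (I A) = A \<and> key (I A) = key A \<and> sgn (I A) = - sgn A)
    \<and> (\<forall>A\<in>Z. \<forall>B\<in>Z. key A = key B \<longrightarrow> sgn A = sgn B)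
    \<and> (\<forall>\<kappa>. (\<Sum>A\<in>{A\<in>Z. key A = \<kappa>}. sgn A) = (\<Sum>A\<in>{A\<in>X. key A = \<kappa>}. sgn A))"
  using assms
proof (induction X rule: finite_psubset_induct)
  case (psubset X)
  show ?case
  proof (cases "\<exists>A\<in>X. \<exists>B\<in>X. key A = key B \<and> sgn A \<noteq> sgn B")
    case True
    then obtain A B where AB: "A \<in> X" "B \<in> X" "key A = key B" "sgn A \<noteq> sgn B" by blast
    have sAB: "sgn B = - sgn A" using AB(4) bspec[OF psubset.prems AB(1)] bspec[OF psubset.prems AB(2)] by auto
    have "A \<noteq> B" using AB by auto
    define X' where "X' = X - {A, B}"
    have X': "X' \<subset> X" "X = insert A (insert B X')" "A \<notin> X'" "B \<notin> X'" "finite X'"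
      using AB psubset.hyps by (auto simp: X'_def)
    have prems': "\<forall>A\<in>X'. sgn A \<in> {1, -1}" using X'(1) by (intro ballI bspec[OF psubset.prems]) (simp add: psubset_eq subset_iff)
    from psubset.IH[OF X'(1) prems']
    obtain Z I where Z: "Z \<subseteq> X'" 
      and I: "\<forall>C\<in>X' - Z. I C \<in> X' - Z \<and> I (I C) = C \<and> key (I C) = key C \<and> sgn (I C) = - sgn C"
      and mono: "\<forall>A\<in>Z. \<forall>B\<in>Z. key A = key B \<longrightarrow> sgn A = sgn B"
      and sum: "\<forall>\<kappa>. (\<Sum>A\<in>{A\<in>Z. key A = \<kappa>}. sgn A) = (\<Sum>A\<in>{A\<in>X'. key A = \<kappa>}. sgn A)"
      by (elim exE conjE) (rule that; assumption)
    have sum_X: "(\<Sum>C\<in>{C\<in>X. key C = \<kappa>}. sgn C) = (\<Sum>C\<in>{C\<in>X'. key C = \<kappa>}. sgn C)" for \<kappa>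
    proof (cases "key A = \<kappa>")
      case True
      then have "{C\<in>X. key C = \<kappa>} = insert A (insert B {C\<in>X'. key C = \<kappa>})"
        using AB X'(2) by auto
      then show ?thesis using X' \<open>A \<noteq> B\<close> sAB by simp
    next
      case False
      then have "{C\<in>X. key C = \<kappa>} = {C\<in>X'. key C = \<kappa>}"
        using AB X'(2) by auto
      then show ?thesis by simp
    qed
    have "\<forall>C\<in>X - Z. (I(A := B, B := A)) C \<in> X - Z \<and> (I(A := B, B := A)) ((I(A := B, B := A)) C) = C
        \<and> key ((I(A := B, B := A)) C) = key C \<and> sgn ((I(A := B, B := A)) C) = - sgn C"
    proof
      fix C assume C: "C \<in> X - Z"
      consider "C = A" | "C = B" | "C \<in> X' - Z" using C X'(2) by auto
      then show "(I(A := B, B := A)) C \<in> X - Z \<and> (I(A := B, B := A)) ((I(A := B, B := A)) C) = C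
        \<and> key ((I(A := B, B := A)) C) = key C \<and> sgn ((I(A := B, B := A)) C) = - sgn C"
      proof cases
        case 3
        then have "C \<noteq> A" "C \<noteq> B" "I C \<noteq> A" "I C \<noteq> B" using X' bspec[OF I 3] by auto
        then show ?thesis using bspec[OF I 3] X' by auto
      qed (use AB Z X' sAB \<open>A \<noteq> B\<close> in auto)
    qed
    then have inv: "\<exists>I. \<forall>C\<in>X - Z. I C \<in> X - Z \<and> I (I C) = C \<and> key (I C) = key C \<and> sgn (I C) = - sgn C"
      by (rule exI[where x = "I(A := B, B := A)"])
    have "Z \<subseteq> X" using Z X'(1) by blast
    then show ?thesis
      by (intro exI[of _ Z] conjI inv mono) (simp_all only: sum sum_X simp_thms)
  next
    case False
    have mono: "\<forall>A\<in>X. \<forall>B\<in>X. key A = key B \<longrightarrow> sgn A = sgn B"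
    proof (intro ballI impI)
      fix A B assume "A \<in> X" "B \<in> X" "key A = key B"
      then show "sgn A = sgn B" using False by meson
    qed
    have "\<forall>A\<in>X - X. id A \<in> X - X \<and> id (id A) = A \<and> key (id A) = key A \<and> sgn (id A) = - sgn A"
      by simp
    then have "\<exists>I. \<forall>A\<in>X - X. I A \<in> X - X \<and> I (I A) = A \<and> key (I A) = key A \<and> sgn (I A) = - sgn A"
      by (rule exI[where x = id])
    with mono show ?thesis by (intro exI[of _ X] conjI subset_refl allI refl)
  qed
qed

text \<open>On what \<open>signed_pairing\<close> leaves, each key has a single sign, so its signed
  sum determines both the sign and the number of elements. Equal sums give bijections key by key,
  which are glued to \<open>Y\<close>.\<close>

lemma signed_matching:
  fixes sgn1 :: "'x \<Rightarrow> int" and sgn2 :: "'y \<Rightarrow> int" and key1 :: "'x \<Rightarrow> 'k" and key2 :: "'y \<Rightarrow> 'k"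
  assumes fin: "finite X1" "finite X2"
    and sgn: "\<forall>A\<in>X1. sgn1 A \<in> {1, -1}" "\<forall>A\<in>X2. sgn2 A \<in> {1, -1}"
    and eq: "\<And>\<kappa>. (\<Sum>A\<in>{A\<in>X1. key1 A = \<kappa>}. sgn1 A) = (\<Sum>A\<in>{A\<in>X2. key2 A = \<kappa>}. sgn2 A)"
  obtains Z1 Z2 Y I1 I2 where "Z1 \<subseteq> X1" "Z2 \<subseteq> X2" "bij_betw Y Z1 Z2"
    "\<forall>A\<in>Z1. key2 (Y A) = key1 A \<and> sgn2 (Y A) = sgn1 A"
    "\<forall>A\<in>X1 - Z1. I1 A \<in> X1 - Z1 \<and> I1 (I1 A) = A \<and> key1 (I1 A) = key1 A \<and> sgn1 (I1 A) = - sgn1 A"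
    "\<forall>A\<in>X2 - Z2. I2 A \<in> X2 - Z2 \<and> I2 (I2 A) = A \<and> key2 (I2 A) = key2 A \<and> sgn2 (I2 A) = - sgn2 A"
proof -
  obtain Z1 I1 where Z1: "Z1 \<subseteq> X1"
    and I1: "\<forall>A\<in>X1 - Z1. I1 A \<in> X1 - Z1 \<and> I1 (I1 A) = A \<and> key1 (I1 A) = key1 A \<and> sgn1 (I1 A) = - sgn1 A"
    and mono1: "\<forall>A\<in>Z1. \<forall>B\<in>Z1. key1 A = key1 B \<longrightarrow> sgn1 A = sgn1 B"
    and sum1: "\<forall>\<kappa>. (\<Sum>A\<in>{A\<in>Z1. key1 A = \<kappa>}. sgn1 A) = (\<Sum>A\<in>{A\<in>X1. key1 A = \<kappa>}. sgn1 A)"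
    using signed_pairing[OF fin(1) sgn(1), where key = key1] by (elim exE conjE) (rule that; assumption)
  obtain Z2 I2 where Z2: "Z2 \<subseteq> X2"
    and I2: "\<forall>A\<in>X2 - Z2. I2 A \<in> X2 - Z2 \<and> I2 (I2 A) = A \<and> key2 (I2 A) = key2 A \<and> sgn2 (I2 A) = - sgn2 A"
    and mono2: "\<forall>A\<in>Z2. \<forall>B\<in>Z2. key2 A = key2 B \<longrightarrow> sgn2 A = sgn2 B"
    and sum2: "\<forall>\<kappa>. (\<Sum>A\<in>{A\<in>Z2. key2 A = \<kappa>}. sgn2 A) = (\<Sum>A\<in>{A\<in>X2. key2 A = \<kappa>}. sgn2 A)"
    using signed_pairing[OF fin(2) sgn(2), where key = key2] by (elim exE conjE) (rule that; assumption)
  let ?F1 = "\<lambda>\<kappa>. {A\<in>Z1. key1 A = \<kappa>}" and ?F2 = "\<lambda>\<kappa>. {A\<in>Z2. key2 A = \<kappa>}"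
  have finF: "finite (?F1 \<kappa>)" "finite (?F2 \<kappa>)" for \<kappa>
    using finite_subset[OF Z1 fin(1)] finite_subset[OF Z2 fin(2)] by simp_all
  have c1: "(\<Sum>A\<in>?F1 \<kappa>. sgn1 A) = sgn1 A * int (card (?F1 \<kappa>))" if "A \<in> ?F1 \<kappa>" for A \<kappa>
  proof -
    have "(\<Sum>B\<in>?F1 \<kappa>. sgn1 B) = (\<Sum>B\<in>?F1 \<kappa>. sgn1 A)" using mono1 that by (intro sum.cong) auto
    then show ?thesis by simp
  qed
  have c2: "(\<Sum>A\<in>?F2 \<kappa>. sgn2 A) = sgn2 A * int (card (?F2 \<kappa>))" if "A \<in> ?F2 \<kappa>" for A \<kappa>
  proof -
    have "(\<Sum>B\<in>?F2 \<kappa>. sgn2 B) = (\<Sum>B\<in>?F2 \<kappa>. sgn2 A)" using mono2 that by (intro sum.cong) auto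
    then show ?thesis by simp
  qed
  have eqF: "(\<Sum>A\<in>?F1 \<kappa>. sgn1 A) = (\<Sum>A\<in>?F2 \<kappa>. sgn2 A)" for \<kappa> using sum1 sum2 eq by simp
  have s1: "sgn1 A = 1 \<or> sgn1 A = -1" if "A \<in> Z1" for A using that Z1 sgn(1) by auto
  have s2: "sgn2 A = 1 \<or> sgn2 A = -1" if "A \<in> Z2" for A using that Z2 sgn(2) by auto
  \<comment> \<open>A nonempty class of constant sign has nonzero sum, so it cannot face an empty
    one.\<close>
  have ne: "?F1 \<kappa> = {} \<longleftrightarrow> ?F2 \<kappa> = {}" for \<kappa>
  proof
    assume e: "?F1 \<kappa> = {}"
    show "?F2 \<kappa> = {}"
    proof (rule ccontr)
      assume n: "?F2 \<kappa> \<noteq> {}"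
      then obtain A where A: "A \<in> ?F2 \<kappa>" by blast
      have "sgn2 A * int (card (?F2 \<kappa>)) = 0" using eqF[of \<kappa>] c2[OF A] e by simp
      moreover have "card (?F2 \<kappa>) \<noteq> 0" using n finF by simp
      ultimately show False using s2[of A] A by auto
    qed
  next
    assume e: "?F2 \<kappa> = {}"
    show "?F1 \<kappa> = {}"
    proof (rule ccontr)
      assume n: "?F1 \<kappa> \<noteq> {}"
      then obtain A where A: "A \<in> ?F1 \<kappa>" by blast
      have "sgn1 A * int (card (?F1 \<kappa>)) = 0" using eqF[of \<kappa>] c1[OF A] e by simp
      moreover have "card (?F1 \<kappa>) \<noteq> 0" using n finF by simp
      ultimately show False using s1[of A] A by auto
    qed
  qed
  have both: "sgn1 A = sgn2 B \<and> card (?F1 \<kappa>) = card (?F2 \<kappa>)" if "A \<in> ?F1 \<kappa>" "B \<in> ?F2 \<kappa>" for A B \<kappa>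
  proof -
    have "sgn1 A * int (card (?F1 \<kappa>)) = sgn2 B * int (card (?F2 \<kappa>))"
      using eqF[of \<kappa>] c1[OF that(1)] c2[OF that(2)] by simp
    moreover have "card (?F1 \<kappa>) > 0" using that(1) finF(1) card_gt_0_iff by blast
    ultimately show ?thesis using s1[of A] s2[of B] that by auto
  qed
  have "card (?F1 \<kappa>) = card (?F2 \<kappa>)" for \<kappa>
  proof (cases "?F1 \<kappa> = {}")
    case True
    then have "?F2 \<kappa> = {}" using ne[of \<kappa>] by blast
    then show ?thesis using True by (simp only: card.empty)
  next
    case False
    then obtain A B where "A \<in> ?F1 \<kappa>" "B \<in> ?F2 \<kappa>" using ne[of \<kappa>] by (meson all_not_in_conv)
    then show ?thesis using both by blast
  qed
  then have "\<exists>g. bij_betw g (?F1 \<kappa>) (?F2 \<kappa>)" for \<kappa>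
    using finF by (intro finite_same_card_bij) auto
  then have "\<exists>g. \<forall>\<kappa>. bij_betw (g \<kappa>) (?F1 \<kappa>) (?F2 \<kappa>)" by (intro choice allI)
  then obtain g where g: "\<And>\<kappa>. bij_betw (g \<kappa>) (?F1 \<kappa>) (?F2 \<kappa>)" by (elim exE) (rule that, erule spec)
  define Y where "Y A = g (key1 A) A" for A
  have YF: "Y A \<in> ?F2 (key1 A)" if "A \<in> Z1" for A
    using bij_betwE[OF g[of "key1 A"]] that by (simp add: Y_def)
  have "bij_betw Y Z1 Z2"
  proof (rule bij_betw_imageI)
    show "inj_on Y Z1"
    proof (rule inj_onI)
      fix A B assume AB: "A \<in> Z1" "B \<in> Z1" "Y A = Y B"
      then have k: "key1 A = key1 B" using YF[of A] YF[of B] by simp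
      then show "A = B"
        using bij_betw_imp_inj_on[OF g[of "key1 A"]] AB by (auto simp: Y_def inj_on_def)
    qed
    show "Y ` Z1 = Z2"
    proof
      show "Y ` Z1 \<subseteq> Z2" using YF by auto
      show "Z2 \<subseteq> Y ` Z1"
      proof
        fix B assume "B \<in> Z2"
        then have "B \<in> g (key2 B) ` ?F1 (key2 B)" using bij_betw_imp_surj_on[OF g[of "key2 B"]] by auto
        then obtain A where "A \<in> Z1" "key1 A = key2 B" "B = g (key2 B) A" by blast
        then show "B \<in> Y ` Z1" by (intro image_eqI[of _ _ A]) (simp_all add: Y_def)
      qed
    qed
  qed
  moreover have "\<forall>A\<in>Z1. key2 (Y A) = key1 A \<and> sgn2 (Y A) = sgn1 A"
  proof
    fix A assume "A \<in> Z1"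
    then show "key2 (Y A) = key1 A \<and> sgn2 (Y A) = sgn1 A"
      using YF[of A] both[of A "key1 A" "Y A"] by simp
  qed
  ultimately show ?thesis by (rule that[OF Z1 Z2 _ _ I1 I2])
qed

section \<open>Admissible subsets\<close>

lemma sorted_list_of_set_Un:
  fixes A B :: "'a::linorder set"
  assumes "finite A" "finite B" "\<And>a b. a \<in> A \<Longrightarrow> b \<in> B \<Longrightarrow> a < b"
  shows "sorted_list_of_set (A \<union> B) = sorted_list_of_set A @ sorted_list_of_set B"
proof -
  let ?xs = "sorted_list_of_set A @ sorted_list_of_set B"
  have "sorted ?xs" "distinct ?xs"
    using assms by (auto simp: sorted_append intro: less_imp_le)
  then have "sorted_list_of_set (set ?xs) = ?xs"
    by (rule sorted_list_of_set.idem_if_sorted_distinct)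
  then show ?thesis using assms(1,2) by simp
qed

lemma path_end_append: "path_end w (xs @ ys) = path_end (path_end w xs) ys"
  by (simp add: path_end_def)

lemma qbg_path_append:
  "qbg_path \<Delta> S w (xs @ ys) \<longleftrightarrow> qbg_path \<Delta> S w xs \<and> qbg_path \<Delta> S (path_end w xs) ys"
  by (induction xs arbitrary: w) (auto simp: path_end_def)

context based_root_system
begin

text \<open>Unlike \<open>labels\<close>, this keeps the signs of the roots, which the coefficients
  need.\<close>

definition entries :: "'a list \<Rightarrow> nat set \<Rightarrow> 'a list" where
  "entries \<Gamma> A = map (\<lambda>j. \<Gamma> ! (j - 1)) (sorted_list_of_set A)"

lemma labels_entries: "labels \<Delta> S \<Gamma> A = map (root_abs \<Delta> S) (entries \<Gamma> A)"
  by (simp add: labels_def entries_def)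

lemma entries_Un:
  assumes "finite A" "finite B" "\<And>a b. a \<in> A \<Longrightarrow> b \<in> B \<Longrightarrow> a < b"
  shows "entries \<Gamma> (A \<union> B) = entries \<Gamma> A @ entries \<Gamma> B"
  by (simp add: entries_def sorted_list_of_set_Un assms)

lemma entries_insert:
  assumes "finite A" "\<And>a. a \<in> A \<Longrightarrow> a < b"
  shows "entries \<Gamma> (insert b A) = entries \<Gamma> A @ [\<Gamma> ! (b - 1)]"
  using entries_Un[of A "{b}" \<Gamma>] assms by (simp add: entries_def)

lemma entries_empty: "entries \<Gamma> {} = []"
  by (simp add: entries_def)

lemma refl_root_abs: "refl (root_abs \<Delta> S \<gamma>) = refl \<gamma>"
  by (simp add: root_abs_def root_sgn_def refl_minus_root)

text \<open>Defined for every list of roots; a list with a step that is not an edge gets weight 0,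
  so sums may run over all subsets.\<close>

fun weight :: "'a \<Rightarrow> ('a \<Rightarrow> 'a) \<Rightarrow> 'a list \<Rightarrow> real" where
  "weight y w [] = 1"
| "weight y w (\<gamma> # \<gamma>s) = qbg_coeff y w \<gamma> * weight y (w \<circ> refl \<gamma>) \<gamma>s"

lemma weight_append:
  "weight y w (xs @ ys) = weight y w xs * weight y (path_end w (map (root_abs \<Delta> S) xs)) ys"
  by (induction xs arbitrary: w) (simp_all add: path_end_def refl_root_abs)

lemma inj_on_insert_Pow: "inj_on (insert (t + q + 1)) (Pow {t + 1..t + q})" for t q :: nat
proof (rule inj_onI)
  fix A B assume "A \<in> Pow {t + 1..t + q}" "B \<in> Pow {t + 1..t + q}"
    and e: "insert (t + q + 1) A = insert (t + q + 1) B"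
  then have "t + q + 1 \<notin> A" "t + q + 1 \<notin> B" by auto
  then show "A = B" using e by (metis insert_ident)
qed

text \<open>Expanding the product of operators, each position is either skipped or used. The last
  position is absorbed into \<open>F\<close>, which therefore varies in the induction.\<close>

lemma foldr_step_op_eq_sum:
  assumes "t + q \<le> length \<Gamma>"
  shows "foldr (step_op (qbg_coeff y)) (take q (drop t \<Gamma>)) F w
    = (\<Sum>B\<in>Pow {t + 1..t + q}. weight y w (entries \<Gamma> B) * F (path_end w (labels \<Delta> S \<Gamma> B)))"
  using assms
proof (induction q arbitrary: F)
  case 0
  then show ?case by (simp add: entries_empty labels_entries path_end_def)
next
  case (Suc q)
  let ?b = "t + q + 1" and ?I = "{t + 1..t + q}" and ?x = "\<Gamma> ! (t + q)"
  let ?h = "\<lambda>B. weight y w (entries \<Gamma> B) * F (path_end w (labels \<Delta> S \<Gamma> B))"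
  have I: "{t + 1..t + Suc q} = insert ?b ?I" by auto
  have take: "take (Suc q) (drop t \<Gamma>) = take q (drop t \<Gamma>) @ [?x]"
    using Suc.prems by (simp add: take_Suc_conv_app_nth)
  have ins: "?h (insert ?b B) = weight y w (entries \<Gamma> B) *
      (qbg_coeff y (path_end w (labels \<Delta> S \<Gamma> B)) ?x * F (path_end w (labels \<Delta> S \<Gamma> B) \<circ> refl ?x))"
    if "B \<in> Pow ?I" for B
  proof -
    have "finite B" "\<And>a. a \<in> B \<Longrightarrow> a < ?b"
      using that finite_subset[of B ?I] by (auto simp: subset_iff)
    from entries_insert[OF this] have e: "entries \<Gamma> (insert ?b B) = entries \<Gamma> B @ [?x]" by simp
    show ?thesis
      unfolding labels_entries e weight_append map_append path_end_append
      by (simp add: path_end_def refl_root_abs)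
  qed
  have "(\<Sum>B\<in>Pow (insert ?b ?I). ?h B) = (\<Sum>B\<in>Pow ?I. ?h B) + (\<Sum>B\<in>insert ?b ` Pow ?I. ?h B)"
    unfolding Pow_insert by (intro sum.union_disjoint) auto
  also have "(\<Sum>B\<in>insert ?b ` Pow ?I. ?h B) = (\<Sum>B\<in>Pow ?I. ?h (insert ?b B))"
  proof (rule sum.reindex_cong[OF _ refl refl])
    show "inj_on (insert ?b) (Pow ?I)" by (rule inj_on_insert_Pow)
  qed
  also have "(\<Sum>B\<in>Pow ?I. ?h B) + (\<Sum>B\<in>Pow ?I. ?h (insert ?b B))
      = (\<Sum>B\<in>Pow ?I. weight y w (entries \<Gamma> B) * step_op (qbg_coeff y) ?x F (path_end w (labels \<Delta> S \<Gamma> B)))"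
    unfolding sum.distrib[symmetric]
    by (intro sum.cong refl) (simp only: ins step_op_def distrib_left)
  also have "\<dots> = foldr (step_op (qbg_coeff y)) (take (Suc q) (drop t \<Gamma>)) F w"
    using Suc unfolding take by simp
  finally show ?case unfolding I ..
qed

lemma not_bruhat_and_quantum: "\<not> (bruhat_edge \<Delta> S w \<gamma> \<and> quantum_edge \<Delta> S w \<gamma>)"
  using quantum_edge_len_less[of w \<gamma>] by (auto simp: bruhat_edge_def)

text \<open>A new largest index appends one step: a negative root changes the parity of
  \<open>neg_count\<close>, a quantum edge adds its coroot to \<open>down\<close>, and a non-edge
  makes both sides 0. No edge is of both kinds, so the coefficient is a single term.\<close>

lemma weight_entries:
  assumes \<Gamma>: "set \<Gamma> \<subseteq> \<Delta>" and A: "A \<subseteq> {1..length \<Gamma>}"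
  shows "weight y w (entries \<Gamma> A) = (if qbg_path \<Delta> S w (labels \<Delta> S \<Gamma> A)
    then (- 1) ^ neg_count \<Delta> S \<Gamma> A * exp (- (y \<bullet> down \<Delta> S w \<Gamma> A)) else 0)"
proof -
  have "finite A" using A by (rule finite_subset) simp
  then show ?thesis using A
  proof (induction A rule: finite_linorder_max_induct)
    case empty
    then show ?case by (simp add: entries_empty labels_entries neg_count_def down_def quantum_steps_def)
  next
    case (insert b A)
    let ?g = "\<Gamma> ! (b - 1)"
    let ?v = "path_end w (labels \<Delta> S \<Gamma> A)"
    have "b - 1 < length \<Gamma>" using insert.prems by auto
    then have gD: "?g \<in> \<Delta>" using \<Gamma> nth_mem by blast
    have bA: "b \<notin> A" using insert.hyps by auto
    have e: "entries \<Gamma> (insert b A) = entries \<Gamma> A @ [?g]"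
      using insert.hyps by (intro entries_insert) auto
    have l: "labels \<Delta> S \<Gamma> (insert b A) = labels \<Delta> S \<Gamma> A @ [root_abs \<Delta> S ?g]"
      by (simp add: labels_entries e)
    \<comment> \<open>The vertex before step \<open>j\<close> depends only on smaller indices, so
      the earlier quantum steps are unaffected by the new one.\<close>
    have lt: "{i \<in> insert b A. i < j} = {i \<in> A. i < j}" if "j \<in> A" for j using that insert.hyps by auto
    have ltb: "{i \<in> insert b A. i < b} = A" using insert.hyps by auto
    have qs: "quantum_steps \<Delta> S w \<Gamma> (insert b A) = quantum_steps \<Delta> S w \<Gamma> A
        \<union> (if quantum_edge \<Delta> S ?v (root_abs \<Delta> S ?g) then {b} else {})"
    proof (rule set_eqI)
      fix j
      consider "j = b" | "j \<in> A" | "j \<noteq> b" "j \<notin> A" by blast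
      then show "j \<in> quantum_steps \<Delta> S w \<Gamma> (insert b A) \<longleftrightarrow> j \<in> quantum_steps \<Delta> S w \<Gamma> A
        \<union> (if quantum_edge \<Delta> S ?v (root_abs \<Delta> S ?g) then {b} else {})"
      proof cases
        case 1
        then show ?thesis using bA unfolding quantum_steps_def mem_Collect_eq 1 ltb by simp
      next
        case 2
        then have "j \<noteq> b" using bA by blast
        then show ?thesis using 2 unfolding quantum_steps_def mem_Collect_eq lt[OF 2] by simp
      qed (simp add: quantum_steps_def)
    qed
    have "finite (quantum_steps \<Delta> S w \<Gamma> A)" "b \<notin> quantum_steps \<Delta> S w \<Gamma> A"
      using insert.hyps bA by (auto simp: quantum_steps_def)
    then have down: "down \<Delta> S w \<Gamma> (insert b A) = down \<Delta> S w \<Gamma> A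
        + (if quantum_edge \<Delta> S ?v (root_abs \<Delta> S ?g) then coroot (root_abs \<Delta> S ?g) else 0)"
      unfolding down_def qs by (simp add: add.commute)
    have "?g \<in> uminus ` pos \<longleftrightarrow> ?g \<notin> pos"
    proof -
      have "?g \<in> uminus ` pos \<longleftrightarrow> - ?g \<in> pos"
      proof
        assume "- ?g \<in> pos"
        then have "- (- ?g) \<in> uminus ` pos" by (rule imageI)
        then show "?g \<in> uminus ` pos" by simp
      qed auto
      then show ?thesis using pos_iff_ht[OF gD] neg_pos_iff_ht[OF gD] ht_root_nonzero[OF gD] by linarith
    qed
    moreover have "{j \<in> insert b A. \<Gamma> ! (j - 1) \<in> uminus ` pos}
        = {j \<in> A. \<Gamma> ! (j - 1) \<in> uminus ` pos} \<union> (if ?g \<in> uminus ` pos then {b} else {})" by auto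
    ultimately have nc: "(- 1) ^ neg_count \<Delta> S \<Gamma> (insert b A) = (- 1) ^ neg_count \<Delta> S \<Gamma> A * root_sgn \<Delta> S ?g"
      using bA insert.hyps by (simp add: neg_count_def root_sgn_def)
    have IH: "weight y w (entries \<Gamma> A) = (if qbg_path \<Delta> S w (labels \<Delta> S \<Gamma> A)
      then (- 1) ^ neg_count \<Delta> S \<Gamma> A * exp (- (y \<bullet> down \<Delta> S w \<Gamma> A)) else 0)"
      using insert by simp
    have exp_sum: "exp (- (y \<bullet> (c + d))) = exp (- (y \<bullet> c)) * exp (- (y \<bullet> d))" for c d
      by (simp add: inner_add_right exp_add[symmetric])
    have "weight y w (entries \<Gamma> (insert b A)) = weight y w (entries \<Gamma> A) * qbg_coeff y ?v ?g"
      by (simp add: e weight_append labels_entries)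
    then show ?case
      unfolding IH l qbg_path_append down nc
      using not_bruhat_and_quantum[of ?v "root_abs \<Delta> S ?g"]
      by (cases "bruhat_edge \<Delta> S ?v (root_abs \<Delta> S ?g)"; cases "quantum_edge \<Delta> S ?v (root_abs \<Delta> S ?g)")
        (simp_all add: qbg_coeff_def Let_def exp_sum)
  qed
qed

lemma split_parts:
  assumes "t + q \<le> r" "A1 \<subseteq> {1..t}" "A3 \<subseteq> {t + q + 1..r}"
  shows "{A \<in> Pow {1..r}. part1 t A = A1 \<and> part3 t q r A = A3} = (\<lambda>B. A1 \<union> B \<union> A3) ` Pow {t + 1..t + q}"
    (is "?L = ?f ` ?P")
proof
  show "?L \<subseteq> ?f ` ?P"
  proof
    fix A assume A: "A \<in> ?L"
    have "{1..r} = {1..t} \<union> {t + 1..t + q} \<union> {t + q + 1..r}" using assms(1) by auto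
    then have "A = A1 \<union> (A \<inter> {t + 1..t + q}) \<union> A3" using A by (auto simp: part1_def part3_def)
    then show "A \<in> ?f ` ?P" by blast
  qed
  show "?f ` ?P \<subseteq> ?L"
  proof
    fix A assume "A \<in> ?f ` ?P"
    then obtain B where B: "B \<subseteq> {t + 1..t + q}" "A = A1 \<union> B \<union> A3" by auto
    have d: "{t + 1..t + q} \<inter> {1..t} = {}" "{t + q + 1..r} \<inter> {1..t} = {}"
      "{1..t} \<inter> {t + q + 1..r} = {}" "{t + 1..t + q} \<inter> {t + q + 1..r} = {}" by auto
    have "A \<subseteq> {1..r}" using B assms by (auto simp: subset_iff) 
    moreover have "A \<inter> {1..t} = A1" "A \<inter> {t + q + 1..r} = A3" unfolding B using B(1) assms(2,3) d by blast+
    ultimately show "A \<in> ?L" by (simp add: part1_def part3_def)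
  qed
qed

text \<open>The weight of \<open>A1 \<union> B \<union> A3\<close> factors at the ends of the first
  two parts. Fixing the vertex \<open>e\<close> makes the last factor constant, and the sum over
  \<open>B\<close> is the operator product applied to the indicator of \<open>e\<close>.\<close>

lemma signed_sum_admissible:
  assumes \<Gamma>: "set \<Gamma> \<subseteq> \<Delta>" "length \<Gamma> = r" and tq: "t + q \<le> r"
    and A13: "A1 \<subseteq> {1..t}" "A3 \<subseteq> {t + q + 1..r}"
  shows "(\<Sum>A\<in>{A \<in> admissible \<Delta> S w \<Gamma>. part1 t A = A1 \<and> end2 \<Delta> S w \<Gamma> t q A = e \<and> part3 t q r A = A3}.
      (- 1) ^ neg_count \<Delta> S \<Gamma> A * exp (- (y \<bullet> down \<Delta> S w \<Gamma> A)))
    = weight y w (entries \<Gamma> A1) * foldr (step_op (qbg_coeff y)) (take q (drop t \<Gamma>)) (\<lambda>v. of_bool (v = e))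
        (path_end w (labels \<Delta> S \<Gamma> A1)) * weight y e (entries \<Gamma> A3)" (is "?lhs = ?rhs")
proof -
  let ?P = "Pow {t + 1..t + q}" and ?w = "path_end w (labels \<Delta> S \<Gamma> A1)"
  let ?X = "{A \<in> Pow {1..r}. part1 t A = A1 \<and> part3 t q r A = A3}"
  let ?h = "\<lambda>A. weight y w (entries \<Gamma> A) * of_bool (end2 \<Delta> S w \<Gamma> t q A = e)"
  have fin: "finite A1" "finite A3" using finite_subset[OF A13(1)] finite_subset[OF A13(2)] by simp_all
  \<comment> \<open>Inadmissible subsets have weight 0, and the indicator removes the other end
    vertices.\<close>
  have "?lhs = (\<Sum>A\<in>?X. ?h A)"
  proof (rule sum.mono_neutral_cong_left)
    show "finite ?X" by simp
    show "{A \<in> admissible \<Delta> S w \<Gamma>. part1 t A = A1 \<and> end2 \<Delta> S w \<Gamma> t q A = e \<and> part3 t q r A = A3} \<subseteq> ?X"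
      using \<Gamma>(2) by (auto simp: admissible_def)
    show "\<forall>A\<in>?X - {A \<in> admissible \<Delta> S w \<Gamma>. part1 t A = A1 \<and> end2 \<Delta> S w \<Gamma> t q A = e \<and> part3 t q r A = A3}. ?h A = 0"
      using \<Gamma> by (auto simp: admissible_def weight_entries)
    show "(- 1) ^ neg_count \<Delta> S \<Gamma> A * exp (- (y \<bullet> down \<Delta> S w \<Gamma> A)) = ?h A"
      if "A \<in> {A \<in> admissible \<Delta> S w \<Gamma>. part1 t A = A1 \<and> end2 \<Delta> S w \<Gamma> t q A = e \<and> part3 t q r A = A3}" for A
      using that \<Gamma> by (auto simp: admissible_def weight_entries)
  qed
  also have "\<dots> = (\<Sum>B\<in>?P. ?h (A1 \<union> B \<union> A3))"
    unfolding split_parts[OF tq A13]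
  proof (rule sum.reindex_cong[OF _ refl refl])
    show "inj_on (\<lambda>B. A1 \<union> B \<union> A3) ?P"
    proof (rule inj_onI)
      fix B B' assume B: "B \<in> ?P" "B' \<in> ?P" "A1 \<union> B \<union> A3 = A1 \<union> B' \<union> A3"
      have "A1 \<inter> {t + 1..t + q} = {}" "A3 \<inter> {t + 1..t + q} = {}" using A13 by fastforce+
      then have "(A1 \<union> C \<union> A3) \<inter> {t + 1..t + q} = C" if "C \<in> ?P" for C using that by blast
      then show "B = B'" using B by metis
    qed
  qed
  also have "\<dots> = (\<Sum>B\<in>?P. weight y w (entries \<Gamma> A1) *
      (weight y ?w (entries \<Gamma> B) * of_bool (path_end ?w (labels \<Delta> S \<Gamma> B) = e)) * weight y e (entries \<Gamma> A3))"
  proof (rule sum.cong[OF refl])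
    fix B assume B: "B \<in> ?P"
    then have fB: "finite B" using finite_subset[of B "{t + 1..t + q}"] by simp
    have e12: "entries \<Gamma> (A1 \<union> B) = entries \<Gamma> A1 @ entries \<Gamma> B"
      using B A13 fin fB by (intro entries_Un) (auto dest!: subsetD)
    have e123: "entries \<Gamma> (A1 \<union> B \<union> A3) = entries \<Gamma> (A1 \<union> B) @ entries \<Gamma> A3"
      using B A13 fin fB by (intro entries_Un) (auto dest!: subsetD)
    have d: "A1 \<inter> {t + 1..t + q} = {}" "A3 \<inter> {t + 1..t + q} = {}" using A13 by fastforce+
    have "A1 \<union> B \<union> A3 \<in> ?X" unfolding split_parts[OF tq A13] using B by blast
    then have p1: "part1 t (A1 \<union> B \<union> A3) = A1" by simp
    have "part2 t q (A1 \<union> B \<union> A3) = B" using B d by (auto simp: part2_def)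
    then have "end2 \<Delta> S w \<Gamma> t q (A1 \<union> B \<union> A3) = path_end ?w (labels \<Delta> S \<Gamma> B)"
      by (simp add: end2_def p1 labels_entries e12 path_end_append)
    then show "?h (A1 \<union> B \<union> A3) = weight y w (entries \<Gamma> A1) *
      (weight y ?w (entries \<Gamma> B) * of_bool (path_end ?w (labels \<Delta> S \<Gamma> B) = e)) * weight y e (entries \<Gamma> A3)"
      by (auto simp: e123 e12 weight_append labels_entries path_end_append)
  qed
  also have "\<dots> = ?rhs"
    unfolding foldr_step_op_eq_sum[OF tq[folded \<Gamma>(2)]] sum_distrib_left sum_distrib_right ..
  finally show ?thesis .
qed

lemma path_end_weyl: "w \<in> W \<Longrightarrow> set \<gamma>s \<subseteq> \<Delta> \<Longrightarrow> path_end w \<gamma>s \<in> W"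
  by (induction \<gamma>s arbitrary: w) (auto simp: path_end_def weyl_refl)

lemma root_abs_root: "\<gamma> \<in> \<Delta> \<Longrightarrow> root_abs \<Delta> S \<gamma> \<in> \<Delta>"
  by (simp add: root_abs_def root_sgn_def neg_root)

lemma labels_roots:
  assumes "set \<Gamma> \<subseteq> \<Delta>" "A \<subseteq> {1..length \<Gamma>}"
  shows "set (labels \<Delta> S \<Gamma> A) \<subseteq> \<Delta>"
proof -
  have "finite A" using assms(2) by (rule finite_subset) simp
  moreover have "root_abs \<Delta> S (\<Gamma> ! (j - 1)) \<in> \<Delta>" if "j \<in> A" for j
  proof -
    have "j \<in> {1..length \<Gamma>}" using that assms(2) by blast
    then have "j - 1 < length \<Gamma>" by auto
    then show ?thesis using assms(1) root_abs_root nth_mem by blast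
  qed
  ultimately show ?thesis by (auto simp: labels_def)
qed

lemma entries_cong: "(\<And>j. j \<in> A \<Longrightarrow> \<Gamma> ! (j - 1) = \<Gamma>' ! (j - 1)) \<Longrightarrow> finite A \<Longrightarrow> entries \<Gamma> A = entries \<Gamma>' A"
  by (simp add: entries_def)

section \<open>Comparison of a chain with its Yang--Baxter transform\<close>

context
  fixes \<Gamma>1 \<Gamma>2 :: "'a list" and t q r :: nat and w :: "'a \<Rightarrow> 'a"
  assumes \<Gamma>1: "set \<Gamma>1 \<subseteq> \<Delta>" "length \<Gamma>1 = r" and tq: "t + q \<le> r" and w: "w \<in> W"
    and yb: "yb_equation (take q (drop t \<Gamma>1))"
    and \<Gamma>2: "\<Gamma>2 = take t \<Gamma>1 @ rev (take q (drop t \<Gamma>1)) @ drop (t + q) \<Gamma>1"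
begin

text \<open>All that the bijection and the involutions must preserve, apart from the sign.\<close>

definition key :: "'a list \<Rightarrow> nat set \<Rightarrow> nat set \<times> ('a \<Rightarrow> 'a) \<times> nat set \<times> 'a" where
  "key \<Gamma> A = (part1 t A, end2 \<Delta> S w \<Gamma> t q A, part3 t q r A, down \<Delta> S w \<Gamma> A)"

lemma \<Gamma>2_props: "set \<Gamma>2 \<subseteq> \<Delta>" "length \<Gamma>2 = r" "take q (drop t \<Gamma>2) = rev (take q (drop t \<Gamma>1))"
proof -
  show "set \<Gamma>2 \<subseteq> \<Delta>"
    using \<Gamma>1(1) set_take_subset set_drop_subset unfolding \<Gamma>2 by (fastforce dest: in_set_takeD in_set_dropD)
  show "length \<Gamma>2 = r" using \<Gamma>1(2) tq by (simp add: \<Gamma>2)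
  show "take q (drop t \<Gamma>2) = rev (take q (drop t \<Gamma>1))" using \<Gamma>1(2) tq by (simp add: \<Gamma>2)
qed

lemma entries_\<Gamma>2:
  "A \<subseteq> {1..t} \<Longrightarrow> entries \<Gamma>2 A = entries \<Gamma>1 A"
  "A \<subseteq> {t + q + 1..r} \<Longrightarrow> entries \<Gamma>2 A = entries \<Gamma>1 A"
proof -
  assume A: "A \<subseteq> {1..t}"
  show "entries \<Gamma>2 A = entries \<Gamma>1 A"
  proof (rule entries_cong)
    fix j assume "j \<in> A"
    then have "j \<in> {1..t}" using A by blast
    then have "j - 1 < t" by auto
    then show "\<Gamma>2 ! (j - 1) = \<Gamma>1 ! (j - 1)" using \<Gamma>1(2) tq by (simp add: \<Gamma>2 nth_append)
  qed (use A finite_subset in blast)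
next
  assume A: "A \<subseteq> {t + q + 1..r}"
  show "entries \<Gamma>2 A = entries \<Gamma>1 A"
  proof (rule entries_cong)
    fix j assume "j \<in> A"
    then have "j \<in> {t + q + 1..r}" using A by blast
    then have j: "t + q \<le> j - 1" by auto
    let ?P = "take t \<Gamma>1 @ rev (take q (drop t \<Gamma>1))"
    have "length ?P = t + q" using \<Gamma>1(2) tq by simp
    then have "(?P @ drop (t + q) \<Gamma>1) ! (j - 1) = drop (t + q) \<Gamma>1 ! (j - 1 - (t + q))"
      using j by (simp only: nth_append not_less[symmetric] if_False)
    then have "\<Gamma>2 ! (j - 1) = drop (t + q) \<Gamma>1 ! (j - 1 - (t + q))"
      by (simp only: \<Gamma>2 append_assoc)
    then show "\<Gamma>2 ! (j - 1) = \<Gamma>1 ! (j - 1)"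
      using nth_drop[of "t + q" \<Gamma>1 "j - 1 - (t + q)"] le_add_diff_inverse[OF j] \<Gamma>1(2) tq by (simp only:)
  qed (use A finite_subset in blast)
qed

text \<open>The chains agree outside the segment, so the two outer factors coincide, and the middle
  factors agree by \<open>quantum_yang_baxter\<close>.\<close>

lemma signed_exp_sum_eq:
  "(\<Sum>A\<in>{A \<in> admissible \<Delta> S w \<Gamma>1. part1 t A = A1 \<and> end2 \<Delta> S w \<Gamma>1 t q A = e \<and> part3 t q r A = A3}.
      (- 1) ^ neg_count \<Delta> S \<Gamma>1 A * exp (- (y \<bullet> down \<Delta> S w \<Gamma>1 A)))
    = (\<Sum>A\<in>{A \<in> admissible \<Delta> S w \<Gamma>2. part1 t A = A1 \<and> end2 \<Delta> S w \<Gamma>2 t q A = e \<and> part3 t q r A = A3}.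
      (- 1) ^ neg_count \<Delta> S \<Gamma>2 A * exp (- (y \<bullet> down \<Delta> S w \<Gamma>2 A)))"
proof (cases "A1 \<subseteq> {1..t} \<and> A3 \<subseteq> {t + q + 1..r}")
  case True
  then have A13: "A1 \<subseteq> {1..t}" "A3 \<subseteq> {t + q + 1..r}" by auto
  have "A1 \<subseteq> {1..length \<Gamma>1}" using A13(1) tq \<Gamma>1(2) by auto
  then have v: "path_end w (labels \<Delta> S \<Gamma>1 A1) \<in> W"
    by (intro path_end_weyl w labels_roots \<Gamma>1(1))
  have L: "set (take q (drop t \<Gamma>1)) \<subseteq> \<Delta>"
    using \<Gamma>1(1) by (meson in_set_dropD in_set_takeD subset_iff)
  show ?thesis
    unfolding signed_sum_admissible[OF \<Gamma>1 tq A13] signed_sum_admissible[OF \<Gamma>2_props(1,2) tq A13]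
      \<Gamma>2_props(3) labels_entries entries_\<Gamma>2(1)[OF A13(1)] entries_\<Gamma>2(2)[OF A13(2)]
      quantum_yang_baxter[OF yb L v[unfolded labels_entries]] ..
next
  case False
  \<comment> \<open>With \<open>A1\<close> or \<open>A3\<close> out of range, both sums are
    empty.\<close>
  then have "{A \<in> admissible \<Delta> S w \<Gamma>. part1 t A = A1 \<and> end2 \<Delta> S w \<Gamma> t q A = e \<and> part3 t q r A = A3} = {}" for \<Gamma>
    by (auto simp: part1_def part3_def)
  then show ?thesis by (simp only: sum.empty)
qed

lemma finite_admissible: "finite (admissible \<Delta> S w \<Gamma>)"
  by (rule finite_subset[of _ "Pow {1..length \<Gamma>}"]) (auto simp: admissible_def)

text \<open>The exponential sums agree for every \<open>y\<close>; independence of the exponentials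
  separates the values of \<open>down\<close>, and the coefficients are the signed counts.\<close>

lemma signed_count_eq:
  "(\<Sum>A\<in>{A \<in> admissible \<Delta> S w \<Gamma>1. key \<Gamma>1 A = \<kappa>}. (- 1 :: int) ^ neg_count \<Delta> S \<Gamma>1 A)
    = (\<Sum>A\<in>{A \<in> admissible \<Delta> S w \<Gamma>2. key \<Gamma>2 A = \<kappa>}. (- 1) ^ neg_count \<Delta> S \<Gamma>2 A)"
proof -
  obtain A1 e A3 d where \<kappa>: "\<kappa> = (A1, e, A3, d)" by (cases \<kappa>) auto
  let ?X = "\<lambda>\<Gamma>. {A \<in> admissible \<Delta> S w \<Gamma>. part1 t A = A1 \<and> end2 \<Delta> S w \<Gamma> t q A = e \<and> part3 t q r A = A3}"
  \<comment> \<open>One finite set of exponents for both chains; a value outside it has count 0 on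
    either side.\<close>
  define D where "D = down \<Delta> S w \<Gamma>1 ` ?X \<Gamma>1 \<union> down \<Delta> S w \<Gamma>2 ` ?X \<Gamma>2"
  define n where "n \<Gamma> d = (\<Sum>A\<in>{A \<in> ?X \<Gamma>. down \<Delta> S w \<Gamma> A = d}. (- 1 :: real) ^ neg_count \<Delta> S \<Gamma> A)" for \<Gamma> d
  have fX: "finite (?X \<Gamma>)" for \<Gamma> using finite_admissible[of \<Gamma>] by simp
  have fD: "finite D" unfolding D_def using fX by blast
  have group: "(\<Sum>d\<in>D. n \<Gamma> d * exp (- (y \<bullet> d))) = (\<Sum>A\<in>?X \<Gamma>. (- 1) ^ neg_count \<Delta> S \<Gamma> A * exp (- (y \<bullet> down \<Delta> S w \<Gamma> A)))"
    if "\<Gamma> \<in> {\<Gamma>1, \<Gamma>2}" for y \<Gamma>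
  proof -
    have "(\<Sum>d\<in>D. n \<Gamma> d * exp (- (y \<bullet> d)))
      = (\<Sum>d\<in>D. \<Sum>A\<in>{A \<in> ?X \<Gamma>. down \<Delta> S w \<Gamma> A = d}. (- 1) ^ neg_count \<Delta> S \<Gamma> A * exp (- (y \<bullet> down \<Delta> S w \<Gamma> A)))"
      unfolding n_def sum_distrib_right by (intro sum.cong refl) simp
    also have "\<dots> = (\<Sum>A\<in>?X \<Gamma>. (- 1) ^ neg_count \<Delta> S \<Gamma> A * exp (- (y \<bullet> down \<Delta> S w \<Gamma> A)))"
      using that by (intro sum.group fX fD) (auto simp: D_def)
    finally show ?thesis .
  qed
  have "(\<Sum>d\<in>D. (n \<Gamma>1 d - n \<Gamma>2 d) * exp (- (y \<bullet> d))) = 0" for y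
    using signed_exp_sum_eq[of y A1 e A3] group[of \<Gamma>1 y] group[of \<Gamma>2 y]
    by (simp only: left_diff_distrib sum_subtractf insert_iff simp_thms diff_self)
  from exponentials_independent[OF fD this] have D: "n \<Gamma>1 d = n \<Gamma>2 d" if "d \<in> D" for d
    using that by fastforce
  have "n \<Gamma>1 d = n \<Gamma>2 d"
  proof (cases "d \<in> D")
    case False
    then have "{A \<in> ?X \<Gamma>1. down \<Delta> S w \<Gamma>1 A = d} = {}" "{A \<in> ?X \<Gamma>2. down \<Delta> S w \<Gamma>2 A = d} = {}"
      by (auto simp: D_def)
    then show ?thesis unfolding n_def by (simp only: sum.empty)
  qed (rule D)
  moreover have "{A \<in> admissible \<Delta> S w \<Gamma>. key \<Gamma> A = \<kappa>} = {A \<in> ?X \<Gamma>. down \<Delta> S w \<Gamma> A = d}" for \<Gamma>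
    by (auto simp: key_def \<kappa>)
  ultimately have "real_of_int (\<Sum>A\<in>{A \<in> admissible \<Delta> S w \<Gamma>1. key \<Gamma>1 A = \<kappa>}. (- 1) ^ neg_count \<Delta> S \<Gamma>1 A)
    = real_of_int (\<Sum>A\<in>{A \<in> admissible \<Delta> S w \<Gamma>2. key \<Gamma>2 A = \<kappa>}. (- 1) ^ neg_count \<Delta> S \<Gamma>2 A)"
    by (simp only: n_def of_int_sum of_int_power of_int_minus of_int_1)
  then show ?thesis by (simp only: of_int_eq_iff)
qed

lemma admissible_matching:
  obtains A01 A02 Y I1 I2 where
    "A01 \<subseteq> admissible \<Delta> S w \<Gamma>1" "A02 \<subseteq> admissible \<Delta> S w \<Gamma>2" "bij_betw Y A01 A02"
    "\<forall>A\<in>A01. key \<Gamma>2 (Y A) = key \<Gamma>1 A \<and> (-1 :: int) ^ neg_count \<Delta> S \<Gamma>2 (Y A) = (-1) ^ neg_count \<Delta> S \<Gamma>1 A"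
    "\<forall>A\<in>admissible \<Delta> S w \<Gamma>1 - A01. I1 A \<in> admissible \<Delta> S w \<Gamma>1 - A01 \<and> I1 (I1 A) = A \<and> key \<Gamma>1 (I1 A) = key \<Gamma>1 A
      \<and> (-1 :: int) ^ neg_count \<Delta> S \<Gamma>1 (I1 A) = - ((-1) ^ neg_count \<Delta> S \<Gamma>1 A)"
    "\<forall>A\<in>admissible \<Delta> S w \<Gamma>2 - A02. I2 A \<in> admissible \<Delta> S w \<Gamma>2 - A02 \<and> I2 (I2 A) = A \<and> key \<Gamma>2 (I2 A) = key \<Gamma>2 A
      \<and> (-1 :: int) ^ neg_count \<Delta> S \<Gamma>2 (I2 A) = - ((-1) ^ neg_count \<Delta> S \<Gamma>2 A)"
proof -
  have "\<forall>A\<in>X. (-1 :: int) ^ neg_count \<Delta> S \<Gamma> A \<in> {1, -1}" for X \<Gamma>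
    using minus_one_power_iff[where 'a = int] by simp
  from signed_matching[OF finite_admissible finite_admissible this this signed_count_eq] that
  show ?thesis by blast
qed

end
end

theorem theorem3p2:
  fixes \<Delta> S :: "'a::euclidean_space set"
    and \<mu> \<alpha> \<beta> :: 'a
    and \<Gamma>1 \<Gamma>2 :: "'a list"
    and t q r :: nat
    and w :: "'a \<Rightarrow> 'a"
  assumes "irreducible_root_system \<Delta> \<or> root_system_A1xA1 \<Delta>"
    and "simple_roots \<Delta> S"
    and "\<mu> \<in> weight_lattice S"
    and "weight_chain \<Delta> S \<mu> \<Gamma>1"
    and "length \<Gamma>1 = r"
    and "q \<ge> 1" and "t + q \<le> r"
    and "\<alpha> \<in> \<Delta>" and "\<beta> \<in> \<Delta>"
    and "\<alpha> \<bullet> coroot \<beta> \<le> 0" and "\<alpha> \<noteq> - \<beta>"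
    and "take q (drop t \<Gamma>1) = yb_segment \<alpha> \<beta>"
    and "\<Gamma>2 = take t \<Gamma>1 @ rev (take q (drop t \<Gamma>1)) @ drop (t + q) \<Gamma>1"
    and "w \<in> weyl_group \<Delta>"
  shows "\<exists>A01 A02.
    A01 \<subseteq> admissible \<Delta> S w \<Gamma>1 \<and> A02 \<subseteq> admissible \<Delta> S w \<Gamma>2 \<and>
    (\<exists>Y. bij_betw Y A01 A02 \<and>
      (\<forall>A\<in>A01.
        part1 t (Y A) = part1 t A \<and>
        end2 \<Delta> S w \<Gamma>2 t q (Y A) = end2 \<Delta> S w \<Gamma>1 t q A \<and>
        part3 t q r (Y A) = part3 t q r A \<and>
        down \<Delta> S w \<Gamma>2 (Y A) = down \<Delta> S w \<Gamma>1 A \<and>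
        (-1 :: int) ^ neg_count \<Delta> S \<Gamma>2 (Y A) = (-1) ^ neg_count \<Delta> S \<Gamma>1 A)) \<and>
    (\<forall>(\<Gamma>, A0) \<in> {(\<Gamma>1, A01), (\<Gamma>2, A02)}.
      \<exists>I. (\<forall>A \<in> admissible \<Delta> S w \<Gamma> - A0.
        I A \<in> admissible \<Delta> S w \<Gamma> - A0 \<and> I (I A) = A \<and>
        part1 t (I A) = part1 t A \<and>
        end2 \<Delta> S w \<Gamma> t q (I A) = end2 \<Delta> S w \<Gamma> t q A \<and>
        part3 t q r (I A) = part3 t q r A \<and>
        down \<Delta> S w \<Gamma> (I A) = down \<Delta> S w \<Gamma> A \<and>
        (-1 :: int) ^ neg_count \<Delta> S \<Gamma> (I A) = - ((-1) ^ neg_count \<Delta> S \<Gamma> A)))"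
proof -
  have "root_system \<Delta>"
    using assms(1) by (auto simp: irreducible_root_system_def root_system_A1xA1_def)
  then interpret based_root_system \<Delta> S
    using assms(2) by unfold_locales
  have \<Gamma>1: "set \<Gamma>1 \<subseteq> \<Delta>" using assms(4) by (simp add: weight_chain_def)
  have yb: "yb_equation (take q (drop t \<Gamma>1))"
    unfolding assms(12) using assms(8-11) by (rule yb_equation_yb_segment)
  obtain A01 A02 Y I1 I2 where sub: "A01 \<subseteq> admissible \<Delta> S w \<Gamma>1" "A02 \<subseteq> admissible \<Delta> S w \<Gamma>2"
    and Y: "bij_betw Y A01 A02"
    "\<forall>A\<in>A01. key t q r w \<Gamma>2 (Y A) = key t q r w \<Gamma>1 A \<and> (-1 :: int) ^ neg_count \<Delta> S \<Gamma>2 (Y A) = (-1) ^ neg_count \<Delta> S \<Gamma>1 A"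
    and I1: "\<forall>A\<in>admissible \<Delta> S w \<Gamma>1 - A01. I1 A \<in> admissible \<Delta> S w \<Gamma>1 - A01 \<and> I1 (I1 A) = A \<and> key t q r w \<Gamma>1 (I1 A) = key t q r w \<Gamma>1 A
      \<and> (-1 :: int) ^ neg_count \<Delta> S \<Gamma>1 (I1 A) = - ((-1) ^ neg_count \<Delta> S \<Gamma>1 A)"
    and I2: "\<forall>A\<in>admissible \<Delta> S w \<Gamma>2 - A02. I2 A \<in> admissible \<Delta> S w \<Gamma>2 - A02 \<and> I2 (I2 A) = A \<and> key t q r w \<Gamma>2 (I2 A) = key t q r w \<Gamma>2 A
      \<and> (-1 :: int) ^ neg_count \<Delta> S \<Gamma>2 (I2 A) = - ((-1) ^ neg_count \<Delta> S \<Gamma>2 A)"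
    using admissible_matching[OF \<Gamma>1 assms(5,7,14) yb assms(13)] by blast
  show ?thesis
  proof (rule exI[where x = A01], rule exI[where x = A02], intro conjI sub)
    show "\<exists>Y. bij_betw Y A01 A02 \<and> (\<forall>A\<in>A01. part1 t (Y A) = part1 t A \<and>
        end2 \<Delta> S w \<Gamma>2 t q (Y A) = end2 \<Delta> S w \<Gamma>1 t q A \<and> part3 t q r (Y A) = part3 t q r A \<and>
        down \<Delta> S w \<Gamma>2 (Y A) = down \<Delta> S w \<Gamma>1 A \<and>
        (-1 :: int) ^ neg_count \<Delta> S \<Gamma>2 (Y A) = (-1) ^ neg_count \<Delta> S \<Gamma>1 A)"
      using Y(2) unfolding key_def[OF \<Gamma>1 assms(5,7,14) yb assms(13)] prod.inject
      by (intro exI[of _ Y] conjI Y(1)) (simp only: conj_assoc)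
    let ?inv = "\<lambda>\<Gamma> A0 I. \<forall>A \<in> admissible \<Delta> S w \<Gamma> - A0.
        I A \<in> admissible \<Delta> S w \<Gamma> - A0 \<and> I (I A) = A \<and>
        part1 t (I A) = part1 t A \<and>
        end2 \<Delta> S w \<Gamma> t q (I A) = end2 \<Delta> S w \<Gamma> t q A \<and>
        part3 t q r (I A) = part3 t q r A \<and>
        down \<Delta> S w \<Gamma> (I A) = down \<Delta> S w \<Gamma> A \<and>
        (-1 :: int) ^ neg_count \<Delta> S \<Gamma> (I A) = - ((-1) ^ neg_count \<Delta> S \<Gamma> A)"
    have "?inv \<Gamma>1 A01 I1" "?inv \<Gamma>2 A02 I2"
      using I1 I2 unfolding key_def[OF \<Gamma>1 assms(5,7,14) yb assms(13)] prod.inject conj_assoc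
      by (simp_all only:)
    then show "\<forall>(\<Gamma>, A0) \<in> {(\<Gamma>1, A01), (\<Gamma>2, A02)}. \<exists>I. ?inv \<Gamma> A0 I"
      unfolding ball_simps case_prod_conv by (intro conjI TrueI exI)
  qed
qed

end
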